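(* Let $X$ be a Banach space with $n(X)=1$. If $X$ has the Radon-Nikodým property, or $X$ is an Asplund space, or $X$ does not contain $\ell_1$, or $X$ has the convex point of continuity property, then $n_L(X)=1$.
   Context: $X$ is a Banach space over $\mathbb{K}=\mathbb{R}$ or $\mathbb{C}$. $n(X)=1$ ($X$ has numerical index $1$) means that every bounded linear operator $T:X\to X$ satisfies $\sup\{|x^*(Tx)|:x\in S_X,\ x^*\in S_{X^*},\ x^*(x)=1\}=\|T\|$. $\operatorname{Lip}(X)$ is the space of Lipschitz maps $T:X\to X$ (not necessarily linear), with $\|T\|=\sup\left\{\frac{\|T(x_1)-T(x_2)\|}{\|x_1-x_2\|}:x_1\neq x_2\in X\right\}$ (formally modulo constants, or with $T(0)=0$). For $T\in\operatorname{Lip}(X)$, $$V(T):=\left\{\frac{f(Tx-Ty)}{\|x-y\|^2}: x,y\in X,\ x\neq y,\ f\in X^*,\ \operatorname{Re}f(x-y)=\|f\|\,\|x-y\|=\|x-y\|^2\right\},$$ $v(T)=\sup\{|\lambda|:\lambda\in V(T)\}$, and the Lipschitz numerical index is $n_L(X)=\inf\{v(T):T\in\operatorname{Lip}(X),\ \|T\|=1\}$. "$X$ does not contain $\ell_1$" means no closed subspace of $X$ is isomorphic to $\ell_1$. $X$ has the convex point of continuity property if every non-empty closed bounded convex set $D\subset X$ contains a point at which the identity map $(D,\text{weak})\to(D,\|\cdot\|)$ is continuous. *)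

theory Defs
  imports "HOL-Analysis.Analysis"
begin

section \<open>Banach spaces over the real or the complex field\<close>

text \<open>
  The class of scalar fields: up to an isometric field isomorphism, exactly the real and the
  complex numbers. The map \<open>cplx\<close> is the canonical embedding into the complex numbers; it
  provides real parts of scalars.
\<close>

class real_or_complex = real_normed_field +
  fixes cplx :: "'a \<Rightarrow> complex"
  assumes cplx_add: "cplx (a + b) = cplx a + cplx b"
    and cplx_mult: "cplx (a * b) = cplx a * cplx b"
    and cplx_one: "cplx 1 = 1"
    and cplx_scaleR: "cplx (r *\<^sub>R a) = r *\<^sub>R cplx a"
    and norm_cplx: "norm (cplx a) = norm a"
    and range_cplx: "range cplx = \<real> \<or> range cplx = UNIV"

instantiation real :: real_or_complex
begin
definition cplx_real :: "real \<Rightarrow> complex" where "cplx_real = complex_of_real"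
instance by standard (auto simp: cplx_real_def Reals_def scaleR_conv_of_real)
end

instantiation complex :: real_or_complex
begin
definition cplx_complex :: "complex \<Rightarrow> complex" where "cplx_complex = (\<lambda>z. z)"
instance by standard (auto simp: cplx_complex_def)
end

definition re :: "'k::real_or_complex \<Rightarrow> real" where
  "re c = Re (cplx c)"

lemma re_real: "re (r::real) = r"
  by (simp add: re_def cplx_real_def)

lemma re_complex: "re (z::complex) = Re z"
  by (simp add: re_def cplx_complex_def)

text \<open>
  The type classes of normed and Banach spaces provide the underlying real structure; a space over
  \<open>'k\<close> carries in addition a compatible scalar multiplication by elements of \<open>'k\<close>.
\<close>

locale normed_space_over = vector_space smul
  for smul :: "'k::real_or_complex \<Rightarrow> 'a::real_normed_vector \<Rightarrow> 'a" +
  assumes scale_of_real: "smul (of_real r) x = r *\<^sub>R x"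
    and norm_scale: "norm (smul c x) = norm c * norm x"

lemma normed_space_over_scaleR:
  "normed_space_over (scaleR :: real \<Rightarrow> 'a::real_normed_vector \<Rightarrow> 'a)"
  by unfold_locales (auto simp: algebra_simps)

lemma normed_space_over_mult:
  "normed_space_over ((*) :: 'k::real_or_complex \<Rightarrow> 'k \<Rightarrow> 'k)"
  by unfold_locales (auto simp: algebra_simps norm_mult scaleR_conv_of_real)

definition bounded_linear_over ::
    "('k::real_or_complex \<Rightarrow> 'a::real_normed_vector \<Rightarrow> 'a) \<Rightarrow>
     ('k \<Rightarrow> 'b::real_normed_vector \<Rightarrow> 'b) \<Rightarrow> ('a \<Rightarrow> 'b) \<Rightarrow> bool" where
  "bounded_linear_over s1 s2 f \<longleftrightarrow>
     Vector_Spaces.linear s1 s2 f \<and> (\<exists>K. \<forall>x. norm (f x) \<le> norm x * K)"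

text \<open>The norm of a functional or an operator is the library's \<^const>\<open>onorm\<close>.\<close>

definition dual :: "('k::real_or_complex \<Rightarrow> 'a::real_normed_vector \<Rightarrow> 'a) \<Rightarrow> ('a \<Rightarrow> 'k) set" where
  "dual smul = {f. bounded_linear_over smul (*) f}"


section \<open>Numerical index and Lipschitz numerical index\<close>

definition numerical_range ::
    "('k::real_or_complex \<Rightarrow> 'a::real_normed_vector \<Rightarrow> 'a) \<Rightarrow> ('a \<Rightarrow> 'a) \<Rightarrow> 'k set" where
  "numerical_range smul T =
     {f (T x) | x f. norm x = 1 \<and> f \<in> dual smul \<and> onorm f = 1 \<and> f x = 1}"

definition numerical_index_one ::
    "('k::real_or_complex \<Rightarrow> 'a::real_normed_vector \<Rightarrow> 'a) \<Rightarrow> bool" where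
  "numerical_index_one smul \<longleftrightarrow>
     (\<forall>T. bounded_linear_over smul smul T \<longrightarrow>
        (SUP z\<in>numerical_range smul T. norm z) = onorm T)"

text \<open>Lipschitz maps are normalised at the origin, so that \<open>lip_norm\<close> is a norm.\<close>

definition Lip :: "('a::real_normed_vector \<Rightarrow> 'a) set" where
  "Lip = {T. T 0 = 0 \<and> (\<exists>L. L-lipschitz_on UNIV T)}"

definition lip_norm :: "('a::real_normed_vector \<Rightarrow> 'a) \<Rightarrow> real" where
  "lip_norm T = Sup {norm (T x - T y) / norm (x - y) | x y. x \<noteq> y}"

definition lip_numerical_range ::
    "('k::real_or_complex \<Rightarrow> 'a::real_normed_vector \<Rightarrow> 'a) \<Rightarrow> ('a \<Rightarrow> 'a) \<Rightarrow> 'k set" where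
  "lip_numerical_range smul T =
     {f (T x - T y) / of_real ((norm (x - y))\<^sup>2) | x y f.
        x \<noteq> y \<and> f \<in> dual smul \<and>
        re (f (x - y)) = onorm f * norm (x - y) \<and>
        onorm f * norm (x - y) = (norm (x - y))\<^sup>2}"

definition lip_numerical_radius ::
    "('k::real_or_complex \<Rightarrow> 'a::real_normed_vector \<Rightarrow> 'a) \<Rightarrow> ('a \<Rightarrow> 'a) \<Rightarrow> real" where
  "lip_numerical_radius smul T = (SUP z\<in>lip_numerical_range smul T. norm z)"

definition lip_numerical_index ::
    "('k::real_or_complex \<Rightarrow> 'a::real_normed_vector \<Rightarrow> 'a) \<Rightarrow> real" where
  "lip_numerical_index smul =
     (INF T\<in>{T. T \<in> Lip \<and> lip_norm T = 1}. lip_numerical_radius smul T)"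


section \<open>The Radon-Nikodym property\<close>

text \<open>
  The library's Bochner integral is restricted to second countable target spaces. For arbitrary
  Banach spaces, Borel measurability of the integrand is replaced by strong measurability, that is,
  by almost everywhere approximability by simple functions. The integrand need not be measurable for
  the \<open>\<sigma>\<close>-algebra of \<open>M\<close>, but \<open>norm (g x - s i x)\<close> agrees almost everywhere with a measurable
  function, which is all that the nonnegative integral depends on.
\<close>

definition has_strong_bochner_integral ::
    "'m measure \<Rightarrow> ('m \<Rightarrow> 'a::real_normed_vector) \<Rightarrow> 'a \<Rightarrow> bool" where
  "has_strong_bochner_integral M g I \<longleftrightarrow>
     (\<exists>s. (\<forall>i. Bochner_Integration.simple_bochner_integrable M (s i)) \<and>
          (AE x in M. (\<lambda>i. s i x) \<longlonglongrightarrow> g x) \<and>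
          (\<lambda>i. \<integral>\<^sup>+x. ennreal (norm (g x - s i x)) \<partial>M) \<longlonglongrightarrow> 0 \<and>
          (\<lambda>i. Bochner_Integration.simple_bochner_integral M (s i)) \<longlonglongrightarrow> I)"

definition vector_measure :: "'m measure \<Rightarrow> ('m set \<Rightarrow> 'a::real_normed_vector) \<Rightarrow> bool" where
  "vector_measure M G \<longleftrightarrow>
     (\<forall>A :: nat \<Rightarrow> 'm set. range A \<subseteq> sets M \<and> disjoint_family A \<longrightarrow>
        (\<lambda>n. G (A n)) sums G (\<Union>n. A n))"

definition bounded_variation :: "'m measure \<Rightarrow> ('m set \<Rightarrow> 'a::real_normed_vector) \<Rightarrow> bool" where
  "bounded_variation M G \<longleftrightarrow>
     (\<exists>C. \<forall>P. finite P \<and> P \<subseteq> sets M \<and> disjoint P \<and> \<Union>P = space M \<longrightarrow>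
        (\<Sum>E\<in>P. norm (G E)) \<le> C)"

definition measure_continuous :: "'m measure \<Rightarrow> ('m set \<Rightarrow> 'a::real_normed_vector) \<Rightarrow> bool" where
  "measure_continuous M G \<longleftrightarrow>
     (\<forall>\<epsilon>>0. \<exists>\<delta>>0. \<forall>E\<in>sets M. measure M E < \<delta> \<longrightarrow> norm (G E) < \<epsilon>)"

text \<open>
  A definition cannot quantify over all types of points of a measure space. The points are taken to
  be real numbers, with arbitrary \<open>\<sigma>\<close>-algebras and finite measures. This loses nothing: the
  property for Lebesgue measure on the unit interval already implies it for all finite measures.
\<close>

definition radon_nikodym_property :: "'a::banach itself \<Rightarrow> bool" where
  "radon_nikodym_property _ \<longleftrightarrow>
     (\<forall>(M :: real measure) (G :: real set \<Rightarrow> 'a).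
        finite_measure M \<and> vector_measure M G \<and> bounded_variation M G \<and> measure_continuous M G \<longrightarrow>
        (\<exists>g. \<forall>E\<in>sets M. has_strong_bochner_integral M (\<lambda>x. indicat_real E x *\<^sub>R g x) (G E)))"


section \<open>Asplund spaces\<close>

text \<open>
  Differentiability is Frechet differentiability for the underlying real structure, also when the
  scalar field is complex.
\<close>

definition asplund_space :: "'a::banach itself \<Rightarrow> bool" where
  "asplund_space _ \<longleftrightarrow>
     (\<forall>(U :: 'a set) (\<phi> :: 'a \<Rightarrow> real).
        open U \<and> convex U \<and> convex_on U \<phi> \<and> continuous_on U \<phi> \<longrightarrow>
        (\<exists>D\<subseteq>U. gdelta D \<and> U \<subseteq> closure D \<and> (\<forall>x\<in>D. \<phi> differentiable (at x))))"


section \<open>Containing \<open>\<ell>\<^sub>1\<close>\<close>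

definition ell1 :: "(nat \<Rightarrow> 'k::real_or_complex) set" where
  "ell1 = {a. summable (\<lambda>n. norm (a n))}"

definition ell1_norm :: "(nat \<Rightarrow> 'k::real_or_complex) \<Rightarrow> real" where
  "ell1_norm a = (\<Sum>n. norm (a n))"

definition contains_ell1 :: "('k::real_or_complex \<Rightarrow> 'a::real_normed_vector \<Rightarrow> 'a) \<Rightarrow> bool" where
  "contains_ell1 smul \<longleftrightarrow>
     (\<exists>(Y :: 'a set) (J :: (nat \<Rightarrow> 'k) \<Rightarrow> 'a).
        closed Y \<and> module.subspace smul Y \<and> bij_betw J ell1 Y \<and>
        (\<forall>a\<in>ell1. \<forall>b\<in>ell1. J (\<lambda>n. a n + b n) = J a + J b) \<and>
        (\<forall>c. \<forall>a\<in>ell1. J (\<lambda>n. c * a n) = smul c (J a)) \<and>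
        (\<exists>c>0. \<exists>C. \<forall>a\<in>ell1. c * ell1_norm a \<le> norm (J a) \<and> norm (J a) \<le> C * ell1_norm a))"


section \<open>The convex point of continuity property\<close>

definition weak_topology ::
    "('k::real_or_complex \<Rightarrow> 'a::real_normed_vector \<Rightarrow> 'a) \<Rightarrow> 'a topology" where
  "weak_topology smul = topology_generated_by {f -` V | f V. f \<in> dual smul \<and> open V}"

definition convex_point_of_continuity_property ::
    "('k::real_or_complex \<Rightarrow> 'a::real_normed_vector \<Rightarrow> 'a) \<Rightarrow> bool" where
  "convex_point_of_continuity_property smul \<longleftrightarrow>
     (\<forall>D :: 'a set. D \<noteq> {} \<and> closed D \<and> bounded D \<and> convex D \<longrightarrow>
        (\<exists>x\<in>D. topcontinuous_at (subtopology (weak_topology smul) D) (top_of_set D) id x))"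

end

theory Submission
  imports Defs
begin

text \<open>
  Write \<open>B\<close> for the unit ball. Numerical index one, applied to rank one operators, gives the alternative
  Daugavet property: for a unit vector \<open>u\<close>, every slice of \<open>B\<close> contains a point \<open>y\<close> such that some
  functional of norm one is almost one at \<open>u\<close> and, up to a unimodular factor, at \<open>y\<close>. Iterating, one
  functional \<open>h\<close> can be made to serve any finite number of adaptively chosen slices, or, averaging
  greedily, weakly open sets. Given \<open>v \<in> B\<close> and \<open>\<epsilon> > 0\<close>, consider therefore the game in which the first
  player names weakly open sets, the second answers with points of \<open>B\<close> in them, and the first
  wins once the convex hull of the answers comes within \<open>\<epsilon>\<close> of \<open>v\<close>. If the first player wins, then
  \<open>v\<close> is almost a convex combination of points at which \<open>h\<close> almost attains its norm, as it does at \<open>u\<close>.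

  Suppose he does not win. A compactness argument then yields a set \<open>H\<close> of functionals such that for
  every weak* open \<open>N\<close> meeting \<open>H\<close>, and every weakly open \<open>U\<close> meeting \<open>B\<close>, some \<open>y \<in> U \<inter> B\<close> and
  \<open>g \<in> N \<inter> H\<close> satisfy \<open>re (g (v - y)) \<ge> \<epsilon>\<close>. Then \<open>H\<close> has no small weak* slices, against the
  Asplund property, and successive splitting of finite families of open sets produces an
  independent sequence of vectors, hence a copy of \<open>\<ell>\<^sub>1\<close>. Moreover, some slice of \<open>B\<close> has only weakly open
  subsets of large diameter; this excludes points of continuity, and a bounded martingale with values
  in the slice that oscillates everywhere defines a vector measure without density.

  For a Lipschitz map \<open>T\<close> of norm one that almost preserves the length of \<open>q - p\<close>, put
  \<open>v = (q - p) / \<parallel>q - p\<parallel>\<close> and \<open>u = (T q - T p) / \<parallel>T q - T p\<parallel>\<close>. A polygonal path from \<open>p\<close> almost to \<open>q\<close>, with edges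
  in the directions obtained for \<open>u\<close> and \<open>v\<close>, has an edge along which \<open>h \<circ> T\<close> increases almost at
  rate one, so that \<open>T\<close> almost attains its norm as a numerical radius on this edge.
\<close>

section \<open>Separation of convex sets\<close>

text \<open>Two features of the argument are forced. First, \<open>h\<close> has to serve all points
  at once, whereas numerical index one supplies a functional for one slice at a time. Instead of a
  functional a weak* slice of the dual ball is kept and shrunk, and after finitely many steps it
  still contains a functional. Hence every run of the game must be finite, though without a common
  bound, which is what an inductive definition expresses. Second, the aim that the hull of the
  answers comes near \<open>v\<close> is recast by separation: no \<open>g\<close> in the dual ball
  may satisfy \<open>g (v - y) \<ge> \<epsilon>\<close> at every answer \<open>y\<close>. The state
  of the game is then the set of functionals not yet refuted, and weak* compactness of the dual ball
  localises a failure to win. Each of the four hypotheses on the space is used only to show that the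
  first player wins, and numerical index one only to turn a win into \<open>h\<close> and the convex
  combination.\<close>

definition sublinear :: "('a::real_vector \<Rightarrow> real) \<Rightarrow> bool" where
  "sublinear p \<longleftrightarrow> (\<forall>x y. p (x + y) \<le> p x + p y) \<and> (\<forall>t\<ge>0. \<forall>x. p (t *\<^sub>R x) \<le> t * p x)"

lemma sublinear_add: "sublinear p \<Longrightarrow> p (x + y) \<le> p x + p y"
  and sublinear_scale: "sublinear p \<Longrightarrow> 0 \<le> t \<Longrightarrow> p (t *\<^sub>R x) \<le> t * p x"
  by (auto simp: sublinear_def)

lemma sublinear_zero:
  assumes "sublinear p"
  shows "p 0 = 0"
  using sublinear_add[OF assms, of 0 0] sublinear_scale[OF assms, of 0 0] by simp

lemma sublinear_scale_eq:
  assumes "sublinear p" "0 \<le> t"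
  shows "p (t *\<^sub>R x) = t * p x"
proof (cases "t = 0")
  case True
  then show ?thesis using sublinear_zero[OF assms(1)] by simp
next
  case False
  then have "t > 0" using assms by simp
  have "p x \<le> (1 / t) * p (t *\<^sub>R x)"
    using sublinear_scale[OF assms(1), of "1 / t" "t *\<^sub>R x"] \<open>t > 0\<close> by simp
  then show ?thesis using sublinear_scale[OF assms, of x] \<open>t > 0\<close> by (simp add: field_simps)
qed

lemma sublinear_minus:
  assumes "sublinear p"
  shows "- p (- x) \<le> p x"
  using sublinear_add[OF assms, of x "- x"] sublinear_zero[OF assms] by simp

text \<open>Common to the three infima below: over a chain, over a ray, and over the scaled points
  of a convex set. It is enough that sums and multiples of indexed values are dominated at a single
  index.\<close>

lemma sublinear_INF:
  assumes ne: "A \<noteq> {}" and below: "\<And>x. bdd_below (F x ` A)" and zero: "\<exists>u\<in>A. F 0 u \<le> 0"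
    and add: "\<And>x y v w. v \<in> A \<Longrightarrow> w \<in> A \<Longrightarrow> \<exists>u\<in>A. F (x + y) u \<le> F x v + F y w"
    and scale: "\<And>c x w. 0 < c \<Longrightarrow> w \<in> A \<Longrightarrow> \<exists>u\<in>A. F (c *\<^sub>R x) u \<le> c * F x w"
  shows "sublinear (\<lambda>x. INF w\<in>A. F x w :: real)"
proof -
  define p where "p x = (INF w\<in>A. F x w)" for x
  have le: "p x \<le> m" if "\<exists>u\<in>A. F x u \<le> m" for x m
    using that cINF_lower[OF below] unfolding p_def by (meson order_trans)
  have ge: "m \<le> p x" if "\<And>w. w \<in> A \<Longrightarrow> m \<le> F x w" for x m
    unfolding p_def by (rule cINF_greatest[OF ne that])
  have "p (x + y) \<le> p x + p y" for x y
  proof -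
    have "p (x + y) - F y w \<le> p x" if "w \<in> A" for w
      by (rule ge) (use le[OF add[OF _ that], of _ x y] in \<open>simp add: algebra_simps\<close>)
    then have "p (x + y) - p x \<le> p y" by (intro ge) (simp add: algebra_simps)
    then show ?thesis by simp
  qed
  moreover have "p (c *\<^sub>R x) \<le> c * p x" if "0 \<le> c" for c x
  proof (cases "c = 0")
    case True
    then show ?thesis using le[OF zero] by simp
  next
    case False
    then have "p (c *\<^sub>R x) / c \<le> p x"
      using that le[OF scale, of c _ x] by (intro ge) (simp add: pos_divide_le_eq mult.commute)
    then show ?thesis using that False by (simp add: pos_divide_le_eq mult.commute)
  qed
  ultimately show ?thesis unfolding p_def[symmetric] by (simp add: sublinear_def)
qed

lemma sublinear_Inf_chain:
  assumes ne: "C \<noteq> {}" and sub: "\<And>q. q \<in> C \<Longrightarrow> sublinear q" and bd: "\<And>q. q \<in> C \<Longrightarrow> q \<le> p"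
    and chain: "\<And>q r. q \<in> C \<Longrightarrow> r \<in> C \<Longrightarrow> q \<le> r \<or> r \<le> q"
  shows "sublinear (\<lambda>x. INF q\<in>C. q x)" "\<And>q. q \<in> C \<Longrightarrow> (\<lambda>x. INF q\<in>C. q x) \<le> q"
proof -
  have below: "bdd_below ((\<lambda>q. q x) ` C)" for x
  proof (rule bdd_belowI2)
    fix q assume "q \<in> C"
    then show "- p (- x) \<le> q x"
      using sublinear_minus[OF sub, of q x] bd[of q] by (force simp: le_fun_def dest: spec[of _ "-x"])
  qed
  show "(\<lambda>x. INF q\<in>C. q x) \<le> q" if "q \<in> C" for q
    using cINF_lower[OF below that] by (simp add: le_fun_def)
  show "sublinear (\<lambda>x. INF q\<in>C. q x)"
  proof (rule sublinear_INF[OF ne below])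
    show "\<exists>q\<in>C. q 0 \<le> 0" using ne sublinear_zero[OF sub] by fastforce
    show "\<exists>m\<in>C. m (x + y) \<le> q x + r y" if qr: "q \<in> C" "r \<in> C" for x y q r
    proof -
      obtain m where m: "m \<in> C" "m \<le> q" "m \<le> r" using chain[OF qr] qr by auto
      then show ?thesis using sublinear_add[OF sub[OF m(1)], of x y]
        by (intro bexI[of _ m]) (meson add_mono le_funD order_trans)+
    qed
    show "\<exists>q\<in>C. q (c *\<^sub>R x) \<le> c * r x" if "0 < c" "r \<in> C" for c x r
      using sublinear_scale[OF sub[OF that(2)], of c x] that by auto
  qed
qed

text \<open>The infimum of \<open>q (x + t *\<^sub>R a) - t * q a\<close> over
  \<open>t \<ge> 0\<close> is sublinear in \<open>x\<close> and at most \<open>q\<close>, so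
  minimality makes it equal to \<open>q\<close>. Comparison with the term \<open>t = 1\<close> gives
  superadditivity.\<close>

lemma minimal_sublinear_linear:
  assumes q: "sublinear q" and min: "\<And>r. sublinear r \<Longrightarrow> r \<le> q \<Longrightarrow> r = q"
  shows "linear q"
proof -
  have super: "q x + q a \<le> q (x + a)" for x a
  proof -
    let ?F = "\<lambda>x t. q (x + t *\<^sub>R a) - t * q a"
    have below: "bdd_below (?F x ` {0..})" for x
    proof (rule bdd_belowI2)
      fix t :: real assume "t \<in> {0..}"
      then have "q (t *\<^sub>R a) = t * q a" by (simp add: sublinear_scale_eq[OF q])
      then show "- q (- x) \<le> ?F x t"
        using sublinear_add[OF q, of "x + t *\<^sub>R a" "- x"] by simp
    qed
    have le: "(INF t\<in>{0..}. ?F x t) \<le> ?F x t" if "0 \<le> t" for x t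
      by (rule cINF_lower[OF below]) (use that in auto)
    have "sublinear (\<lambda>x. INF t\<in>{0..}. ?F x t)"
    proof (rule sublinear_INF[OF _ below])
      show "\<exists>t\<in>{0..}. ?F 0 t \<le> 0" using sublinear_zero[OF q] by (intro bexI[of _ 0]) auto
      show "\<exists>u\<in>{0..}. ?F (x + y) u \<le> ?F x t + ?F y s" if "t \<in> {0..}" "s \<in> {0..}" for x y t s
        using sublinear_add[OF q, of "x + t *\<^sub>R a" "y + s *\<^sub>R a"] that
        by (intro bexI[of _ "t + s"]) (auto simp: algebra_simps)
      show "\<exists>u\<in>{0..}. ?F (c *\<^sub>R x) u \<le> c * ?F x t" if "0 < c" "t \<in> {0..}" for c x t
        using sublinear_scale[OF q, of c "x + t *\<^sub>R a"] that
        by (intro bexI[of _ "c * t"]) (auto simp: algebra_simps)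
    qed auto
    moreover have "(\<lambda>x. INF t\<in>{0..}. ?F x t) \<le> q" using le[of 0] by (simp add: le_fun_def)
    ultimately have "(\<lambda>x. INF t\<in>{0..}. ?F x t) = q" by (rule min)
    from fun_cong[OF this, of x] have "q x \<le> ?F x 1" using le[of 1 x] by simp
    then show ?thesis by simp
  qed
  have add: "q (x + y) = q x + q y" for x y
    using super[of x y] sublinear_add[OF q, of x y] by simp
  have minus: "q (- x) = - q x" for x
    using add[of x "- x"] sublinear_zero[OF q] by simp
  show ?thesis
  proof (rule linearI)
    show "q (x + y) = q x + q y" for x y by (rule add)
    show "q (t *\<^sub>R x) = t *\<^sub>R q x" for t x
    proof (cases "0 \<le> t")
      case True
      then show ?thesis by (simp add: sublinear_scale_eq[OF q])
    next
      case False
      then have "q ((- t) *\<^sub>R x) = (- t) * q x" by (intro sublinear_scale_eq[OF q]) simp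
      then show ?thesis using minus[of "t *\<^sub>R x"] by simp
    qed
  qed
qed

text \<open>Hahn-Banach without extension from subspaces. Zorn's lemma is applied with the order
  reversed, so that chains are bounded by their infima and a maximal element is a minimal sublinear
  map, which is linear.\<close>

lemma sublinear_dominates_linear:
  assumes p: "sublinear p"
  obtains g where "linear g" "\<And>x. g x \<le> p x"
proof -
  define A where "A = {q. sublinear q \<and> q \<le> p}"
  have "\<exists>m\<in>A. \<forall>a\<in>A. a \<le> m \<longrightarrow> a = m"
  proof (rule predicate_Zorn)
    show "partial_order_on A (relation_of (\<lambda>q r. r \<le> q) A)"
      by (rule partial_order_on_relation_ofI) auto
  next
    fix C assume C: "C \<in> Chains (relation_of (\<lambda>q r. r \<le> q) A)"
    then have CA: "C \<subseteq> A" and tot: "\<And>q r. q \<in> C \<Longrightarrow> r \<in> C \<Longrightarrow> q \<le> r \<or> r \<le> q"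
      by (auto simp: Chains_def relation_of_def)
    show "\<exists>u\<in>A. \<forall>a\<in>C. u \<le> a"
    proof (cases "C = {}")
      case True
      then show ?thesis using p by (auto simp: A_def)
    next
      case False
      have *: "sublinear (\<lambda>x. INF q\<in>C. q x)" "\<And>q. q \<in> C \<Longrightarrow> (\<lambda>x. INF q\<in>C. q x) \<le> q"
        using sublinear_Inf_chain[of C p] False tot CA by (auto simp: A_def)
      then have "(\<lambda>x. INF q\<in>C. q x) \<in> A" 
        using False CA unfolding A_def by (blast intro: order_trans)
      then show ?thesis using *(2) by blast
    qed
  qed
  then obtain m where m: "m \<in> A" "\<And>a. a \<in> A \<Longrightarrow> a \<le> m \<Longrightarrow> a = m" by blast
  have "linear m"
    by (rule minimal_sublinear_linear) (use m in \<open>auto simp: A_def\<close>)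
  then show ?thesis using m that[of m] by (auto simp: A_def le_fun_def)
qed

text \<open>The real dual unit ball, for complex spaces too. Its members are bare functions, so the
  product topology on functions restricts to the weak* topology.\<close>

definition dual_ball :: "('a::real_normed_vector \<Rightarrow> real) set" where
  "dual_ball = {g. linear g \<and> (\<forall>x. g x \<le> norm x)}"

lemma dual_ball_linear: "g \<in> dual_ball \<Longrightarrow> linear g"
  by (simp add: dual_ball_def)

lemma dual_ball_abs: "g \<in> dual_ball \<Longrightarrow> \<bar>g x\<bar> \<le> norm x"
  using linear_neg[of g x] norm_minus_cancel[of x] unfolding dual_ball_def abs_le_iff
  by (metis (mono_tags, lifting) mem_Collect_eq)

lemma dual_ball_le: "g \<in> dual_ball \<Longrightarrow> g x \<le> norm x"
  by (simp add: dual_ball_def)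

lemma dual_ball_bounded_linear: "g \<in> dual_ball \<Longrightarrow> bounded_linear g"
  by (rule bounded_linear_intro[where K = 1])
     (auto simp: dual_ball_abs dest: dual_ball_linear simp: linear_add linear_scale)

lemma zero_in_dual_ball: "(\<lambda>x. 0) \<in> dual_ball"
  by (simp add: dual_ball_def linear_zero)

text \<open>A functional below the sublinear map \<open>x \<mapsto> inf (norm (x + t *\<^sub>R z) - t * d)\<close>, with
  \<open>t \<ge> 0\<close> and \<open>z \<in> Z\<close>, is at once bounded by the norm and at least \<open>d\<close> on \<open>Z\<close>.\<close>

lemma dual_ball_separation:
  fixes Z :: "'a::real_normed_vector set"
  assumes Z: "convex Z" "Z \<noteq> {}" and d: "\<And>z. z \<in> Z \<Longrightarrow> d \<le> norm z"
  obtains g where "g \<in> dual_ball" "\<And>z. z \<in> Z \<Longrightarrow> d \<le> g z"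
proof -
  define A where "A = {0::real..} \<times> Z"
  define F where "F x = (\<lambda>(t, z). norm (x + t *\<^sub>R z) - t * d)" for x :: 'a
  define p where "p x = (INF w\<in>A. F x w)" for x
  have A: "A \<noteq> {}" using Z by (auto simp: A_def)
  have below: "bdd_below (F x ` A)" for x
  proof (rule bdd_belowI2)
    fix w assume "w \<in> A"
    then obtain t z where w: "w = (t, z)" "0 \<le> t" "z \<in> Z" by (auto simp: A_def)
    have "norm (t *\<^sub>R z) \<le> norm (x + t *\<^sub>R z) + norm x"
      by (metis add_diff_cancel_left' norm_triangle_ineq4)
    moreover have "t * d \<le> t * norm z" using d[OF w(3)] w(2) by (rule mult_left_mono)
    ultimately show "- norm x \<le> F x w" using w by (simp add: F_def)
  qed
  have le: "p x \<le> norm (x + t *\<^sub>R z) - t * d" if "0 \<le> t" "z \<in> Z" for x t z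
    using cINF_lower[OF below, of "(t, z)" x] that by (auto simp: p_def A_def F_def)
  obtain z0 where z0: "z0 \<in> Z" using Z by auto
  have "sublinear p"
    unfolding p_def
  proof (rule sublinear_INF[OF A below])
    show "\<exists>w\<in>A. F 0 w \<le> 0" using z0 by (intro bexI[of _ "(0, z0)"]) (auto simp: A_def F_def)
    show "\<exists>u\<in>A. F (x + y) u \<le> F x v + F y w" if "v \<in> A" "w \<in> A" for x y v w
    proof -
      obtain t z s z' where v: "v = (t, z)" "0 \<le> t" "z \<in> Z" and w: "w = (s, z')" "0 \<le> s" "z' \<in> Z"
        using \<open>v \<in> A\<close> \<open>w \<in> A\<close> by (auto simp: A_def)
      obtain u where u: "u \<in> Z" "(t + s) *\<^sub>R u = t *\<^sub>R z + s *\<^sub>R z'"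
      proof (cases "t + s = 0")
        case True
        then have "t = 0" "s = 0" using v w by auto
        then show ?thesis using that[OF z0] by simp
      next
        case False
        then have ts: "t + s > 0" using v w by simp
        have "(t / (t + s)) *\<^sub>R z + (s / (t + s)) *\<^sub>R z' \<in> Z"
          using v w ts by (intro convexD[OF Z(1)]) (auto simp: add_divide_distrib[symmetric])
        then show ?thesis by (rule that) (use ts in \<open>simp add: scaleR_add_right\<close>)
      qed
      have "norm (x + y + (t + s) *\<^sub>R u) \<le> norm (x + t *\<^sub>R z) + norm (y + s *\<^sub>R z')"
        unfolding u(2) using norm_triangle_ineq[of "x + t *\<^sub>R z" "y + s *\<^sub>R z'"]
        by (simp add: algebra_simps)
      then show ?thesis using u(1) v w
        by (intro bexI[of _ "(t + s, u)"]) (auto simp: A_def F_def algebra_simps)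
    qed
    show "\<exists>u\<in>A. F (c *\<^sub>R x) u \<le> c * F x w" if "0 < c" "w \<in> A" for c x w
    proof -
      obtain t z where w: "w = (t, z)" "0 \<le> t" "z \<in> Z" using \<open>w \<in> A\<close> by (auto simp: A_def)
      have "c *\<^sub>R x + (c * t) *\<^sub>R z = c *\<^sub>R (x + t *\<^sub>R z)" by (simp add: scaleR_add_right)
      then have "norm (c *\<^sub>R x + (c * t) *\<^sub>R z) = c * norm (x + t *\<^sub>R z)" using \<open>0 < c\<close> by simp
      then show ?thesis using w \<open>0 < c\<close>
        by (intro bexI[of _ "(c * t, z)"]) (auto simp: A_def F_def algebra_simps)
    qed
  qed
  then obtain g where g: "linear g" "\<And>x. g x \<le> p x" by (rule sublinear_dominates_linear) blast
  show ?thesis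
  proof
    show "g \<in> dual_ball"
      unfolding dual_ball_def using g le[of 0 z0] z0 by (auto intro: order_trans)
    fix z assume "z \<in> Z"
    \<comment> \<open>At the point \<open>- z\<close> the term with \<open>t = 1\<close> is
      \<open>norm 0 - d\<close>.\<close>
    then show "d \<le> g z" using g(2)[of "- z"] le[of 1 z "- z"] linear_neg[OF g(1), of z] by simp
  qed
qed

lemma support_functional:
  fixes x :: "'a::real_normed_vector"
  obtains g where "g \<in> dual_ball" "g x = norm x"
proof -
  obtain g where g: "g \<in> dual_ball" "\<And>z. z \<in> {x} \<Longrightarrow> norm x \<le> g z"
    by (rule dual_ball_separation[of "{x}" "norm x"]) auto
  then show ?thesis using that[of g] dual_ball_le[OF g(1), of x] by (simp add: order_antisym)
qed

lemma dual_ball_separation_point: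
  fixes C :: "'a::real_normed_vector set"
  assumes C: "convex C" "C \<noteq> {}" and d: "\<And>c. c \<in> C \<Longrightarrow> d \<le> norm (x - c)"
  obtains g where "g \<in> dual_ball" "\<And>c. c \<in> C \<Longrightarrow> d \<le> g (x - c)"
proof -
  have "convex ((\<lambda>c. x - c) ` C)" "(\<lambda>c. x - c) ` C \<noteq> {}"
    using C convex_translation[OF convex_negations[OF C(1)], of x] by (auto simp: image_image)
  then obtain g where "g \<in> dual_ball" "\<And>z. z \<in> (\<lambda>c. x - c) ` C \<Longrightarrow> d \<le> g z"
    by (rule dual_ball_separation[of _ d]) (use d in auto)
  then show ?thesis using that[of g] by auto
qed

lemma continuous_on_eval: "continuous_on S (\<lambda>g :: 'a \<Rightarrow> 'b::topological_space. g x)"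
  by (rule continuous_on_product_then_coordinatewise) (rule continuous_on_id)

lemma closed_dual_ball: "closed (dual_ball :: ('a::real_normed_vector \<Rightarrow> real) set)"
proof -
  have "dual_ball = (\<Inter>x. \<Inter>y. {g :: 'a \<Rightarrow> real. g (x + y) = g x + g y}) \<inter>
      (\<Inter>c. \<Inter>x. {g. g (c *\<^sub>R x) = c * g x}) \<inter> (\<Inter>x. {g. g x \<le> norm x})"
    by (auto simp: dual_ball_def linear_iff)
  also have "closed \<dots>"
    by (intro closed_Int closed_INT ballI closed_Collect_eq closed_Collect_le continuous_intros
        continuous_on_eval)
  finally show ?thesis .
qed

text \<open>Banach-Alaoglu: a closed subset of a product of intervals, which is compact by
  Tychonoff's theorem.\<close>

lemma compact_dual_ball: "compact (dual_ball :: ('a::real_normed_vector \<Rightarrow> real) set)"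
proof -
  have "compactin (product_topology (\<lambda>i::'a. euclidean) UNIV) (PiE UNIV (\<lambda>x. {- norm x..norm x}))"
    unfolding compactin_PiE by (auto simp: compactin_euclidean_iff)
  then have "compact (PiE UNIV (\<lambda>x::'a. {- norm x..norm x :: real}))"
    by (simp add: euclidean_product_topology)
  moreover have "dual_ball \<subseteq> PiE UNIV (\<lambda>x::'a. {- norm x..norm x :: real})"
    using abs_le_D1[OF dual_ball_abs] abs_le_D2[OF dual_ball_abs]
    by (auto simp: PiE_def minus_le_iff)
  ultimately show ?thesis
    using closed_dual_ball by (metis compact_Int_closed inf.absorb_iff2)
qed

section \<open>A game between weakly open sets and points\<close>

text \<open>Only real functionals occur, so the notion does not mention the scalar field; real parts
  of scalar functionals are among them.\<close>

definition weakly_open :: "'a::real_normed_vector set \<Rightarrow> bool" where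
  "weakly_open U \<longleftrightarrow> (\<forall>w\<in>U. \<exists>\<Phi> \<delta>. finite \<Phi> \<and> (\<forall>f\<in>\<Phi>. bounded_linear f) \<and> \<delta> > 0 \<and>
     (\<forall>y. (\<forall>f\<in>\<Phi>. \<bar>f (y - w) :: real\<bar> < \<delta>) \<longrightarrow> y \<in> U))"

lemma weakly_openE:
  assumes "weakly_open U" "w \<in> U"
  obtains \<Phi> \<delta> where "finite \<Phi>" "\<forall>f\<in>\<Phi>. bounded_linear f" "\<delta> > 0"
    "\<And>y. (\<And>f. f \<in> \<Phi> \<Longrightarrow> \<bar>f (y - w) :: real\<bar> < \<delta>) \<Longrightarrow> y \<in> U"
proof -
  obtain \<Phi> \<delta> where *: "finite \<Phi>" "\<forall>f\<in>\<Phi>. bounded_linear f" "\<delta> > 0"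
    "\<forall>y. (\<forall>f\<in>\<Phi>. \<bar>f (y - w) :: real\<bar> < \<delta>) \<longrightarrow> y \<in> U"
    using bspec[OF assms(1)[unfolded weakly_open_def] assms(2)] by (elim exE conjE)
  show ?thesis by (rule that[OF *(1-3)]) (use *(4) in \<open>simp add: Ball_def\<close>)
qed

lemma weakly_open_Int:
  assumes "weakly_open U" "weakly_open V"
  shows "weakly_open (U \<inter> V)"
  unfolding weakly_open_def
proof
  fix w assume w: "w \<in> U \<inter> V"
  obtain \<Phi> \<delta> where 1: "finite \<Phi>" "\<forall>f\<in>\<Phi>. bounded_linear f" "\<delta> > 0"
    "\<And>y. (\<And>f. f \<in> \<Phi> \<Longrightarrow> \<bar>f (y - w) :: real\<bar> < \<delta>) \<Longrightarrow> y \<in> U"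
    using weakly_openE[OF assms(1), of w] w by blast
  obtain \<Psi> \<eta> where 2: "finite \<Psi>" "\<forall>f\<in>\<Psi>. bounded_linear f" "\<eta> > 0"
    "\<And>y. (\<And>f. f \<in> \<Psi> \<Longrightarrow> \<bar>f (y - w) :: real\<bar> < \<eta>) \<Longrightarrow> y \<in> V"
    using weakly_openE[OF assms(2), of w] w by blast
  have "y \<in> U \<inter> V" if "\<forall>f\<in>\<Phi> \<union> \<Psi>. \<bar>f (y - w)\<bar> < min \<delta> \<eta>" for y
    using 1(4)[of y] 2(4)[of y] that by simp
  then show "\<exists>\<Phi> \<delta>. finite \<Phi> \<and> (\<forall>f\<in>\<Phi>. bounded_linear f) \<and> \<delta> > 0 \<and>
     (\<forall>y. (\<forall>f\<in>\<Phi>. \<bar>f (y - w) :: real\<bar> < \<delta>) \<longrightarrow> y \<in> U \<inter> V)"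
    using 1(1-3) 2(1-3)
    by (intro exI[of _ "\<Phi> \<union> \<Psi>"] exI[of _ "min \<delta> \<eta>"] conjI allI impI) (blast | simp)+
qed

lemma weakly_open_UNIV: "weakly_open UNIV"
  unfolding weakly_open_def by (auto intro!: exI[of _ "{}"] exI[of _ 1])

lemma weakly_open_Inter:
  assumes "finite I" "\<And>i. i \<in> I \<Longrightarrow> weakly_open (U i)"
  shows "weakly_open (\<Inter>i\<in>I. U i)"
  using assms by (induction I) (auto simp: weakly_open_UNIV weakly_open_Int)

lemma weakly_open_slice:
  assumes "bounded_linear f"
  shows "weakly_open {y. (a::real) < f y}"
  unfolding weakly_open_def
proof
  fix w assume w: "w \<in> {y. a < f y}"
  show "\<exists>\<Phi> \<delta>. finite \<Phi> \<and> (\<forall>f\<in>\<Phi>. bounded_linear f) \<and> \<delta> > 0 \<and>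
     (\<forall>y. (\<forall>f\<in>\<Phi>. \<bar>f (y - w) :: real\<bar> < \<delta>) \<longrightarrow> y \<in> {y. a < f y})"
    by (rule exI[of _ "{f}"], rule exI[of _ "f w - a"])
       (use w assms in \<open>auto simp: linear_diff bounded_linear.linear\<close>)
qed

lemma weakly_open_slice':
  assumes "bounded_linear f"
  shows "weakly_open {y. f y < (a::real)}"
  using weakly_open_slice[of "\<lambda>x. - f x" "- a"] bounded_linear_minus[OF assms] by simp

lemma weakly_open_slice_diff:
  assumes "bounded_linear f"
  shows "weakly_open {y. (a::real) < f (v - y)}" "weakly_open {y. f (v - y) < a}"
proof -
  have "{y. a < f (v - y)} = {y. f y < f v - a}" "{y. f (v - y) < a} = {y. f v - a < f y}"
    using linear_diff[OF bounded_linear.linear[OF assms]] by auto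
  then show "weakly_open {y. (a::real) < f (v - y)}" "weakly_open {y. f (v - y) < a}"
    using weakly_open_slice[OF assms] weakly_open_slice'[OF assms] by auto
qed

text \<open>Used to push a point off the bounding hyperplane of a slice. The step \<open>t\<close>
  is measured against the sum of all \<open>\<bar>f z\<bar>\<close>, so that one value suits all
  functionals.\<close>

lemma weakly_open_segment:
  assumes U: "weakly_open U" and w: "w \<in> U"
  obtains t where "0 < t" "t < 1" "w + t *\<^sub>R z \<in> U"
proof -
  obtain \<Phi> \<delta> where 1: "finite \<Phi>" "\<forall>f\<in>\<Phi>. bounded_linear f" "\<delta> > 0"
    "\<And>y. (\<And>f. f \<in> \<Phi> \<Longrightarrow> \<bar>f (y - w) :: real\<bar> < \<delta>) \<Longrightarrow> y \<in> U"
    using weakly_openE[OF U w] by metis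
  define S where "S = 1 + (\<Sum>f\<in>\<Phi>. \<bar>f z\<bar>)"
  have S: "S \<ge> 1" by (auto simp: S_def intro: sum_nonneg)
  define t where "t = min (1/2) (\<delta> / (2 * S))"
  have t: "0 < t" "t < 1" "t * S \<le> \<delta> / 2"
    using S \<open>\<delta> > 0\<close> by (auto simp: t_def min_def field_simps)
  have "\<bar>f (t *\<^sub>R z)\<bar> < \<delta>" if "f \<in> \<Phi>" for f
  proof -
    have "\<bar>f z\<bar> \<le> S"
      using member_le_sum[of f \<Phi> "\<lambda>f. \<bar>f z\<bar>"] that 1(1) by (auto simp: S_def)
    then have "t * \<bar>f z\<bar> \<le> t * S" using t(1) by simp
    moreover have "\<bar>f (t *\<^sub>R z)\<bar> = t * \<bar>f z\<bar>"
      using linear_scale[OF bounded_linear.linear, of f t z] 1(2) that t(1) by (simp add: abs_mult)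
    ultimately show ?thesis using t(3) \<open>\<delta> > 0\<close> by linarith
  qed
  then have "w + t *\<^sub>R z \<in> U" using 1(4) by simp
  then show ?thesis using t that by blast
qed

text \<open>The first player names a weakly open set meeting the unit ball, the second answers with a point
  \<open>y\<close> of the ball in it, and all functionals \<open>g\<close> with \<open>g (v - y) < \<epsilon>\<close> are discarded from the set.
  The first player has to discard everything.\<close>

inductive forces :: "'a::real_normed_vector \<Rightarrow> real \<Rightarrow> ('a \<Rightarrow> real) set \<Rightarrow> bool" for v \<epsilon> where
  forces_empty: "forces v \<epsilon> {}"
| forces_step: "weakly_open U \<Longrightarrow> U \<inter> cball 0 1 \<noteq> {} \<Longrightarrow>
    (\<And>y. y \<in> U \<inter> cball 0 1 \<Longrightarrow> forces v \<epsilon> (L \<inter> {g. \<epsilon> \<le> g (v - y)})) \<Longrightarrow> forces v \<epsilon> L"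

lemma forces_mono: "forces v \<epsilon> L \<Longrightarrow> K \<subseteq> L \<Longrightarrow> forces v \<epsilon> K"
proof (induction arbitrary: K rule: forces.induct)
  case forces_empty
  then show ?case by (simp add: forces.forces_empty)
next
  case (forces_step U L)
  show ?case
  proof (rule forces.forces_step[OF forces_step(1,2)])
    fix y assume "y \<in> U \<inter> cball 0 1"
    then show "forces v \<epsilon> (K \<inter> {g. \<epsilon> \<le> g (v - y)})"
      by (rule forces_step.IH) (use forces_step.prems in auto)
  qed
qed

text \<open>The two winning strategies are played one after the other: once \<open>L\<close> is
  exhausted, what remains lies in \<open>K\<close>.\<close>

lemma forces_Un: "forces v \<epsilon> L \<Longrightarrow> forces v \<epsilon> K \<Longrightarrow> forces v \<epsilon> (L \<union> K)"
proof (induction rule: forces.induct)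
  case forces_empty
  then show ?case by simp
next
  case (forces_step U L)
  show ?case
  proof (rule forces.forces_step[OF forces_step(1,2)])
    fix y assume "y \<in> U \<inter> cball 0 1"
    then have "forces v \<epsilon> (L \<inter> {g. \<epsilon> \<le> g (v - y)} \<union> K)" using forces_step by blast
    then show "forces v \<epsilon> ((L \<union> K) \<inter> {g. \<epsilon> \<le> g (v - y)})" by (rule forces_mono) auto
  qed
qed

lemma forces_Union:
  assumes "finite \<L>" "\<And>L. L \<in> \<L> \<Longrightarrow> forces v \<epsilon> L"
  shows "forces v \<epsilon> (\<Union>\<L>)"
  using assms by (induction \<L>) (auto simp: forces_empty forces_Un)

text \<open>A strategy whose moves are fixed in advance and do not react to the answers.\<close>

lemma forces_finite:
  assumes "finite I" "\<And>i. i \<in> I \<Longrightarrow> weakly_open (U i)" "\<And>i. i \<in> I \<Longrightarrow> U i \<inter> cball 0 1 \<noteq> {}"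
    and "\<And>y g. (\<And>i. i \<in> I \<Longrightarrow> y i \<in> U i \<inter> cball 0 1) \<Longrightarrow> g \<in> L \<Longrightarrow> \<exists>i\<in>I. g (v - y i) < \<epsilon>"
  shows "forces v \<epsilon> L"
  using assms
proof (induction I arbitrary: L)
  case empty
  then have "L = {}" by force
  then show ?case by (simp add: forces_empty)
next
  case (insert j I)
  show ?case
  proof (rule forces_step[of "U j"])
    show "weakly_open (U j)" "U j \<inter> cball 0 1 \<noteq> {}" using insert by auto
    fix z assume z: "z \<in> U j \<inter> cball 0 1"
    show "forces v \<epsilon> (L \<inter> {g. \<epsilon> \<le> g (v - z)})"
    proof (rule insert.IH)
      fix y g assume y: "\<And>i. i \<in> I \<Longrightarrow> y i \<in> U i \<inter> cball 0 1" and g: "g \<in> L \<inter> {g. \<epsilon> \<le> g (v - z)}"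
      have "\<exists>i\<in>insert j I. g (v - (y(j := z)) i) < \<epsilon>"
        by (rule insert.prems(3)) (use y z g in \<open>auto split: if_splits\<close>)
      then show "\<exists>i\<in>I. g (v - y i) < \<epsilon>" using g insert.hyps(2) by (auto split: if_splits)
    qed (use insert.prems in auto)
  qed
qed

lemma closed_eval_ge: "closed {g :: 'a \<Rightarrow> real. c \<le> g x}"
  by (intro closed_Collect_le continuous_intros continuous_on_eval)

lemma open_fun_regular:
  fixes N :: "('a \<Rightarrow> real) set"
  assumes "open N" "g \<in> N"
  obtains M where "open M" "g \<in> M" "closure M \<subseteq> N"
proof -
  have "regular_space (product_topology (\<lambda>i::'a. euclidean :: real topology) UNIV)"
    by (auto simp: regular_space_product_topology regular_space_euclidean)
  then have "regular_space (euclidean :: ('a \<Rightarrow> real) topology)"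
    by (simp add: euclidean_product_topology)
  then obtain M V where "open M" "closed V" "g \<in> M" "M \<subseteq> V" "V \<subseteq> N"
    using assms unfolding neighbourhood_base_of_closedin[symmetric] neighbourhood_base_of
    by (metis closed_closedin open_openin)
  then show ?thesis using that[of M] closure_minimal[of M V] by blast
qed

definition oscillating :: "'a::real_normed_vector \<Rightarrow> real \<Rightarrow> ('a \<Rightarrow> real) set \<Rightarrow> bool" where
  "oscillating v \<epsilon> H \<longleftrightarrow> H \<subseteq> dual_ball \<and> H \<noteq> {} \<and>
     (\<forall>N U. open N \<longrightarrow> N \<inter> H \<noteq> {} \<longrightarrow> weakly_open U \<longrightarrow> U \<inter> cball 0 1 \<noteq> {} \<longrightarrow>
        (\<exists>y\<in>U \<inter> cball 0 1. \<exists>g\<in>N \<inter> H. \<epsilon> \<le> g (v - y)))"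

lemma oscillating_subset: "oscillating v \<epsilon> H \<Longrightarrow> H \<subseteq> dual_ball"
  and oscillating_nonempty: "oscillating v \<epsilon> H \<Longrightarrow> H \<noteq> {}"
  by (simp_all add: oscillating_def)

lemma oscillatingE:
  assumes "oscillating v \<epsilon> H" "open N" "N \<inter> H \<noteq> {}" "weakly_open U" "U \<inter> cball 0 1 \<noteq> {}"
  obtains y g where "y \<in> U" "norm y \<le> 1" "g \<in> N" "g \<in> H" "\<epsilon> \<le> g (v - y)"
proof -
  have "\<exists>y\<in>U \<inter> cball 0 1. \<exists>g\<in>N \<inter> H. \<epsilon> \<le> g (v - y)"
    using assms(1)[unfolded oscillating_def, THEN conjunct2, THEN conjunct2, rule_format, OF assms(2-)] .
  then show ?thesis using that by auto
qed

text \<open>The kernel \<open>H\<close> consists of the functionals all of whose neighbourhoods defeat the first player.\<close>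

lemma forces_kernel:
  fixes v :: "'a::real_normed_vector"
  assumes "\<not> forces v \<epsilon> dual_ball"
  obtains H where "oscillating v \<epsilon> H"
proof -
  define H where "H = {g\<in>dual_ball. \<forall>N. open N \<and> g \<in> N \<longrightarrow> \<not> forces v \<epsilon> (N \<inter> dual_ball)}"
  \<comment> \<open>A compact set missing \<open>H\<close> is covered by finitely many open sets on
    which the first player wins, and wins add up.\<close>
  have small: "forces v \<epsilon> L" if L: "compact L" "L \<subseteq> dual_ball" "L \<inter> H = {}" for L
  proof -
    let ?\<O> = "{N. open N \<and> forces v \<epsilon> (N \<inter> dual_ball)}"
    have "L \<subseteq> \<Union>?\<O>" using L(2,3) by (auto simp: H_def)
    moreover have "\<And>N. N \<in> ?\<O> \<Longrightarrow> open N" by simp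
    ultimately obtain \<O> where "\<O> \<subseteq> ?\<O>" "finite \<O>" "L \<subseteq> \<Union>\<O>" by (rule compactE[OF L(1)])
    then have "forces v \<epsilon> (\<Union>((\<lambda>N. N \<inter> dual_ball) ` \<O>))" by (intro forces_Union) auto
    then show ?thesis by (rule forces_mono) (use \<open>L \<subseteq> \<Union>\<O>\<close> L(2) in auto)
  qed
  have "oscillating v \<epsilon> H"
    unfolding oscillating_def
  proof (intro conjI allI impI)
    show "H \<subseteq> dual_ball" by (auto simp: H_def)
    show "H \<noteq> {}" using small[OF compact_dual_ball] assms by auto
    fix N and U :: "'a set"
    assume N: "open N" "N \<inter> H \<noteq> {}" and U: "weakly_open U" "U \<inter> cball 0 1 \<noteq> {}"
    show "\<exists>y\<in>U \<inter> cball 0 1. \<exists>g\<in>N \<inter> H. \<epsilon> \<le> g (v - y)"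
    proof (rule ccontr)
      assume neg: "\<not> ?thesis"
      obtain g0 where g0: "g0 \<in> N" "g0 \<in> H" using N by auto
      obtain M where M: "open M" "g0 \<in> M" "closure M \<subseteq> N"
        by (rule open_fun_regular[OF N(1) g0(1)])
      \<comment> \<open>If \<open>U\<close> is played first, any answer leaves a compact set of
        functionals missing \<open>H\<close>. So the first player would win near \<open>g0\<close>,
        against \<open>g0 \<in> H\<close>.\<close>
      have "forces v \<epsilon> (closure M \<inter> dual_ball)"
      proof (rule forces_step[OF U])
        fix y assume y: "y \<in> U \<inter> cball 0 1"
        show "forces v \<epsilon> (closure M \<inter> dual_ball \<inter> {g. \<epsilon> \<le> g (v - y)})"
        proof (rule small)
          show "compact (closure M \<inter> dual_ball \<inter> {g. \<epsilon> \<le> g (v - y)})"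
            using compact_dual_ball closed_eval_ge
            by (intro compact_Int_closed closed_Int_compact) auto
          show "closure M \<inter> dual_ball \<inter> {g. \<epsilon> \<le> g (v - y)} \<inter> H = {}"
            using neg y M(3) by force
        qed auto
      qed
      then have "forces v \<epsilon> (M \<inter> dual_ball)"
        by (rule forces_mono) (use closure_subset in auto)
      then show False using g0(2) M(1,2) by (auto simp: H_def)
    qed
  qed
  then show ?thesis by (rule that)
qed

section \<open>Asplund spaces\<close>

text \<open>The support function \<open>\<phi>\<close> of the kernel \<open>H\<close> is convex and
  Lipschitz. Where it is Frechet differentiable, all functionals of \<open>H\<close> that almost
  attain it are close to the derivative in norm, hence to each other. This contradicts the
  oscillation of \<open>H\<close> on that slice, applied to points \<open>y\<close> at which one of
  these functionals is small on \<open>v - y\<close>.\<close>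

lemma asplund_forces:
  fixes v :: "'a::banach"
  assumes asp: "asplund_space TYPE('a)" and v: "norm v \<le> 1" and \<epsilon>: "0 < \<epsilon>"
  shows "forces v \<epsilon> dual_ball"
proof (rule ccontr)
  assume "\<not> forces v \<epsilon> dual_ball"
  then obtain H where osc: "oscillating v \<epsilon> H" by (rule forces_kernel)
  note H = oscillating_subset[OF osc] oscillating_nonempty[OF osc]
  define \<phi> where "\<phi> x = (SUP g\<in>H. g x)" for x :: 'a
  have bdd: "bdd_above ((\<lambda>g. g x) ` H)" for x
    by (rule bdd_aboveI2[of _ _ "norm x"]) (use H dual_ball_le in auto)
  have up: "g x \<le> \<phi> x" if "g \<in> H" for g x
    unfolding \<phi>_def by (rule cSUP_upper[OF that bdd])
  have least: "\<phi> x \<le> m" if "\<And>g. g \<in> H \<Longrightarrow> g x \<le> m" for x m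
    unfolding \<phi>_def by (rule cSUP_least[OF H(2)]) (use that in auto)
  have lip: "\<phi> x - \<phi> y \<le> dist x y" for x y
  proof -
    have "\<phi> x \<le> \<phi> y + dist x y"
    proof (rule least)
      fix g assume g: "g \<in> H"
      then have "g (x - y) \<le> norm (x - y)" using H dual_ball_le by blast
      moreover have "g (x - y) = g x - g y" using g H dual_ball_linear linear_diff by blast
      ultimately show "g x \<le> \<phi> y + dist x y" using up[OF g, of y] by (simp add: dist_norm)
    qed
    then show ?thesis by simp
  qed
  have "1-lipschitz_on UNIV \<phi>"
    using lip by (intro lipschitz_onI) (auto simp: dist_real_def abs_le_iff dist_commute,
        metis dist_commute)
  then have cont: "continuous_on UNIV \<phi>" by (rule lipschitz_on_continuous_on)
  have conv: "convex_on UNIV \<phi>"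
  proof (rule convex_onI)
    fix t :: real and x y assume t: "0 < t" "t < 1"
    show "\<phi> ((1 - t) *\<^sub>R x + t *\<^sub>R y) \<le> (1 - t) * \<phi> x + t * \<phi> y"
    proof (rule least)
      fix g assume g: "g \<in> H"
      then have "linear g" using H dual_ball_linear by blast
      then have "g ((1 - t) *\<^sub>R x + t *\<^sub>R y) = (1 - t) * g x + t * g y"
        by (simp add: linear_add linear_scale)
      then show "g ((1 - t) *\<^sub>R x + t *\<^sub>R y) \<le> (1 - t) * \<phi> x + t * \<phi> y"
        using up[OF g] t by (simp add: add_mono mult_left_mono)
    qed
  qed simp
  obtain D where D: "UNIV \<subseteq> closure D" "\<forall>x\<in>D. \<phi> differentiable (at x)"
    using asp cont conv unfolding asplund_space_def by (metis convex_UNIV open_UNIV)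
  then obtain x0 where "\<phi> differentiable (at x0)" by (metis UNIV_not_empty closure_empty ex_in_conv subset_empty)
  then obtain A where A: "(\<phi> has_derivative A) (at x0)" by (auto simp: differentiable_def)
  \<comment> \<open>Members of the slice \<open>N\<close> of \<open>H\<close> deviate from the
    derivative by at most \<open>2 * \<kappa>\<close> in norm. On \<open>v - y\<close>, of norm at
    most 2, two of them differ by at most \<open>8 * \<kappa> = \<epsilon> / 4\<close>.\<close>
  define \<kappa> where "\<kappa> = \<epsilon> / 32"
  have "\<kappa> > 0" using \<epsilon> by (simp add: \<kappa>_def)
  obtain d where d: "d > 0" "\<And>y. norm (y - x0) < d \<Longrightarrow>
      norm (\<phi> y - \<phi> x0 - A (y - x0)) \<le> \<kappa> * norm (y - x0)"
    using A \<open>\<kappa> > 0\<close> unfolding has_derivative_at_alt by blast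
  define r where "r = d / 2"
  have r: "r > 0" "r < d" using d(1) by (auto simp: r_def)
  have linA: "linear A" using A by (auto dest: has_derivative_linear)
  define N where "N = {g :: 'a \<Rightarrow> real. \<phi> x0 - \<kappa> * r < g x0}"
  have near: "g h \<le> A h + 2 * \<kappa> * norm h" if g: "g \<in> N \<inter> H" for g h
  proof (cases "h = 0")
    case True
    have "linear g" using g H dual_ball_linear by blast
    then show ?thesis using True linear_0[of g] linear_0[OF linA] by simp
  next
    case False
    \<comment> \<open>\<open>h\<close> is rescaled to length \<open>r\<close>, where the error of
      differentiation and the depth of the slice are both \<open>\<kappa> * r\<close>.\<close>
    define c where "c = r / norm h"
    have c: "c > 0" using False r by (simp add: c_def)
    have nch: "norm (c *\<^sub>R h) = r" using False r by (simp add: c_def)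
    have ling: "linear g" using g H dual_ball_linear by blast
    have "\<phi> (x0 + c *\<^sub>R h) - \<phi> x0 - A (c *\<^sub>R h) \<le> \<kappa> * r"
      using d(2)[of "x0 + c *\<^sub>R h"] nch r by simp
    moreover have "g (x0 + c *\<^sub>R h) \<le> \<phi> (x0 + c *\<^sub>R h)" using up g by blast
    moreover have "g (x0 + c *\<^sub>R h) = g x0 + c * g h" using ling by (simp add: linear_add linear_scale)
    moreover have "A (c *\<^sub>R h) = c * A h" using linA by (simp add: linear_scale)
    ultimately have "c * g h \<le> c * A h + 2 * (\<kappa> * r)" using g by (simp add: N_def)
    also have "r = c * norm h" using False by (simp add: c_def)
    finally have "c * g h \<le> c * (A h + 2 * \<kappa> * norm h)" by (simp add: algebra_simps)
    then show ?thesis using c by simp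
  qed
  have "open N" unfolding N_def by (intro open_Collect_less continuous_intros continuous_on_eval)
  have "\<exists>g\<in>H. \<phi> x0 - \<kappa> * r < g x0"
    using less_cSUP_iff[OF H(2) bdd, of "\<phi> x0 - \<kappa> * r" x0] mult_pos_pos[OF \<open>\<kappa> > 0\<close> r(1)]
    by (simp add: \<phi>_def[symmetric])
  then obtain g0 where g0: "g0 \<in> N \<inter> H" by (auto simp: N_def)
  have g0': "g0 \<in> dual_ball" using g0 H by blast
  define U where "U = {y. g0 (v - y) < \<epsilon> / 4}"
  have U: "weakly_open U" "v \<in> U \<inter> cball 0 1"
    unfolding U_def by (rule weakly_open_slice_diff(2)[OF dual_ball_bounded_linear[OF g0']])
      (use v \<epsilon> linear_0[OF dual_ball_linear[OF g0']] in auto)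
  have "N \<inter> H \<noteq> {}" "U \<inter> cball 0 1 \<noteq> {}" using g0 U(2) by auto
  then obtain y g where y: "y \<in> U" "norm y \<le> 1" and g': "g \<in> N" "g \<in> H" "\<epsilon> \<le> g (v - y)"
    by (rule oscillatingE[OF osc \<open>open N\<close> _ U(1)])
  then have g: "g \<in> N \<inter> H" "\<epsilon> \<le> g (v - y)" by auto
  have "g (v - y) \<le> A (v - y) + 2 * \<kappa> * norm (v - y)" by (rule near[OF g(1)])
  moreover have "g0 (y - v) \<le> A (y - v) + 2 * \<kappa> * norm (y - v)" by (rule near[OF g0])
  moreover have "g0 (y - v) = - g0 (v - y)" "A (y - v) = - A (v - y)"
    using linear_neg[OF dual_ball_linear[OF g0'], of "v - y"] linear_neg[OF linA, of "v - y"] by auto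
  moreover have "\<kappa> * norm (v - y) \<le> \<kappa> * 2"
    using norm_triangle_ineq4[of v y] v y \<open>\<kappa> > 0\<close> by (intro mult_left_mono) auto
  moreover have "norm (y - v) = norm (v - y)" by (rule norm_minus_commute)
  ultimately have "g (v - y) \<le> g0 (v - y) + 8 * \<kappa>" by (simp add: algebra_simps)
  then show False using g(2) y \<epsilon> by (auto simp: U_def \<kappa>_def)
qed

section \<open>Real and scalar functionals\<close>

lemma cplx_zero [simp]: "cplx (0::'k::real_or_complex) = 0"
  using cplx_add[of "0::'k" 0] by simp

lemma cplx_of_real [simp]: "cplx (of_real r :: 'k::real_or_complex) = of_real r"
  using cplx_scaleR[of r "1::'k"] by (simp add: cplx_one of_real_def)

lemma cplx_minus [simp]: "cplx (- c :: 'k::real_or_complex) = - cplx c"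
  using cplx_add[of c "- c"] by (simp add: eq_neg_iff_add_eq_0 add.commute)

lemma cplx_diff: "cplx (c - d :: 'k::real_or_complex) = cplx c - cplx d"
  using cplx_add[of c "- d"] by simp

lemma cplx_inject [simp]: "cplx (c :: 'k::real_or_complex) = cplx d \<longleftrightarrow> c = d"
  using norm_cplx[of "c - d"] by (auto simp: cplx_diff)

lemma re_add: "re (c + d) = re c + re d"
  by (simp add: re_def cplx_add)

lemma re_scaleR: "re (r *\<^sub>R c) = r * re c"
  by (simp add: re_def cplx_scaleR)

lemma re_of_real [simp]: "re (of_real r :: 'k::real_or_complex) = r"
  by (simp add: re_def)

lemma re_one [simp]: "re (1 :: 'k::real_or_complex) = 1"
  using re_of_real[of 1, where 'k = 'k] by simp

lemma re_zero [simp]: "re (0 :: 'k::real_or_complex) = 0"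
  by (simp add: re_def)

lemma re_minus [simp]: "re (- c) = - re c"
  by (simp add: re_def)

lemma abs_re_le: "\<bar>re c\<bar> \<le> norm c"
  using abs_Re_le_cmod[of "cplx c"] by (simp add: re_def norm_cplx)

lemma re_le: "re c \<le> norm c"
  using abs_re_le[of c] by simp

lemma bounded_linear_re: "bounded_linear (re :: 'k::real_or_complex \<Rightarrow> real)"
  by (rule bounded_linear_intro[where K = 1]) (auto simp: re_add re_scaleR abs_re_le)

lemma real_or_complex_cases:
  obtains (real) "\<And>c::'k::real_or_complex. c = of_real (re c)"
  | (complex) i :: "'k::real_or_complex" where "cplx i = \<i>"
proof (cases "range (cplx :: 'k \<Rightarrow> complex) = \<real>")
  case True
  have "c = of_real (re c)" for c :: 'k
  proof -
    have "cplx c \<in> \<real>" using True by auto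
    then have "cplx c = cplx (of_real (re c) :: 'k)" by (auto simp: re_def elim: Reals_cases)
    then show ?thesis by (simp only: cplx_inject)
  qed
  then show ?thesis by (rule real)
next
  case False
  then have "range (cplx :: 'k \<Rightarrow> complex) = UNIV" using range_cplx by blast
  then show ?thesis using complex by (metis rangeE UNIV_I)
qed

text \<open>The scalar \<open>\<iota>\<close> is the imaginary unit in the complex case; in the real case \<open>0\<close> will do.\<close>

lemma imaginary_unit:
  obtains \<iota> :: "'k::real_or_complex" where "norm \<iota> \<le> 1" "\<forall>c. norm c \<le> \<bar>re c\<bar> + \<bar>re (\<iota> * c)\<bar>"
proof (cases rule: real_or_complex_cases[where 'k = 'k])
  case real
  have "norm c \<le> \<bar>re c\<bar>" for c :: 'k
    by (subst real[of c]) simp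
  then show ?thesis using that[of 0] by simp
next
  case (complex i)
  have "norm c \<le> \<bar>re c\<bar> + \<bar>re (i * c)\<bar>" for c
    using cmod_le[of "cplx c"] by (simp add: re_def cplx_mult complex norm_cplx)
  moreover have "norm i \<le> 1" using norm_cplx[of i] by (simp add: complex)
  ultimately show ?thesis using that by blast
qed

lemma unimodular_factor:
  obtains \<alpha> :: "'k::real_or_complex" where "norm \<alpha> = 1" "\<alpha> * c = of_real (norm c)"
proof (cases "c = 0")
  case True
  then show ?thesis using that[of 1] by simp
next
  case False
  then show ?thesis using that[of "of_real (norm c) / c"] by (simp add: norm_divide)
qed

context normed_space_over
begin

lemma dual_add: "f \<in> dual smul \<Longrightarrow> f (x + y) = f x + f y"
  and dual_smul: "f \<in> dual smul \<Longrightarrow> f (smul c x) = c * f x"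
  by (auto simp: dual_def bounded_linear_over_def Vector_Spaces.linear_iff)

lemma dual_scaleR: "f \<in> dual smul \<Longrightarrow> f (r *\<^sub>R x) = r *\<^sub>R f x"
  using dual_smul[of f "of_real r" x] by (simp add: scale_of_real scaleR_conv_of_real)

lemma dual_bounded_linear: 
  assumes "f \<in> dual smul"
  shows "bounded_linear f"
proof -
  obtain K where "\<forall>x. norm (f x) \<le> norm x * K"
    using assms by (auto simp: dual_def bounded_linear_over_def)
  then show ?thesis
    by (intro bounded_linear_intro[of f K]) (auto simp: dual_add[OF assms] dual_scaleR[OF assms])
qed

lemma dualI:
  assumes "\<And>x y. f (x + y) = f x + f y" "\<And>c x. f (smul c x) = c * f x" "\<And>x. norm (f x) \<le> K * norm x"
  shows "f \<in> dual smul"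
proof -
  have "vector_space ((*) :: 'k \<Rightarrow> 'k \<Rightarrow> 'k)" by unfold_locales (auto simp: algebra_simps)
  then show ?thesis
    unfolding dual_def bounded_linear_over_def Vector_Spaces.linear_iff
    using assms vector_space_axioms by (auto intro!: exI[of _ K] simp: mult.commute)
qed

lemma smul_scaleR: "smul c (r *\<^sub>R x) = r *\<^sub>R smul c x"
  using scale_left_commute[of c "of_real r" x] by (simp only: scale_of_real)

text \<open>The Bohnenblust-Sobczyk device: in the complex case
  \<open>F x = g x - i * g (i * x)\<close>, the only complex linear map with real part
  \<open>g\<close>. The one-sided bound on \<open>g\<close> bounds the norm of \<open>F x\<close>,
  because \<open>x\<close> can be rotated until this value is real and nonnegative.\<close>

lemma dual_of_real_functional:
  assumes g: "linear g" "\<And>x. g x \<le> m * norm x"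
  obtains F where "F \<in> dual smul" "\<And>x. re (F x) = g x" "\<And>x. norm (F x) \<le> m * norm x"
proof -
  have "\<exists>F. (\<forall>x y. F (x + y) = F x + F y) \<and> (\<forall>c x. F (smul c x) = c * F x) \<and> (\<forall>x. re (F x) = g x)"
  proof (cases rule: real_or_complex_cases[where 'k = 'k])
    case real
    have "g (smul c x) = re c * g x" for c x
      using linear_scale[OF g(1), of "re c" x] scale_of_real[of "re c" x] real[of c] by simp
    then show ?thesis
      by (intro exI[of _ "\<lambda>x. of_real (g x)"] conjI allI)
         (auto simp: linear_add[OF g(1)] real[symmetric])
  next
    case (complex i)
    have ii: "i * i = - 1"
      using complex by (subst cplx_inject[symmetric]) (simp add: cplx_mult cplx_one)
    define F where "F x = of_real (g x) - i * of_real (g (smul i x))" for x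
    have hom: "F (smul c x) = c * F x" for c x
    proof -
      obtain a b where ab: "a = re c" "b = Im (cplx c)" by simp
      have c: "c = of_real a + i * of_real b"
        by (subst cplx_inject[symmetric])
           (simp add: cplx_add cplx_mult complex ab re_def complex_eq_iff)
      have "smul c x = a *\<^sub>R x + b *\<^sub>R smul i x"
        unfolding c by (simp add: scale_left_distrib scale_of_real scale_scale[symmetric] smul_scaleR)
      then have 1: "g (smul c x) = a * g x + b * g (smul i x)"
        by (simp add: linear_add[OF g(1)] linear_scale[OF g(1)])
      have "smul i (smul c x) = a *\<^sub>R smul i x + b *\<^sub>R smul (i * i) x"
        using \<open>smul c x = _\<close> by (simp add: scale_right_distrib smul_scaleR)
      then have 2: "g (smul i (smul c x)) = a * g (smul i x) - b * g x"
        using ii by (simp add: linear_add[OF g(1)] linear_diff[OF g(1)] linear_scale[OF g(1)])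
      have "F (smul c x) = of_real (a * g x + b * g (smul i x)) - i * of_real (a * g (smul i x) - b * g x)"
        unfolding F_def 1 2 ..
      also have "\<dots> = of_real a * of_real (g x) + of_real b * of_real (g (smul i x))
          - i * (of_real a * of_real (g (smul i x))) + i * (of_real b * of_real (g x))"
        by (simp add: algebra_simps)
      also have "\<dots> = (of_real a + i * of_real b) * F x"
      proof -
        have "i * of_real b * (i * of_real (g (smul i x))) = (i * i) * (of_real b * of_real (g (smul i x)))"
          by (simp add: algebra_simps)
        then show ?thesis unfolding F_def ii by (simp add: algebra_simps)
      qed
      finally show ?thesis using c by simp
    qed
    have "re (i * of_real r) = 0" for r by (simp add: re_def cplx_mult complex)
    then have "re (F x) = g x" for x
      using re_add[of "of_real (g x)" "- (i * of_real (g (smul i x)))"] by (simp add: F_def)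
    moreover have "F (x + y) = F x + F y" for x y
      by (simp add: F_def linear_add[OF g(1)] scale_right_distrib algebra_simps)
    ultimately show ?thesis using hom by blast
  qed
  then obtain F where F: "\<And>x y. F (x + y) = F x + F y" "\<And>c x. F (smul c x) = c * F x"
    "\<And>x. re (F x) = g x" by blast
  have bd: "norm (F x) \<le> m * norm x" for x
  proof -
    obtain \<alpha> where \<alpha>: "norm \<alpha> = 1" "\<alpha> * F x = of_real (norm (F x))" by (rule unimodular_factor)
    have "norm (F x) = g (smul \<alpha> x)" using F(3)[of "smul \<alpha> x"] \<alpha>(2) by (simp add: F(2))
    also have "\<dots> \<le> m * norm x" using g(2)[of "smul \<alpha> x"] \<alpha>(1) by (simp add: norm_scale)
    finally show ?thesis .
  qed
  show ?thesis using that[OF dualI[OF F(1,2) bd] F(3) bd] .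
qed

lemma dual_of_dual_ball:
  assumes "g \<in> dual_ball"
  obtains F where "F \<in> dual smul" "\<And>x. re (F x) = g x" "\<And>x. norm (F x) \<le> norm x"
proof -
  obtain F where "F \<in> dual smul" "\<And>x. re (F x) = g x" "\<And>x. norm (F x) \<le> 1 * norm x"
    by (rule dual_of_real_functional[of g 1]) (use dual_ball_linear dual_ball_le assms in auto)
  then show ?thesis using that[of F] by simp
qed

lemma dual_re_bounded_linear:
  assumes "f \<in> dual smul"
  shows "bounded_linear (\<lambda>x. re (c * f x))"
  using bounded_linear_compose[OF bounded_linear_re
      bounded_linear_compose[OF bounded_linear_mult_right dual_bounded_linear[OF assms]]] .

lemma dual_norm_le: "f \<in> dual smul \<Longrightarrow> norm (f x) \<le> onorm f * norm x"
  using onorm[OF dual_bounded_linear] by blast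

lemma dual_re_dual_ball:
  assumes "f \<in> dual smul" "onorm f \<le> 1" "norm c \<le> 1"
  shows "(\<lambda>x. re (c * f x)) \<in> dual_ball"
proof -
  have "re (c * f x) \<le> norm x" for x
  proof -
    have "norm (f x) \<le> norm x"
      using dual_norm_le[OF assms(1), of x] mult_right_mono[OF assms(2), of "norm x"] by simp
    then have "norm (c * f x) \<le> 1 * norm x"
      unfolding norm_mult using assms(3) by (intro mult_mono) auto
    then show ?thesis using re_le[of "c * f x"] by simp
  qed
  then show ?thesis
    unfolding dual_ball_def
    using bounded_linear.linear[OF dual_re_bounded_linear[OF assms(1)]] by simp
qed

lemma norming_functional:
  assumes x: "norm x = 1"
  obtains h where "h \<in> dual smul" "onorm h = 1" "h x = 1"
proof -
  obtain g where g: "g \<in> dual_ball" "g x = norm x" by (rule support_functional)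
  obtain h where h: "h \<in> dual smul" "\<And>x. re (h x) = g x" "\<And>x. norm (h x) \<le> norm x"
    using dual_of_dual_ball[OF g(1)] by blast
  have "re (h x) = 1" "norm (h x) \<le> 1" using h(2)[of x] h(3)[of x] g x by auto
  then have "cplx (h x) = 1"
    using norm_cplx[of "h x"] cmod_power2[of "cplx (h x)"] power_le_one[of "norm (h x)" 2]
    by (auto simp: re_def complex_eq_iff)
  then have "h x = 1" by (metis cplx_inject cplx_one)
  moreover have "onorm h = 1"
  proof (rule antisym)
    show "onorm h \<le> 1" using h(3) by (intro onorm_bound) auto
    show "1 \<le> onorm h" using dual_norm_le[OF h(1), of x] \<open>h x = 1\<close> x by simp
  qed
  ultimately show ?thesis using h(1) that by blast
qed

section \<open>The alternative Daugavet property\<close>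

text \<open>Numerical index one, applied to the rank one operator \<open>z \<mapsto> f z \<cdot> x\<close>.\<close>

lemma alternative_daugavet:
  assumes n1: "numerical_index_one smul" and f: "f \<in> dual smul" "onorm f = 1" and x: "norm x = 1"
    and \<kappa>: "0 < \<kappa>"
  obtains z h where "norm z = 1" "h \<in> dual smul" "onorm h = 1" "h z = 1"
    "1 - \<kappa> < norm (f z)" "1 - \<kappa> < norm (h x)"
proof -
  define T where "T z = smul (f z) x" for z
  have "bounded_linear_over smul smul T"
    unfolding bounded_linear_over_def Vector_Spaces.linear_iff
    using vector_space_axioms dual_norm_le[OF f(1)] f(2) x
    by (auto simp: T_def dual_add[OF f(1)] dual_smul[OF f(1)] scale_left_distrib norm_scale intro!: exI[of _ 1])
  then have "(SUP z\<in>numerical_range smul T. norm z) = onorm T"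
    using n1 by (simp add: numerical_index_one_def)
  also have "onorm T = 1" using f(2) by (simp add: onorm_def T_def norm_scale x)
  finally have sup: "(SUP z\<in>numerical_range smul T. norm z) = 1" .
  have elem: "\<exists>z h. norm z = 1 \<and> h \<in> dual smul \<and> onorm h = 1 \<and> h z = 1 \<and> c = f z * h x \<and>
      norm (f z) \<le> 1 \<and> norm (h x) \<le> 1" if "c \<in> numerical_range smul T" for c
  proof -
    obtain z h where zh: "c = h (T z)" "norm z = 1" "h \<in> dual smul" "onorm h = 1" "h z = 1"
      using \<open>c \<in> _\<close> by (auto simp: numerical_range_def)
    then show ?thesis
      using dual_norm_le[OF f(1), of z] dual_norm_le[OF zh(3), of x] f(2) x
      by (intro exI[of _ z] exI[of _ h]) (auto simp: T_def dual_smul)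
  qed
  have bdd: "bdd_above (norm ` numerical_range smul T)"
  proof (rule bdd_aboveI2)
    fix c assume "c \<in> numerical_range smul T"
    then show "norm c \<le> 1" using elem mult_le_one norm_mult norm_ge_zero by metis
  qed
  have ne: "numerical_range smul T \<noteq> {}"
  proof -
    obtain h where "h \<in> dual smul" "onorm h = 1" "h x = 1" by (rule norming_functional[OF x])
    then show ?thesis using x by (force simp: numerical_range_def)
  qed
  obtain c where c: "c \<in> numerical_range smul T" "1 - \<kappa> < norm c"
    using less_cSUP_iff[OF ne bdd, of "1 - \<kappa>"] sup \<kappa> by auto
  obtain z h where zh: "norm z = 1" "h \<in> dual smul" "onorm h = 1" "h z = 1" "c = f z * h x"
    "norm (f z) \<le> 1" "norm (h x) \<le> 1" using elem[OF c(1)] by blast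
  \<comment> \<open>Both factors of \<open>c\<close> are at most one in modulus, so each is at least
    as large as the product.\<close>
  have "norm c \<le> norm (f z)" "norm c \<le> norm (h x)"
    unfolding zh(5) norm_mult using zh(6,7) by (auto simp: mult_left_le mult_left_le_one_le)
  then show ?thesis using that[of z h] zh c(2) by auto
qed

end

section \<open>Shrinking slices of the dual ball\<close>

definition dual_slice :: "'a::real_normed_vector \<Rightarrow> real \<Rightarrow> ('a \<Rightarrow> real) set" where
  "dual_slice x \<rho> = {h\<in>dual_ball. 1 - \<rho> < h x}"

context normed_space_over
begin

text \<open>The functional \<open>f\<close> is \<open>- \<phi>\<close> normalised. By the
  alternative Daugavet property \<open>x + smul \<theta> y\<close> has almost norm two for a
  suitable rotation, and a functional almost norming this sum is almost one at both summands. So the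
  slice in the direction of the sum lies in the old one, while \<open>y\<close> almost minimises
  \<open>\<phi>\<close> over the ball.\<close>

lemma slice_refinement:
  assumes n1: "numerical_index_one smul" and x: "norm x = 1" and \<rho>: "0 < \<rho>" and \<eta>: "0 < \<eta>"
    and \<phi>: "bounded_linear \<phi>" and w: "norm w \<le> 1" and \<kappa>: "0 < \<kappa>"
  obtains y \<theta> x' \<rho>' where "norm y \<le> 1" "norm \<theta> = 1" "norm x' = 1" "0 < \<rho>'"
    "dual_slice x' \<rho>' \<subseteq> dual_slice x \<rho>" "\<forall>h\<in>dual_slice x' \<rho>'. 1 - \<eta> < h (smul \<theta> y)"
    "\<phi> y < \<phi> w + (\<kappa>::real)"
proof -
  define m where "m = onorm \<phi>"
  have m0: "0 \<le> m" by (simp add: m_def onorm_pos_le[OF \<phi>])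
  have \<phi>le: "\<bar>\<phi> y\<bar> \<le> m * norm y" for y using onorm[OF \<phi>, of y] by (simp add: m_def)
  \<comment> \<open>For \<open>\<phi> = 0\<close> every functional of norm one will do, since the
    relation is multiplied by \<open>m = 0\<close>.\<close>
  have "\<exists>f. f \<in> dual smul \<and> onorm f = 1 \<and> (\<forall>y. m * re (f y) = - \<phi> y)"
  proof (cases "m = 0")
    case True
    obtain f where "f \<in> dual smul" "onorm f = 1" by (rule norming_functional[OF x])
    moreover have "\<phi> y = 0" for y using \<phi>le[of y] True by simp
    ultimately show ?thesis using True by auto
  next
    case False
    then have m: "m > 0" using m0 by simp
    have "linear (\<lambda>y. - \<phi> y / m)"
      using bounded_linear.linear[OF \<phi>]
      by (auto simp: linear_iff add_divide_distrib)
    moreover have "- \<phi> y / m \<le> 1 * norm y" for y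
      using \<phi>le[of y] m by (simp add: field_simps abs_le_iff)
    ultimately obtain f where f: "f \<in> dual smul" "\<And>y. re (f y) = - \<phi> y / m" "\<And>y. norm (f y) \<le> 1 * norm y"
      by (rule dual_of_real_functional) blast
    have "onorm f = 1"
    proof (rule antisym)
      show "onorm f \<le> 1" using f(3) by (intro onorm_bound) auto
      have "norm (\<phi> y) \<le> (m * onorm f) * norm y" for y
      proof -
        have "\<bar>\<phi> y\<bar> = m * \<bar>re (f y)\<bar>" using f(2)[of y] m by simp
        also have "\<dots> \<le> m * (onorm f * norm y)"
          using abs_re_le[of "f y"] dual_norm_le[OF f(1), of y] m by (intro mult_left_mono) auto
        finally show ?thesis by simp
      qed
      then have "m \<le> m * onorm f"
        unfolding m_def[symmetric] using onorm_bound[of "m * onorm f" \<phi>] m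
        by (simp add: m_def[symmetric] onorm_pos_le dual_bounded_linear[OF f(1)])
      then show "1 \<le> onorm f" using m by simp
    qed
    then show ?thesis using f m by auto
  qed
  then obtain f where f: "f \<in> dual smul" "onorm f = 1" "\<And>y. m * re (f y) = - \<phi> y" by blast
  \<comment> \<open>The new slice loses at most \<open>3 * \<kappa>0\<close> at each summand, which
    stays below \<open>\<rho>\<close> and \<open>\<eta>\<close>. The last bound gives
    \<open>m * \<kappa>0 < \<kappa>\<close>, and \<open>1 / 2\<close> keeps
    \<open>1 - \<kappa>0\<close> positive.\<close>
  define \<kappa>0 where "\<kappa>0 = min (min (\<rho> / 4) (\<eta> / 4)) (min (1 / 2) (\<kappa> / (2 * (m + 1))))"
  have k0: "0 < \<kappa>0" "\<kappa>0 \<le> \<rho> / 4" "\<kappa>0 \<le> \<eta> / 4" "\<kappa>0 \<le> 1 / 2" "\<kappa>0 \<le> \<kappa> / (2 * (m + 1))"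
  proof -
    have "0 < \<kappa> / (2 * (m + 1))" using \<kappa> m0 by simp
    then show "0 < \<kappa>0" using \<rho> \<eta> by (simp add: \<kappa>0_def)
    show "\<kappa>0 \<le> \<rho> / 4" "\<kappa>0 \<le> \<eta> / 4" "\<kappa>0 \<le> 1 / 2" "\<kappa>0 \<le> \<kappa> / (2 * (m + 1))"
      unfolding \<kappa>0_def by linarith+
  qed
  have mk: "m * \<kappa>0 < \<kappa>"
  proof -
    have "m * \<kappa>0 \<le> m * (\<kappa> / (2 * (m + 1)))" using k0(5) m0 by (rule mult_left_mono)
    also have "\<dots> < \<kappa>" using m0 \<kappa> add_nonneg_pos[of "\<kappa> * m" "\<kappa> * 2"] by (simp add: field_simps)
    finally show ?thesis .
  qed
  obtain z h where zh: "norm z = 1" "h \<in> dual smul" "onorm h = 1" "h z = 1"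
    "1 - \<kappa>0 < norm (f z)" "1 - \<kappa>0 < norm (h x)"
    by (rule alternative_daugavet[OF n1 f(1,2) x k0(1)])
  obtain \<alpha> where \<alpha>: "norm \<alpha> = 1" "\<alpha> * f z = of_real (norm (f z))" by (rule unimodular_factor)
  obtain \<beta> where \<beta>: "norm \<beta> = 1" "\<beta> * h x = of_real (norm (h x))" by (rule unimodular_factor)
  define y where "y = smul \<alpha> z"
  \<comment> \<open>With this factor \<open>\<beta> * h (smul \<theta> y) = 1\<close>, in phase with
    \<open>\<beta> * h x\<close>.\<close>
  define \<theta> where "\<theta> = 1 / (\<beta> * \<alpha>)"
  have nz: "\<alpha> \<noteq> 0" "\<beta> \<noteq> 0" using \<alpha>(1) \<beta>(1) by auto
  have y1: "norm y = 1" using \<alpha>(1) zh(1) by (simp add: y_def norm_scale)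
  have \<theta>: "norm \<theta> = 1" using \<alpha>(1) \<beta>(1) by (simp add: \<theta>_def norm_divide norm_mult)
  define v where "v = x + smul \<theta> y"
  have "(\<lambda>x. re (\<beta> * h x)) \<in> dual_ball" by (rule dual_re_dual_ball) (use zh \<beta> in auto)
  then have "re (\<beta> * h v) \<le> norm v" by (rule dual_ball_le)
  moreover have "\<beta> * h v = of_real (norm (h x)) + 1"
    using nz by (simp add: v_def dual_add[OF zh(2)] dual_smul[OF zh(2)] y_def zh(4) distrib_left \<beta>(2) \<theta>_def)
  ultimately have nv: "2 - \<kappa>0 < norm v" using zh(6) by (simp add: re_add)
  define x' where "x' = v /\<^sub>R norm v"
  have v0: "norm v > 0" using nv k0 by linarith
  have x': "norm x' = 1" using v0 by (simp add: x'_def)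
  have key: "1 - 3 * \<kappa>0 < g x \<and> 1 - 3 * \<kappa>0 < g (smul \<theta> y) \<and> g \<in> dual_ball"
    if g: "g \<in> dual_slice x' \<kappa>0" for g
  proof -
    have gd: "g \<in> dual_ball" and gx: "1 - \<kappa>0 < g x'" using g by (auto simp: dual_slice_def)
    have lg: "linear g" using gd by (rule dual_ball_linear)
    have "g x' = g v / norm v" by (simp add: x'_def linear_scale[OF lg] divide_inverse mult.commute)
    then have "(1 - \<kappa>0) * norm v < g v" using gx v0 by (simp add: field_simps)
    moreover have "(1 - \<kappa>0) * (2 - \<kappa>0) \<le> (1 - \<kappa>0) * norm v"
      using nv k0 by (intro mult_left_mono) auto
    moreover have "(1 - \<kappa>0) * (2 - \<kappa>0) = 2 - 3 * \<kappa>0 + \<kappa>0 * \<kappa>0" by (simp add: algebra_simps)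
    moreover have "0 \<le> \<kappa>0 * \<kappa>0" by simp
    moreover have "g v = g x + g (smul \<theta> y)" by (simp add: v_def linear_add[OF lg])
    moreover have "g x \<le> 1" "g (smul \<theta> y) \<le> 1"
      using dual_ball_le[OF gd, of x] dual_ball_le[OF gd, of "smul \<theta> y"] x y1 \<theta> by (auto simp: norm_scale)
    ultimately show ?thesis using gd by linarith
  qed
  show ?thesis
  proof
    show "norm y \<le> 1" "norm \<theta> = 1" "norm x' = 1" "0 < \<kappa>0" using y1 \<theta> x' k0 by auto
    show "dual_slice x' \<kappa>0 \<subseteq> dual_slice x \<rho>"
      using key k0 unfolding dual_slice_def[of x] by force
    show "\<forall>g\<in>dual_slice x' \<kappa>0. 1 - \<eta> < g (smul \<theta> y)"
      using key k0 by force
    have "m * (1 - \<kappa>0) \<le> m * norm (f z)" using zh(5) m0 by (intro mult_left_mono) auto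
    moreover have "m * norm (f z) = - \<phi> y"
      using f(3)[of y] \<alpha>(2) by (simp add: y_def dual_smul[OF f(1)])
    moreover have "m * norm w \<le> m" using w m0 by (simp add: mult_left_le)
    ultimately show "\<phi> y < \<phi> w + \<kappa>" using \<phi>le[of w] mk by (simp add: algebra_simps abs_le_iff)
  qed
qed

text \<open>\<open>Y\<close> collects the points chosen so far. The condition on it concerns all
  functionals of the slice, so it persists when the slice shrinks further, and stages can be
  composed.\<close>

definition refines ::
    "'a \<Rightarrow> real \<Rightarrow> real \<Rightarrow> 'a set \<Rightarrow> 'a \<Rightarrow> real \<Rightarrow> bool" where
  "refines x \<rho> \<eta> Y x' \<rho>' \<longleftrightarrow> finite Y \<and> Y \<subseteq> cball 0 1 \<and> norm x' = 1 \<and> 0 < \<rho>' \<and>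
     dual_slice x' \<rho>' \<subseteq> dual_slice x \<rho> \<and>
     (\<forall>h\<in>dual_slice x' \<rho>'. \<forall>y\<in>Y. \<exists>\<theta>. norm \<theta> = 1 \<and> 1 - \<eta> < h (smul \<theta> y))"

lemma refines_refl: "norm x = 1 \<Longrightarrow> 0 < \<rho> \<Longrightarrow> refines x \<rho> \<eta> {} x \<rho>"
  by (simp add: refines_def)

lemma refines_trans:
  "refines x \<rho> \<eta> Y x' \<rho>' \<Longrightarrow> refines x' \<rho>' \<eta> Z x'' \<rho>'' \<Longrightarrow> refines x \<rho> \<eta> (Y \<union> Z) x'' \<rho>''"
  unfolding refines_def by blast

text \<open>The points are chosen greedily: the next one has a nonpositive scalar product with the error
  accumulated so far, up to a constant. Hence after \<open>N\<close> steps the squared error is of order \<open>N\<close>, and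
  the averages converge weakly to \<open>w\<close>.\<close>

lemma weak_approachability:
  assumes n1: "numerical_index_one smul" and x: "norm x = 1" and \<rho>: "0 < \<rho>" and \<eta>: "0 < \<eta>"
    and U: "weakly_open U" and w: "w \<in> U" "norm w \<le> 1"
  obtains Y x' \<rho>' y where "refines x \<rho> \<eta> Y x' \<rho>'" "y \<in> convex hull Y" "y \<in> U"
proof -
  obtain \<Phi> \<delta> where \<Phi>: "finite \<Phi>" "\<forall>f\<in>\<Phi>. bounded_linear f" "\<delta> > 0"
    "\<And>y. (\<And>f. f \<in> \<Phi> \<Longrightarrow> \<bar>f (y - w) :: real\<bar> < \<delta>) \<Longrightarrow> y \<in> U"
    using weakly_openE[OF U w(1)] by metis
  have lin: "linear f" if "f \<in> \<Phi>" for f using \<Phi>(2) that bounded_linear.linear by blast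
  \<comment> \<open>Each step adds at most this much to the squared error:
    \<open>norm (y - w) \<le> 2\<close>, and the summand 1 pays for the slack \<open>1 / 2\<close>
    in the scalar product.\<close>
  define C where "C = 1 + (\<Sum>f\<in>\<Phi>. (2 * onorm f)\<^sup>2)"
  have C1: "C \<ge> 1" by (auto simp: C_def intro: sum_nonneg)
  \<comment> \<open>\<open>s\<close> is the sum of the errors \<open>y - w\<close> over the
    \<open>Suc N\<close> points chosen, so the point of the hull is their average.\<close>
  have step: "\<exists>Y x' \<rho>' s. refines x \<rho> \<eta> Y x' \<rho>' \<and> w + s /\<^sub>R real (Suc N) \<in> convex hull Y \<and>
      (\<Sum>f\<in>\<Phi>. (f s)\<^sup>2) \<le> real (Suc N) * C" for N
  proof -
    have next_point: "\<exists>Y' x'' \<rho>'' y. refines x \<rho> \<eta> Y' x'' \<rho>'' \<and> Y' = insert y Y \<and>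
        (\<Sum>f\<in>\<Phi>. (f (s + (y - w)))\<^sup>2) \<le> (\<Sum>f\<in>\<Phi>. (f s)\<^sup>2) + C"
      if R: "refines x \<rho> \<eta> Y x' \<rho>'" for Y x' \<rho>' s
    proof -
      \<comment> \<open>The scalar product with the accumulated error, in the coordinates given by
        \<open>\<Phi>\<close>.\<close>
      have bl: "bounded_linear (\<lambda>y. \<Sum>f\<in>\<Phi>. f s * f y)"
        using \<Phi>(2) by (intro bounded_linear_sum bounded_linear_const_mult) auto
      have x': "norm x' = 1" "0 < \<rho>'" using R by (auto simp: refines_def)
      have half: "0 < (1 / 2 :: real)" by simp
      obtain y \<theta> x'' \<rho>'' where y: "norm y \<le> 1" "norm \<theta> = 1" "norm x'' = 1" "0 < \<rho>''"
        "dual_slice x'' \<rho>'' \<subseteq> dual_slice x' \<rho>'" "\<forall>h\<in>dual_slice x'' \<rho>''. 1 - \<eta> < h (smul \<theta> y)"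
        "(\<Sum>f\<in>\<Phi>. f s * f y) < (\<Sum>f\<in>\<Phi>. f s * f w) + 1 / 2"
        by (rule slice_refinement[OF n1 x' \<eta> bl w(2) half])
      have "refines x' \<rho>' \<eta> {y} x'' \<rho>''" using y(1-6) by (auto simp: refines_def)
      then have R': "refines x \<rho> \<eta> (insert y Y) x'' \<rho>''" using refines_trans[OF R, of "{y}"] by simp
      have "(f (s + (y - w)))\<^sup>2 \<le> (f s)\<^sup>2 + 2 * (f s * f y) - 2 * (f s * f w) + (2 * onorm f)\<^sup>2"
        if f: "f \<in> \<Phi>" for f
      proof -
        have bl: "bounded_linear f" using \<Phi>(2) f by blast
        have "\<bar>f (y - w)\<bar> \<le> onorm f * norm (y - w)" using onorm[OF bl, of "y - w"] by simp
        also have "\<dots> \<le> onorm f * 2"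
          using norm_triangle_ineq4[of y w] y(1) w(2) by (intro mult_left_mono onorm_pos_le[OF bl]) auto
        finally have "\<bar>f (y - w)\<bar>\<^sup>2 \<le> (2 * onorm f)\<^sup>2" by (intro power_mono) (auto simp: mult.commute)
        then show ?thesis
          using lin[OF f] by (simp add: linear_add linear_diff power2_eq_square algebra_simps)
      qed
      then have "(\<Sum>f\<in>\<Phi>. (f (s + (y - w)))\<^sup>2) \<le>
          (\<Sum>f\<in>\<Phi>. (f s)\<^sup>2 + 2 * (f s * f y) - 2 * (f s * f w) + (2 * onorm f)\<^sup>2)"
        by (rule sum_mono)
      also have "\<dots> = (\<Sum>f\<in>\<Phi>. (f s)\<^sup>2) + 2 * (\<Sum>f\<in>\<Phi>. f s * f y) - 2 * (\<Sum>f\<in>\<Phi>. f s * f w)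
          + (\<Sum>f\<in>\<Phi>. (2 * onorm f)\<^sup>2)"
        by (simp add: sum.distrib sum_subtractf sum_distrib_left)
      also have "\<dots> \<le> (\<Sum>f\<in>\<Phi>. (f s)\<^sup>2) + C" using y(7) by (simp add: C_def)
      finally show ?thesis using R' by blast
    qed
    show ?thesis
    proof (induction N)
      case 0
      obtain Y x' \<rho>' y where "refines x \<rho> \<eta> Y x' \<rho>'" "Y = {y}"
        "(\<Sum>f\<in>\<Phi>. (f (0 + (y - w)))\<^sup>2) \<le> (\<Sum>f\<in>\<Phi>. (f 0)\<^sup>2) + C"
        using next_point[OF refines_refl[OF x \<rho>], of 0] by blast
      moreover have "(\<Sum>f\<in>\<Phi>. (f 0)\<^sup>2) = 0" using lin by (simp add: linear_0)
      ultimately show ?case by (intro exI[of _ Y] exI[of _ x'] exI[of _ \<rho>'] exI[of _ "y - w"]) auto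
    next
      case (Suc N)
      then obtain Y x' \<rho>' s where IH: "refines x \<rho> \<eta> Y x' \<rho>'" "w + s /\<^sub>R real (Suc N) \<in> convex hull Y"
        "(\<Sum>f\<in>\<Phi>. (f s)\<^sup>2) \<le> real (Suc N) * C" by blast
      obtain Y' x'' \<rho>'' y where Y': "refines x \<rho> \<eta> Y' x'' \<rho>''" "Y' = insert y Y"
        "(\<Sum>f\<in>\<Phi>. (f (s + (y - w)))\<^sup>2) \<le> (\<Sum>f\<in>\<Phi>. (f s)\<^sup>2) + C"
        using next_point[OF IH(1), of s] by blast
      define t where "t = 1 / real (Suc (Suc N))"
      have t: "0 \<le> t" "t \<le> 1" "1 - t = real (Suc N) * t" by (auto simp: t_def field_simps)
      have "(1 - t) *\<^sub>R (w + s /\<^sub>R real (Suc N)) + t *\<^sub>R y \<in> convex hull Y'"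
        using IH(2) hull_mono[of Y Y' convex] hull_inc[of y Y' convex] t Y'(2)
        by (intro convexD_alt[OF convex_convex_hull]) auto
      also have "(1 - t) *\<^sub>R (w + s /\<^sub>R real (Suc N)) + t *\<^sub>R y
          = w + (s + (y - w)) /\<^sub>R real (Suc (Suc N))"
      proof -
        have "((1 - t) * inverse (real (Suc N))) = t" unfolding t(3) by simp
        then have "(1 - t) *\<^sub>R (s /\<^sub>R real (Suc N)) = t *\<^sub>R s" by (metis scaleR_scaleR)
        then show ?thesis
          by (simp add: t_def[symmetric] inverse_eq_divide algebra_simps del: of_nat_Suc)
      qed
      finally have "w + (s + (y - w)) /\<^sub>R real (Suc (Suc N)) \<in> convex hull Y'" .
      moreover have "(\<Sum>f\<in>\<Phi>. (f (s + (y - w)))\<^sup>2) \<le> real (Suc (Suc N)) * C"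
        using Y'(3) IH(3) by (simp add: algebra_simps)
      ultimately show ?case using Y'(1) by blast
    qed
  qed
  \<comment> \<open>The average after \<open>Suc N\<close> steps has an error of at most
    \<open>sqrt (C / Suc N)\<close> in each coordinate, which is below \<open>\<delta>\<close> for
    this \<open>N\<close>.\<close>
  obtain N where N: "C / \<delta>\<^sup>2 < real (Suc N)"
    by (metis less_Suc_eq of_nat_less_iff order_less_trans reals_Archimedean2)
  obtain Y x' \<rho>' s where Y: "refines x \<rho> \<eta> Y x' \<rho>'" "w + s /\<^sub>R real (Suc N) \<in> convex hull Y"
    "(\<Sum>f\<in>\<Phi>. (f s)\<^sup>2) \<le> real (Suc N) * C" using step by blast
  have "w + s /\<^sub>R real (Suc N) \<in> U"
  proof (rule \<Phi>(4))
    fix f assume f: "f \<in> \<Phi>"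
    have "(f s)\<^sup>2 \<le> (\<Sum>f\<in>\<Phi>. (f s)\<^sup>2)" using f \<Phi>(1) by (intro member_le_sum) auto
    also have "\<dots> \<le> real (Suc N) * C" by (rule Y(3))
    also have "\<dots> < real (Suc N) * (real (Suc N) * \<delta>\<^sup>2)"
      using N \<Phi>(3) by (intro mult_strict_left_mono) (auto simp: field_simps)
    also have "\<dots> = (real (Suc N) * \<delta>)\<^sup>2" by (simp add: power2_eq_square)
    finally have "\<bar>f s\<bar> < real (Suc N) * \<delta>"
      using \<Phi>(3) by (intro power2_less_imp_less[of "\<bar>f s\<bar>"]) auto
    moreover have "f (s /\<^sub>R real (Suc N)) = f s / real (Suc N)"
      using linear_scale[OF lin[OF f]] by (simp add: divide_inverse mult.commute)
    moreover have "w + s /\<^sub>R real (Suc N) - w = s /\<^sub>R real (Suc N)" by simp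
    ultimately show "\<bar>f (w + s /\<^sub>R real (Suc N) - w)\<bar> < \<delta>"
      by (simp add: pos_divide_less_eq mult.commute del: of_nat_Suc)
  qed
  then show ?thesis using that[OF Y(1,2)] by blast
qed

text \<open>The winning strategy is followed against answers built by
  \<open>weak_approachability\<close>. Single good points are provided only in slices; in a general
  weakly open set an average of good points is found instead, and it is an admissible answer. This
  is why the conclusion speaks of the convex hull.\<close>

lemma forces_refines:
  assumes n1: "numerical_index_one smul" and \<eta>: "0 < \<eta>" and "forces v \<epsilon> L"
    and "norm x = 1" "0 < \<rho>"
  shows "\<exists>Y x' \<rho>'. refines x \<rho> \<eta> Y x' \<rho>' \<and> (\<forall>g\<in>L. \<exists>y\<in>convex hull Y. g (v - y) < \<epsilon>)"
  using assms(3-)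
proof (induction arbitrary: x \<rho> rule: forces.induct)
  case forces_empty
  then show ?case using refines_refl by blast
next
  case (forces_step U L)
  obtain w where w: "w \<in> U" "norm w \<le> 1" using forces_step.hyps(2) by auto
  obtain Y x' \<rho>' y where Y: "refines x \<rho> \<eta> Y x' \<rho>'" "y \<in> convex hull Y" "y \<in> U"
    by (rule weak_approachability[OF n1 forces_step.prems \<eta> forces_step.hyps(1) w])
  have "convex hull Y \<subseteq> cball 0 1"
    using Y(1) by (intro hull_minimal) (auto simp: refines_def)
  then have "y \<in> U \<inter> cball 0 1" using Y by auto
  moreover have "norm x' = 1" "0 < \<rho>'" using Y(1) by (auto simp: refines_def)
  ultimately obtain Z x'' \<rho>'' where Z: "refines x' \<rho>' \<eta> Z x'' \<rho>''"
    "\<forall>g\<in>L \<inter> {g. \<epsilon> \<le> g (v - y)}. \<exists>y\<in>convex hull Z. g (v - y) < \<epsilon>"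
    using forces_step.IH by blast
  have "\<exists>y\<in>convex hull (Y \<union> Z). g (v - y) < \<epsilon>" if "g \<in> L" for g
  proof (cases "\<epsilon> \<le> g (v - y)")
    case True
    then have "\<exists>y\<in>convex hull Z. g (v - y) < \<epsilon>" using that by (intro Z(2)[rule_format]) simp
    then show ?thesis using hull_mono[of Z "Y \<union> Z" convex] by (elim bexE) (intro bexI; auto)
  next
    case False
    then show ?thesis using Y(2) hull_mono[of Y "Y \<union> Z" convex] by (intro bexI[of _ y]) auto
  qed
  then show ?case using refines_trans[OF Y(1) Z(1)] by (intro exI conjI) auto
qed

text \<open>A form of lushness, now with one point of the hull. Before, each \<open>g\<close> had
  its own; but if the whole hull kept distance \<open>\<epsilon>\<close> from \<open>v\<close>,
  separation would give a single \<open>g\<close> for which no point is good.\<close>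

lemma forces_lush:
  assumes n1: "numerical_index_one smul" and "0 < \<eta>" and "forces v \<epsilon> dual_ball" and u: "norm u = 1"
  obtains h Y y where "h \<in> dual_ball" "1 - \<eta> < h u" "finite Y" "Y \<subseteq> cball 0 1"
    "\<And>y. y \<in> Y \<Longrightarrow> \<exists>\<theta>. norm \<theta> = 1 \<and> 1 - \<eta> < h (smul \<theta> y)"
    "y \<in> convex hull Y" "norm (v - y) < \<epsilon>"
proof -
  obtain Y x' \<rho>' where Y: "refines u \<eta> \<eta> Y x' \<rho>'" "\<forall>g\<in>dual_ball. \<exists>y\<in>convex hull Y. g (v - y) < \<epsilon>"
    using forces_refines[OF assms, of \<eta>] assms(2) by blast
  \<comment> \<open>Any functional of the final slice will do; one that norms \<open>x'\<close>
    belongs to it.\<close>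
  obtain h where "h \<in> dual_ball" "h x' = norm x'" by (rule support_functional)
  then have h: "h \<in> dual_slice x' \<rho>'" using Y(1) by (auto simp: refines_def dual_slice_def)
  have "\<exists>y\<in>convex hull Y. norm (v - y) < \<epsilon>"
  proof (rule ccontr)
    assume neg: "\<not> ?thesis"
    have "convex hull Y \<noteq> {}" using Y(2) zero_in_dual_ball by blast
    then obtain g where "g \<in> dual_ball" "\<And>c. c \<in> convex hull Y \<Longrightarrow> \<epsilon> \<le> g (v - c)"
      by (rule dual_ball_separation_point[OF convex_convex_hull, of Y \<epsilon> v]) (use neg in force)+
    then show False using Y(2) by force
  qed
  then obtain y where y: "y \<in> convex hull Y" "norm (v - y) < \<epsilon>" by blast
  show ?thesis
    by (rule that[of h Y y]) (use h Y(1) y in \<open>auto simp: refines_def dual_slice_def\<close>)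
qed

end

section \<open>The convex point of continuity property\<close>

lemma weakly_open_Union:
  assumes "\<And>U. U \<in> \<U> \<Longrightarrow> weakly_open U"
  shows "weakly_open (\<Union>\<U>)"
  unfolding weakly_open_def
proof
  fix w assume "w \<in> \<Union>\<U>"
  then obtain U where U: "U \<in> \<U>" "w \<in> U" by blast
  obtain \<Phi> \<delta> where "finite \<Phi>" "\<forall>f\<in>\<Phi>. bounded_linear f" "\<delta> > 0"
    "\<And>y. (\<And>f. f \<in> \<Phi> \<Longrightarrow> \<bar>f (y - w) :: real\<bar> < \<delta>) \<Longrightarrow> y \<in> U"
    using weakly_openE[OF assms[OF U(1)] U(2)] by metis
  then show "\<exists>\<Phi> \<delta>. finite \<Phi> \<and> (\<forall>f\<in>\<Phi>. bounded_linear f) \<and> \<delta> > 0 \<and>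
     (\<forall>y. (\<forall>f\<in>\<Phi>. \<bar>f (y - w) :: real\<bar> < \<delta>) \<longrightarrow> y \<in> \<Union>\<U>)"
    using U(1) by (intro exI[of _ \<Phi>] exI[of _ \<delta>] conjI allI impI UnionI[of U]) simp_all
qed

text \<open>Points at which the identity on the ball, from the weak to the norm topology, has
  oscillation at most \<open>\<delta>\<close>.\<close>

definition small_points :: "real \<Rightarrow> 'a::real_normed_vector set" where
  "small_points \<delta> = {w\<in>cball 0 1. \<exists>U. weakly_open U \<and> w \<in> U \<and>
     (\<forall>a\<in>U \<inter> cball 0 1. \<forall>b\<in>U \<inter> cball 0 1. norm (a - b) < \<delta>)}"

text \<open>The first player names in advance small neighbourhoods of the points of a convex
  combination near \<open>v\<close>. Each answer is close to the corresponding point, so the same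
  combination of the answers is close to \<open>v\<close>, and no functional in the dual ball can
  reach \<open>\<epsilon>\<close> on all the differences.\<close>

lemma forces_small_points:
  fixes v :: "'a::real_normed_vector"
  assumes v: "v \<in> closure (convex hull small_points (\<epsilon> / 2))" and \<epsilon>: "0 < \<epsilon>"
  shows "forces v \<epsilon> dual_ball"
proof -
  obtain x where x: "x \<in> convex hull small_points (\<epsilon> / 2)" "dist x v < \<epsilon> / 2"
    using v \<epsilon> closure_approachable by (metis half_gt_zero)
  obtain S u where S: "finite S" "S \<subseteq> small_points (\<epsilon> / 2)" "\<And>s. s \<in> S \<Longrightarrow> 0 \<le> u s"
    "sum u S = 1" "(\<Sum>s\<in>S. u s *\<^sub>R s) = x"
    using x(1) unfolding convex_hull_explicit by auto
  have "\<forall>s\<in>S. \<exists>U. weakly_open U \<and> s \<in> U \<and>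
     (\<forall>a\<in>U \<inter> cball 0 1. \<forall>b\<in>U \<inter> cball 0 1. norm (a - b) < \<epsilon> / 2)"
    using S(2) by (auto simp: small_points_def)
  then obtain U where U: "\<And>s. s \<in> S \<Longrightarrow> weakly_open (U s)" "\<And>s. s \<in> S \<Longrightarrow> s \<in> U s"
     "\<And>s a b. s \<in> S \<Longrightarrow> a \<in> U s \<inter> cball 0 1 \<Longrightarrow> b \<in> U s \<inter> cball 0 1 \<Longrightarrow> norm (a - b) < \<epsilon> / 2"
    by metis
  have SB: "s \<in> cball 0 1" if "s \<in> S" for s using S(2) that by (auto simp: small_points_def)
  show ?thesis
  proof (rule forces_finite[OF S(1), of U])
    show "weakly_open (U s)" if "s \<in> S" for s using U(1)[OF that] .
    show "U s \<inter> cball 0 1 \<noteq> {}" if "s \<in> S" for s using U(2)[OF that] SB[OF that] by blast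
    fix y g assume y: "\<And>s. s \<in> S \<Longrightarrow> y s \<in> U s \<inter> cball 0 1" and g: "(g :: 'a \<Rightarrow> real) \<in> dual_ball"
    show "\<exists>s\<in>S. g (v - y s) < \<epsilon>"
    proof (rule ccontr)
      assume "\<not> ?thesis"
      then have neg: "\<epsilon> \<le> g (v - y s)" if "s \<in> S" for s using that by force
      have lg: "linear g" using g by (rule dual_ball_linear)
      have "g (v - x) < \<epsilon> / 2"
        using dual_ball_le[OF g, of "v - x"] x(2) by (simp add: dist_norm norm_minus_commute)
      moreover have "g (s - y s) \<le> \<epsilon> / 2" if "s \<in> S" for s
        using dual_ball_le[OF g, of "s - y s"] U(3)[OF that _ y[OF that], of s] U(2)[OF that] SB[OF that]
        by (metis IntI less_imp_le order_trans)
      then have "(\<Sum>s\<in>S. u s * g (s - y s)) \<le> (\<Sum>s\<in>S. u s * (\<epsilon> / 2))"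
        using S(3) by (intro sum_mono mult_left_mono) auto
      moreover have "(\<Sum>s\<in>S. u s * (\<epsilon> / 2)) = \<epsilon> / 2"
        unfolding sum_distrib_right[symmetric] S(4) by simp
      moreover have "(\<Sum>s\<in>S. u s * g (s - y s)) = g x - (\<Sum>s\<in>S. u s * g (y s))"
        by (simp add: S(5)[symmetric] linear_sum[OF lg] linear_scale[OF lg] linear_diff[OF lg]
            right_diff_distrib sum_subtractf)
      moreover have "(\<Sum>s\<in>S. u s * \<epsilon>) \<le> (\<Sum>s\<in>S. u s * g (v - y s))"
        using S(3) neg by (intro sum_mono mult_left_mono) auto
      moreover have "(\<Sum>s\<in>S. u s * g (v - y s)) = g v - (\<Sum>s\<in>S. u s * g (y s))"
        using S(4) by (simp add: linear_diff[OF lg] right_diff_distrib sum_subtractf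
            sum_distrib_right[symmetric])
      moreover have "(\<Sum>s\<in>S. u s * \<epsilon>) = \<epsilon>"
        using S(4) by (simp add: sum_distrib_right[symmetric])
      ultimately show False by (simp add: linear_diff[OF lg])
    qed
  qed
qed

definition thick :: "real \<Rightarrow> 'a::real_normed_vector set \<Rightarrow> bool" where
  "thick \<delta> D \<longleftrightarrow> (\<forall>U. weakly_open U \<longrightarrow> U \<inter> D \<noteq> {} \<longrightarrow> (\<exists>a\<in>U \<inter> D. \<exists>b\<in>U \<inter> D. \<delta> \<le> norm (a - b)))"

text \<open>By \<open>forces_small_points\<close>, \<open>v\<close> lies off the closed convex hull
  of the small points, so a slice of the ball on the side of \<open>v\<close> contains none of
  them.\<close>

lemma not_forces_thick_set:
  fixes v :: "'a::real_normed_vector"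
  assumes nf: "\<not> forces v \<epsilon> dual_ball" and v: "norm v \<le> 1" and \<epsilon>: "0 < \<epsilon>"
  obtains D :: "'a set" where "D \<noteq> {}" "closed D" "convex D" "D \<subseteq> cball 0 1"
    "thick (\<epsilon> / 2) D"
proof -
  define E :: "'a set" where "E = small_points (\<epsilon> / 2)"
  have "\<exists>g\<in>dual_ball. \<exists>\<alpha><g v. \<forall>e\<in>E. g e \<le> \<alpha>"
  proof (cases "E = {}")
    case True
    \<comment> \<open>Without small points the whole ball serves as the slice: \<open>g = 0\<close>
      and \<open>\<alpha> = -1\<close>.\<close>
    then show ?thesis using zero_in_dual_ball by (intro bexI[of _ "\<lambda>x. 0"]) (auto intro: exI[of _ "-1"])
  next
    case False
    have "v \<notin> closure (convex hull E)" using forces_small_points[OF _ \<epsilon>] nf by (auto simp: E_def)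
    then obtain d where d: "d > 0" "\<And>c. c \<in> convex hull E \<Longrightarrow> d \<le> norm (v - c)"
      unfolding closure_approachable by (auto simp: dist_norm norm_minus_commute not_less)
    obtain g where g: "g \<in> dual_ball" "\<And>c. c \<in> convex hull E \<Longrightarrow> d \<le> g (v - c)"
      by (rule dual_ball_separation_point[OF convex_convex_hull, of E d v]) (use d False in auto)
    have "g e \<le> g v - d" if "e \<in> E" for e
      using g(2)[of e] hull_inc[OF that, of convex] linear_diff[OF dual_ball_linear[OF g(1)]] by simp
    then show ?thesis using g(1) d(1) by (intro bexI[of _ g] exI[of _ "g v - d"]) auto
  qed
  then obtain g \<alpha> where g: "g \<in> dual_ball" "\<alpha> < g v" "\<And>e. e \<in> E \<Longrightarrow> g e \<le> \<alpha>" by blast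
  have lg: "linear g" and bg: "bounded_linear g"
    using g(1) dual_ball_linear dual_ball_bounded_linear by auto
  define \<beta> where "\<beta> = (\<alpha> + g v) / 2"
  have \<beta>: "\<alpha> < \<beta>" "\<beta> < g v" using g(2) by (auto simp: \<beta>_def)
  define D where "D = cball 0 1 \<inter> {x. \<beta> \<le> g x}"
  show ?thesis
  proof (rule that[of D])
    show "D \<noteq> {}" using v \<beta> by (auto simp: D_def intro!: exI[of _ v])
    show "closed D" unfolding D_def
      by (intro closed_Int closed_cball closed_Collect_le continuous_on_const linear_continuous_on[OF bg])
    have "convex {x. \<beta> \<le> g x}"
      using convex_linear_vimage[OF lg, of "{\<beta>..}"] by (simp add: vimage_def)
    then show "convex D" unfolding D_def by (intro convex_Int) auto
    show "D \<subseteq> cball 0 1" by (auto simp: D_def)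
    have "\<exists>a\<in>U \<inter> D. \<exists>b\<in>U \<inter> D. \<epsilon> / 2 \<le> norm (a - b)" if U: "weakly_open U" "U \<inter> D \<noteq> {}" for U
    proof -
    obtain w where w: "w \<in> U" "norm w \<le> 1" "\<beta> \<le> g w" using U by (auto simp: D_def)
    \<comment> \<open>A point of \<open>D\<close> may lie on the hyperplane
      \<open>g = \<beta>\<close>. Moving towards \<open>v\<close> brings it into the open slice,
      which is weakly open.\<close>
    obtain t where t: "0 < t" "t < 1" "w + t *\<^sub>R (v - w) \<in> U" by (rule weakly_open_segment[OF U(1) w(1)])
    define w' where "w' = w + t *\<^sub>R (v - w)"
    have "w' = (1 - t) *\<^sub>R w + t *\<^sub>R v" by (simp add: w'_def algebra_simps)
    then have "w' \<in> cball 0 1"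
      using convexD_alt[OF convex_cball, of w 0 1 v t] w(2) v t by auto
    have "g w' = g w + t * (g v - g w)"
      by (simp add: w'_def linear_add[OF lg] linear_scale[OF lg] linear_diff[OF lg])
    also have "\<dots> = (1 - t) * g w + t * g v" by (simp add: algebra_simps)
    also have "\<dots> > (1 - t) * \<beta> + t * \<beta>"
      using t w(3) \<beta> by (intro add_le_less_mono mult_left_mono mult_strict_left_mono) auto
    finally have gw': "\<beta> < g w'" by (simp add: algebra_simps)
    define U' where "U' = U \<inter> {x. \<beta> < g x}"
    have "weakly_open U'" unfolding U'_def by (intro weakly_open_Int U(1) weakly_open_slice bg)
    moreover have "w' \<in> U'" using t(3) gw' by (auto simp: U'_def w'_def)
    moreover have "w' \<notin> E" using g(3) gw' \<beta>(1) by force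
    ultimately obtain a b where "a \<in> U' \<inter> cball 0 1" "b \<in> U' \<inter> cball 0 1" "\<epsilon> / 2 \<le> norm (a - b)"
      using \<open>w' \<in> cball 0 1\<close> unfolding E_def small_points_def by force
    then show "\<exists>a\<in>U \<inter> D. \<exists>b\<in>U \<inter> D. \<epsilon> / 2 \<le> norm (a - b)"
      by (intro bexI[of _ a] bexI[of _ b]) (auto simp: U'_def D_def)
    qed
    then show "thick (\<epsilon> / 2) D" by (simp add: thick_def)
  qed
qed

context normed_space_over
begin

text \<open>A scalar is small once its real part and that of its multiple by \<open>\<iota>\<close>
  are, so two real functionals replace each scalar one.\<close>

lemma openin_weak_topology_weakly_open:
  assumes "openin (weak_topology smul) U"
  shows "weakly_open U"
proof -
  obtain \<iota> :: 'k where \<iota>: "norm \<iota> \<le> 1" "\<forall>c. norm c \<le> \<bar>re c\<bar> + \<bar>re (\<iota> * c)\<bar>" by (rule imaginary_unit)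
  have "generate_topology_on {f -` V | f V. f \<in> dual smul \<and> open V} U"
    using assms by (simp add: weak_topology_def openin_topology_generated_by_iff)
  then show ?thesis
  proof (induction rule: generate_topology_on.induct)
    case Empty
    show ?case by (simp add: weakly_open_def)
  next
    case (Int a b)
    show ?case by (rule weakly_open_Int) fact+
  next
    case (UN K)
    then show ?case by (intro weakly_open_Union) auto
  next
    case (Basis s)
    then obtain f V where f: "f \<in> dual smul" and V: "open V" and s: "s = f -` V" by blast
    show ?case unfolding weakly_open_def
    proof
      fix w assume "w \<in> s"
      then obtain e where e: "e > 0" "ball (f w) e \<subseteq> V" using V s openE by blast
      let ?\<Phi> = "{\<lambda>x. re (1 * f x), \<lambda>x. re (\<iota> * f x)}"
      have "y \<in> s" if "\<forall>\<phi>\<in>?\<Phi>. \<bar>\<phi> (y - w)\<bar> < e / 2" for y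
      proof -
        have "f w = f y - f (y - w)" using dual_add[OF f, of "y - w" w] by simp
        then have "dist (f w) (f y) = norm (f (y - w))" by (simp add: dist_norm)
        also have "\<dots> < e" using \<iota>(2)[rule_format, of "f (y - w)"] that by simp
        finally show ?thesis using e(2) s by (auto simp: subset_iff)
      qed
      moreover have "\<forall>\<phi>\<in>?\<Phi>. bounded_linear \<phi>" using dual_re_bounded_linear[OF f] by blast
      ultimately show "\<exists>\<Phi> \<delta>. finite \<Phi> \<and> (\<forall>f\<in>\<Phi>. bounded_linear f) \<and> \<delta> > 0 \<and>
          (\<forall>y. (\<forall>f\<in>\<Phi>. \<bar>f (y - w) :: real\<bar> < \<delta>) \<longrightarrow> y \<in> s)"
        using e(1) by (intro exI[of _ ?\<Phi>] exI[of _ "e / 2"] conjI allI impI) simp_all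
    qed
  qed
qed

lemma cpcp_forces:
  fixes v :: 'a
  assumes cp: "convex_point_of_continuity_property smul" and v: "norm v \<le> 1" and \<epsilon>: "0 < \<epsilon>"
  shows "forces v \<epsilon> dual_ball"
proof (rule ccontr)
  assume "\<not> ?thesis"
  then obtain D :: "'a set" where D: "D \<noteq> {}" "closed D" "convex D" "D \<subseteq> cball 0 1"
    "thick (\<epsilon> / 2) D"
    by (rule not_forces_thick_set[OF _ v \<epsilon>])
  have "bounded D" using D(4) bounded_cball bounded_subset by blast
  then obtain x where x: "x \<in> D" "topcontinuous_at (subtopology (weak_topology smul) D) (top_of_set D) id x"
    using cp D(1-3) unfolding convex_point_of_continuity_property_def by blast
  have "openin (top_of_set D) (D \<inter> ball x (\<epsilon> / 4))" by auto
  moreover have "id x \<in> D \<inter> ball x (\<epsilon> / 4)" using x(1) \<epsilon> by simp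
  ultimately obtain W where W: "openin (subtopology (weak_topology smul) D) W" "x \<in> W"
    "\<forall>y\<in>W. id y \<in> D \<inter> ball x (\<epsilon> / 4)"
    using x(2) unfolding topcontinuous_at_def by blast
  then obtain U where U: "openin (weak_topology smul) U" "W = U \<inter> D" by (auto simp: openin_subtopology)
  have "U \<inter> D \<noteq> {}" using U(2) W(2) by blast
  then obtain a b where ab: "a \<in> W" "b \<in> W" "\<epsilon> / 2 \<le> norm (a - b)"
    using D(5)[unfolded thick_def, rule_format, OF openin_weak_topology_weakly_open[OF U(1)]] U(2) by blast
  have "dist x a < \<epsilon> / 4" "dist x b < \<epsilon> / 4" using W(3) ab(1,2) by auto
  then have "dist a b < \<epsilon> / 2" using dist_triangle3[of a b x] by linarith
  then show False using ab(3) by (simp add: dist_norm)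
qed

end

section \<open>Spaces not containing \<open>\<ell>\<^sub>1\<close>\<close>

text \<open>If \<open>y\<close> works for the first open set, with functional \<open>g\<close>, then it has a weak neighbourhood all
  of whose points work for \<open>g\<close>; the point for the next open set is sought there.\<close>

lemma kernel_common_point:
  assumes osc: "oscillating v \<epsilon> H" and c: "c < \<epsilon>"
    and "finite \<O>" "\<And>N. N \<in> \<O> \<Longrightarrow> open N \<and> N \<inter> H \<noteq> {}"
    and "weakly_open U" "U \<inter> cball 0 1 \<noteq> {}"
  shows "\<exists>U'\<subseteq>U. weakly_open U' \<and> U' \<inter> cball 0 1 \<noteq> {} \<and> (\<forall>N\<in>\<O>. \<exists>g\<in>N \<inter> H. \<forall>y\<in>U'. c < g (v - y))"
  using assms(3-)
proof (induction \<O> arbitrary: U)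
  case empty
  then show ?case by blast
next
  case (insert N \<O>)
  obtain U' where U': "U' \<subseteq> U" "weakly_open U'" "U' \<inter> cball 0 1 \<noteq> {}"
    "\<forall>N\<in>\<O>. \<exists>g\<in>N \<inter> H. \<forall>y\<in>U'. c < g (v - y)"
    using insert.IH[OF _ insert.prems(2,3)] insert.prems(1) by auto
  obtain y g where yg: "y \<in> U' \<inter> cball 0 1" "g \<in> N \<inter> H" "\<epsilon> \<le> g (v - y)"
    using oscillatingE[OF osc _ _ U'(2,3), of N] insert.prems(1)[of N] by force
  define U'' where "U'' = U' \<inter> {y. c < g (v - y)}"
  have "bounded_linear g" using yg(2) oscillating_subset[OF osc] dual_ball_bounded_linear by blast
  then have "weakly_open U''" unfolding U''_def by (intro weakly_open_Int U'(2) weakly_open_slice_diff)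
  moreover have "U'' \<subseteq> U" "y \<in> U'' \<inter> cball 0 1" using U'(1) yg c by (auto simp: U''_def)
  moreover have "\<exists>g\<in>M \<inter> H. \<forall>y\<in>U''. c < g (v - y)" if "M \<in> insert N \<O>" for M
  proof (cases "M = N")
    case True
    then show ?thesis using yg(2) by (auto simp: U''_def)
  next
    case False
    then obtain g where "g \<in> M \<inter> H" "\<forall>y\<in>U'. c < g (v - y)" using U'(4) \<open>M \<in> insert N \<O>\<close> by blast
    then show ?thesis by (auto simp: U''_def)
  qed
  ultimately show ?case by blast
qed

text \<open>Membership in \<open>\<sigma>\<close> is encoded by a large value and non-membership by
  a value near zero. The condition at \<open>smul \<iota> (z i)\<close> makes the scalar value small
  and not only its real part.\<close>

definition sign_pattern ::
    "('k::real_or_complex \<Rightarrow> 'a::real_normed_vector \<Rightarrow> 'a) \<Rightarrow> 'k \<Rightarrow> real \<Rightarrow> real \<Rightarrow> nat set \<Rightarrow>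
     (nat \<Rightarrow> 'a) \<Rightarrow> nat \<Rightarrow> ('a \<Rightarrow> real) set" where
  "sign_pattern smul \<iota> c d \<sigma> z n =
     {g. \<forall>i<n. if i \<in> \<sigma> then c < g (z i) else \<bar>g (z i)\<bar> < d \<and> \<bar>g (smul \<iota> (z i))\<bar> < d}"

lemma open_sign_pattern: "open (sign_pattern smul \<iota> c d \<sigma> z n)"
proof -
  have "sign_pattern smul \<iota> c d \<sigma> z n = (\<Inter>i\<in>{..<n}. if i \<in> \<sigma> then {g. c < g (z i)}
      else {g. \<bar>g (z i)\<bar> < d} \<inter> {g. \<bar>g (smul \<iota> (z i))\<bar> < d})"
    unfolding sign_pattern_def by (auto split: if_splits)
  also have "open \<dots>"
    by (intro open_INT ballI)
       (auto intro!: open_Int open_Collect_less continuous_intros continuous_on_eval)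
  finally show ?thesis .
qed

context normed_space_over
begin

lemma bounded_linear_smul: "bounded_linear (smul c)"
  by (rule bounded_linear_intro[where K = "norm c"])
     (auto simp: scale_right_distrib smul_scaleR norm_scale mult.commute)

text \<open>For patterns without \<open>n\<close> the old functionals are kept, with
  \<open>y\<close> confined to a weak neighbourhood of \<open>v\<close> in which they are all small
  on \<open>v - y\<close>. For patterns with \<open>n\<close>, \<open>kernel_common_point\<close>
  finds \<open>y\<close> in this neighbourhood together with new functionals.\<close>

lemma independent_extension:
  fixes v :: 'a
  assumes osc: "oscillating v \<epsilon> H" and v: "norm v \<le> 1" and c: "c < \<epsilon>" and d: "0 < d"
    and z: "\<And>\<sigma>. sign_pattern smul \<iota> c d \<sigma> z n \<inter> H \<noteq> {}"
  shows "\<exists>y. norm y \<le> 1 \<and> (\<forall>\<sigma>. sign_pattern smul \<iota> c d \<sigma> (z(n := v - y)) (Suc n) \<inter> H \<noteq> {})"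
proof -
  define P where "P \<sigma> = sign_pattern smul \<iota> c d \<sigma> z n" for \<sigma>
  \<comment> \<open>Only the finitely many traces of \<open>\<sigma>\<close> below \<open>n\<close>
    matter.\<close>
  have Pcut: "P \<sigma> = P (\<sigma> \<inter> {..<n})" for \<sigma> by (auto simp: P_def sign_pattern_def)
  define \<O> where "\<O> = P ` Pow {..<n}"
  have "\<forall>\<sigma>. \<exists>g. g \<in> P \<sigma> \<inter> H" using z by (auto simp: P_def)
  then obtain G where G: "\<And>\<sigma>. G \<sigma> \<in> P \<sigma> \<inter> H" by metis
  have bl: "bounded_linear (G \<sigma>)" for \<sigma> using G oscillating_subset[OF osc] dual_ball_bounded_linear by blast
  have bl': "bounded_linear (\<lambda>x. G \<sigma> (smul \<iota> x))" for \<sigma>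
    using bounded_linear_compose[OF bl bounded_linear_smul] .
  define U where "U = (\<Inter>\<sigma>\<in>Pow {..<n}. ({y. G \<sigma> (v - y) < d} \<inter> {y. - d < G \<sigma> (v - y)}) \<inter>
      ({y. G \<sigma> (smul \<iota> (v - y)) < d} \<inter> {y. - d < G \<sigma> (smul \<iota> (v - y))}))"
  have "weakly_open U"
    unfolding U_def using bl bl'
    by (intro weakly_open_Inter weakly_open_Int finite_Pow_iff[THEN iffD2] finite_lessThan
        weakly_open_slice_diff weakly_open_slice_diff[of "\<lambda>x. G _ (smul \<iota> x)"])
  moreover have "v \<in> U \<inter> cball 0 1"
    using v d by (auto simp: U_def linear_0[OF bounded_linear.linear[OF bl]])
  moreover have "finite \<O>" by (simp add: \<O>_def)
  moreover have "open N \<and> N \<inter> H \<noteq> {}" if "N \<in> \<O>" for N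
    using that z by (auto simp: \<O>_def P_def open_sign_pattern)
  ultimately obtain U' where U': "U' \<subseteq> U" "U' \<inter> cball 0 1 \<noteq> {}"
    "\<forall>N\<in>\<O>. \<exists>g\<in>N \<inter> H. \<forall>y\<in>U'. c < g (v - y)"
    using kernel_common_point[OF osc c, of \<O> U] by blast
  then obtain y where y: "y \<in> U'" "norm y \<le> 1" by auto
  have "sign_pattern smul \<iota> c d \<sigma> (z(n := v - y)) (Suc n) \<inter> H \<noteq> {}" for \<sigma>
  proof -
    let ?\<tau> = "\<sigma> \<inter> {..<n}"
    have "\<exists>g\<in>P \<sigma> \<inter> H. if n \<in> \<sigma> then c < g (v - y)
        else \<bar>g (v - y)\<bar> < d \<and> \<bar>g (smul \<iota> (v - y))\<bar> < d"
    proof (cases "n \<in> \<sigma>")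
      case True
      have "P \<sigma> \<in> \<O>" unfolding Pcut[of \<sigma>] by (auto simp: \<O>_def)
      then show ?thesis using U'(3) y(1) True by auto
    next
      case False
      have "G ?\<tau> \<in> P \<sigma> \<inter> H" using G[of ?\<tau>] Pcut[of \<sigma>] by simp
      moreover have "\<bar>G ?\<tau> (v - y)\<bar> < d \<and> \<bar>G ?\<tau> (smul \<iota> (v - y))\<bar> < d"
      proof -
        have "y \<in> U" using y(1) U'(1) by blast
        then have "G ?\<tau> (v - y) < d" "- d < G ?\<tau> (v - y)"
          "G ?\<tau> (smul \<iota> (v - y)) < d" "- d < G ?\<tau> (smul \<iota> (v - y))"
          unfolding U_def by blast+
        then show ?thesis by linarith
      qed
      ultimately show ?thesis using False by auto
    qed
    then show ?thesis by (auto simp: P_def sign_pattern_def less_Suc_eq split: if_splits)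
  qed
  then show ?thesis using y(2) by blast
qed

lemma independent_sequence:
  fixes v :: 'a
  assumes nf: "\<not> forces v \<epsilon> dual_ball" and v: "norm v \<le> 1" and c: "c < \<epsilon>" and d: "0 < d"
  obtains z :: "nat \<Rightarrow> 'a" where "\<forall>i. norm (z i) \<le> 2" "\<forall>n \<sigma>. sign_pattern smul \<iota> c d \<sigma> z n \<inter> dual_ball \<noteq> {}"
proof -
  obtain H where osc: "oscillating v \<epsilon> H" by (rule forces_kernel[OF nf])
  define Q where "Q n z \<longleftrightarrow> (\<forall>\<sigma>. sign_pattern smul \<iota> c d \<sigma> z n \<inter> H \<noteq> {})" for n z
  define R where "R n z z' \<longleftrightarrow> (\<exists>y. norm y \<le> 1 \<and> z' = z(n := v - y))" for n :: nat and z z' :: "nat \<Rightarrow> 'a"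
  have "\<exists>f. \<forall>n. Q n (f n) \<and> R n (f n) (f (Suc n))"
  proof (rule dependent_nat_choice)
    show "\<exists>z. Q 0 z" using oscillating_nonempty[OF osc] by (simp add: Q_def sign_pattern_def)
    fix z n assume "Q n z"
    then show "\<exists>z'. Q (Suc n) z' \<and> R n z z'"
      using independent_extension[OF osc v c d, of \<iota> z n] unfolding Q_def R_def by blast
  qed
  then obtain f where f: "\<And>n. Q n (f n)" "\<And>n. R n (f n) (f (Suc n))" by blast
  \<comment> \<open>Entry \<open>i\<close> is set in the step from stage \<open>i\<close> to stage
    \<open>Suc i\<close> and never changed afterwards.\<close>
  define z where "z i = f (Suc i) i" for i
  have agree: "f n i = z i" if "i < n" for n i
    using that
  proof (induction n)
    case (Suc n)
    then show ?case using f(2)[of n] by (cases "i = n") (auto simp: z_def R_def)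
  qed simp
  have "norm (z i) \<le> 2" for i
  proof -
    obtain y where "norm y \<le> 1" "z i = v - y" using f(2)[of i] by (auto simp: z_def R_def)
    then show ?thesis using norm_triangle_ineq4[of v y] v by simp
  qed
  moreover have "sign_pattern smul \<iota> c d \<sigma> z n \<inter> dual_ball \<noteq> {}" for n \<sigma>
  proof -
    have "sign_pattern smul \<iota> c d \<sigma> (f n) n = sign_pattern smul \<iota> c d \<sigma> z n"
      using agree by (simp add: sign_pattern_def)
    then show ?thesis using f(1)[of n] oscillating_subset[OF osc] unfolding Q_def by blast
  qed
  ultimately show ?thesis using that[of z] by blast
qed

end

section \<open>Scalar phases and a lower estimate by the \<open>ell1\<close> norm\<close>

lemma cplx_range_closed: "closed (range (cplx :: 'k::real_or_complex \<Rightarrow> complex))"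
  using range_cplx[where 'a = 'k] by (auto simp: closed_complex_Reals)

text \<open>Through \<open>cplx\<close> the unimodular scalars become a compact subset of the
  circle, for both fields at once.\<close>

lemma unimodular_net:
  assumes "0 < \<eta>"
  obtains \<Omega> :: "'k::real_or_complex set" where "finite \<Omega>" "\<forall>\<omega>\<in>\<Omega>. norm \<omega> = 1"
    "\<forall>a. \<exists>\<omega>\<in>\<Omega>. norm (a - of_real (norm a) * \<omega>) \<le> \<eta> * norm a"
proof -
  define S where "S = range (cplx :: 'k \<Rightarrow> complex) \<inter> sphere 0 1"
  have "compact S" unfolding S_def by (rule closed_Int_compact[OF cplx_range_closed]) simp
  then obtain k where k: "finite k" "k \<subseteq> S" "S \<subseteq> (\<Union>x\<in>k. ball x \<eta>)"
    by (rule compactE_image[of S S "\<lambda>x. ball x \<eta>"]) (use assms in auto)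
  have inv: "cplx (inv cplx x :: 'k) = x" if "x \<in> k" for x
    using that k(2) by (intro f_inv_into_f) (auto simp: S_def)
  show ?thesis
  proof (rule that[of "inv cplx ` k"])
    show "finite (inv cplx ` k :: 'k set)" using k(1) by simp
    show "\<forall>\<omega>\<in>inv cplx ` k :: 'k set. norm \<omega> = 1"
    proof
      fix \<omega> :: 'k assume "\<omega> \<in> inv cplx ` k"
      then obtain x where "x \<in> k" "\<omega> = inv cplx x" by blast
      then have "norm (cplx \<omega>) = 1" using inv k(2) by (auto simp: S_def)
      then show "norm \<omega> = 1" by (simp add: norm_cplx)
    qed
    have net: "\<exists>\<omega>\<in>inv cplx ` k. norm (a - \<omega>) < \<eta>" if "norm a = 1" for a :: 'k
    proof -
      have "cplx a \<in> S" using that by (simp add: S_def norm_cplx)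
      then obtain x where x: "x \<in> k" "dist x (cplx a) < \<eta>" using k(3) by auto
      have "norm (a - inv cplx x) = norm (cplx a - x)"
        using norm_cplx[of "a - inv cplx x"] by (simp add: cplx_diff inv[OF x(1)])
      then show ?thesis using x by (intro bexI[of _ "inv cplx x"]) (simp_all add: dist_norm norm_minus_commute)
    qed
    show "\<forall>a::'k. \<exists>\<omega>\<in>inv cplx ` k. norm (a - of_real (norm a) * \<omega>) \<le> \<eta> * norm a"
    proof
      fix a :: 'k
      show "\<exists>\<omega>\<in>inv cplx ` k. norm (a - of_real (norm a) * \<omega>) \<le> \<eta> * norm a"
      proof (cases "a = 0")
        case True
        then show ?thesis using net[of 1] by auto
      next
        case False
        have "norm (a / of_real (norm a)) = 1" using False by (simp add: norm_divide)
        then obtain \<omega> where \<omega>: "\<omega> \<in> inv cplx ` k" "norm (a / of_real (norm a) - \<omega>) < \<eta>"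
          using net by blast
        have "a - of_real (norm a) * \<omega> = of_real (norm a) * (a / of_real (norm a) - \<omega>)"
          using False by (simp add: right_diff_distrib)
        then have "norm (a - of_real (norm a) * \<omega>) = norm a * norm (a / of_real (norm a) - \<omega>)"
          by (simp only: norm_mult norm_of_real abs_norm_cancel)
        also have "\<dots> \<le> norm a * \<eta>" using \<omega>(2) by (intro mult_left_mono) auto
        finally show ?thesis using \<omega>(1) by (auto simp: mult.commute)
      qed
    qed
  qed
qed

context normed_space_over
begin

text \<open>The coefficients are sorted by their approximate phases; a functional that is large on the vectors
  of the heaviest class and small on the others detects a fixed part of the \<open>\<ell>\<^sub>1\<close> norm.\<close>

lemma sign_pattern_ell1_lower:
  fixes z :: "nat \<Rightarrow> 'a"
  assumes z: "\<And>i. norm (z i) \<le> 2"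
    and pat: "\<And>\<sigma>. sign_pattern smul \<iota> c d \<sigma> z n \<inter> dual_ball \<noteq> {}"
    and \<iota>: "\<forall>c. norm c \<le> \<bar>re c\<bar> + \<bar>re (\<iota> * c)\<bar>"
    and c: "0 < c"
    and \<Omega>: "finite (\<Omega> :: 'k set)" "\<forall>\<omega>\<in>\<Omega>. norm \<omega> = 1" "\<forall>a. \<exists>\<omega>\<in>\<Omega>. norm (a - of_real (norm a) * \<omega>) \<le> c / 4 * norm a"
    and d: "d = c / (8 * real (card \<Omega>))"
  shows "c / (4 * real (card \<Omega>)) * (\<Sum>i<n. norm (a i)) \<le> norm (\<Sum>i<n. smul (a i) (z i))"
proof -
  define A where "A = (\<Sum>i<n. norm (a i))"
  have "\<Omega> \<noteq> {}" using \<Omega>(3) by blast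
  then have card: "card \<Omega> > 0" using \<Omega>(1) by (simp add: card_gt_0_iff)
  obtain w where w: "\<And>i. w i \<in> \<Omega>" "\<And>i. norm (a i - of_real (norm (a i)) * w i) \<le> c / 4 * norm (a i)"
  proof -
    have "\<forall>i. \<exists>\<omega>. \<omega> \<in> \<Omega> \<and> norm (a i - of_real (norm (a i)) * \<omega>) \<le> c / 4 * norm (a i)"
      using \<Omega>(3) by blast
    from choice[OF this] show ?thesis using that by blast
  qed
  have "A = (\<Sum>\<omega>\<in>\<Omega>. \<Sum>i\<in>{i\<in>{..<n}. w i = \<omega>}. norm (a i))"
    unfolding A_def by (rule sum.group[symmetric]) (use \<Omega>(1) w(1) in auto)
  moreover have "\<exists>\<omega>\<in>\<Omega>. A / card \<Omega> \<le> (\<Sum>i\<in>{i\<in>{..<n}. w i = \<omega>}. norm (a i))"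
  proof (rule ccontr)
    assume "\<not> ?thesis"
    then have "(\<Sum>\<omega>\<in>\<Omega>. \<Sum>i\<in>{i\<in>{..<n}. w i = \<omega>}. norm (a i)) < (\<Sum>\<omega>\<in>\<Omega>. A / card \<Omega>)"
      using \<Omega>(1) \<open>\<Omega> \<noteq> {}\<close> by (intro sum_strict_mono) (auto simp: not_le)
    then show False using calculation card by simp
  qed
  ultimately obtain \<omega> where \<omega>: "\<omega> \<in> \<Omega>" "A / card \<Omega> \<le> (\<Sum>i\<in>{i\<in>{..<n}. w i = \<omega>}. norm (a i))" by blast
  define I where "I = {i\<in>{..<n}. w i = \<omega>}"
  have nw: "norm \<omega> = 1" "\<omega> \<noteq> 0" using \<Omega>(2) \<omega>(1) by auto
  obtain g where g: "g \<in> dual_ball" "g \<in> sign_pattern smul \<iota> c d I z n" using pat[of I] by blast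
  obtain F where F: "F \<in> dual smul" "\<And>x. re (F x) = g x" "\<And>x. norm (F x) \<le> norm x"
    using dual_of_dual_ball[OF g(1)] by blast
  \<comment> \<open>Replacing the phase of \<open>a i\<close> by \<open>\<omega>\<close> costs
    \<open>c / 4\<close> per unit of \<open>norm (a i)\<close>, doubled by
    \<open>norm (z i) \<le> 2\<close>; half of the value \<open>c\<close> is left.\<close>
  have big: "norm (a i) * (c / 2) \<le> re (a i * F (z i) / \<omega>)" if i: "i \<in> I" for i
  proof -
    have "a i / \<omega> - of_real (norm (a i)) = (a i - of_real (norm (a i)) * w i) / \<omega>"
      using i nw(2) by (simp add: I_def field_simps)
    then have e: "norm (a i / \<omega> - of_real (norm (a i))) \<le> c / 4 * norm (a i)"
      using w(2)[of i] nw(1) by (simp add: norm_divide)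
    have "a i * F (z i) / \<omega> = norm (a i) *\<^sub>R F (z i) + (a i / \<omega> - of_real (norm (a i))) * F (z i)"
      by (simp add: scaleR_conv_of_real algebra_simps)
    then have "re (a i * F (z i) / \<omega>) = norm (a i) * g (z i) + re ((a i / \<omega> - of_real (norm (a i))) * F (z i))"
      by (simp only: re_add re_scaleR F(2))
    moreover have "norm ((a i / \<omega> - of_real (norm (a i))) * F (z i)) \<le> (c / 4 * norm (a i)) * 2"
      unfolding norm_mult using e F(3)[of "z i"] z[of i] c by (intro mult_mono) auto
    moreover have "norm (a i) * c \<le> norm (a i) * g (z i)"
      using g(2) i by (intro mult_left_mono) (auto simp: sign_pattern_def I_def)
    ultimately show ?thesis
      using abs_re_le[of "(a i / \<omega> - of_real (norm (a i))) * F (z i)"] by (simp add: algebra_simps)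
  qed
  have small: "- (norm (a i) * (2 * d)) \<le> re (a i * F (z i) / \<omega>)" if i: "i \<in> {..<n} - I" for i
  proof -
    have "\<bar>g (z i)\<bar> < d" "\<bar>g (smul \<iota> (z i))\<bar> < d" using g(2) i by (auto simp: sign_pattern_def)
    then have "norm (F (z i)) \<le> 2 * d"
      using \<iota>[rule_format, of "F (z i)"] F(2)[of "z i"] F(2)[of "smul \<iota> (z i)"]
      by (simp add: dual_smul[OF F(1)])
    then have "norm (a i * F (z i) / \<omega>) \<le> norm (a i) * (2 * d)"
      using nw(1) by (simp add: norm_mult norm_divide mult_left_mono)
    then show ?thesis using abs_re_le[of "a i * F (z i) / \<omega>"] by linarith
  qed
  have "A / card \<Omega> * (c / 2) \<le> (\<Sum>i\<in>I. norm (a i)) * (c / 2)"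
    using \<omega>(2) c by (intro mult_right_mono) (auto simp: I_def)
  also have "\<dots> \<le> (\<Sum>i\<in>I. re (a i * F (z i) / \<omega>))"
    unfolding sum_distrib_right by (rule sum_mono) (rule big)
  finally have 1: "A / card \<Omega> * (c / 2) \<le> (\<Sum>i\<in>I. re (a i * F (z i) / \<omega>))" .
  have d0: "0 \<le> d" using d c by simp
  have "(\<Sum>i\<in>{..<n} - I. norm (a i)) \<le> A" unfolding A_def by (intro sum_mono2) auto
  then have "- (A * (2 * d)) \<le> - ((\<Sum>i\<in>{..<n} - I. norm (a i)) * (2 * d))"
    using d0 by (simp add: mult_right_mono)
  also have "\<dots> = (\<Sum>i\<in>{..<n} - I. - (norm (a i) * (2 * d)))"
    by (simp add: sum_distrib_right sum_negf)
  also have "\<dots> \<le> (\<Sum>i\<in>{..<n} - I. re (a i * F (z i) / \<omega>))"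
    by (rule sum_mono) (rule small)
  finally have 2: "- (A * (2 * d)) \<le> (\<Sum>i\<in>{..<n} - I. re (a i * F (z i) / \<omega>))" .
  have "(\<Sum>i<n. re (a i * F (z i) / \<omega>)) =
      (\<Sum>i\<in>{..<n} - I. re (a i * F (z i) / \<omega>)) + (\<Sum>i\<in>I. re (a i * F (z i) / \<omega>))"
    by (rule sum.subset_diff) (auto simp: I_def)
  then have "A / card \<Omega> * (c / 2) - A * (2 * d) \<le> (\<Sum>i<n. re (a i * F (z i) / \<omega>))"
    using 1 2 by linarith
  \<comment> \<open>The value of \<open>d\<close> makes the loss \<open>2 * d * A\<close> from the
    other classes half of the gain \<open>c * A / (2 * card \<Omega>)\<close> from the heaviest
    one.\<close>
  also have "A / card \<Omega> * (c / 2) - A * (2 * d) = c / (4 * real (card \<Omega>)) * A"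
    using card by (simp add: d field_simps)
  also have "(\<Sum>i<n. re (a i * F (z i) / \<omega>)) = re (F (\<Sum>i<n. smul (a i) (z i)) / \<omega>)"
    by (simp add: linear_sum[OF bounded_linear.linear[OF dual_bounded_linear[OF F(1)]]]
        linear_sum[OF bounded_linear.linear[OF bounded_linear_re]] dual_smul[OF F(1)]
        sum_divide_distrib)
  also have "\<dots> \<le> norm (\<Sum>i<n. smul (a i) (z i))"
    using re_le[of "F (\<Sum>i<n. smul (a i) (z i)) / \<omega>"] F(3)[of "\<Sum>i<n. smul (a i) (z i)"] nw(1)
    by (simp add: norm_divide)
  finally show ?thesis by (simp add: A_def)
qed

end

text \<open>Completeness is not part of the class of scalars; it is inherited from the complex
  numbers through the closed range of \<open>cplx\<close>.\<close>

lemma Cauchy_convergent_real_or_complex: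
  fixes X :: "nat \<Rightarrow> 'k::real_or_complex"
  assumes "Cauchy X"
  shows "convergent X"
proof -
  have dist: "dist (cplx a) (cplx b) = dist a b" for a b :: 'k
    by (simp add: dist_norm cplx_diff[symmetric] norm_cplx)
  have "Cauchy (\<lambda>n. cplx (X n))" using assms unfolding Cauchy_def dist .
  then obtain l where l: "(\<lambda>n. cplx (X n)) \<longlonglongrightarrow> l" using Cauchy_convergent convergent_def by blast
  have "l \<in> range (cplx :: 'k \<Rightarrow> complex)"
    using closed_sequentially[OF cplx_range_closed _ l] by blast
  then obtain a :: 'k where "l = cplx a" by blast
  then have "X \<longlonglongrightarrow> a" using l unfolding lim_sequentially by (simp add: dist)
  then show ?thesis by (auto simp: convergent_def)
qed

section \<open>Completeness of \<open>ell1\<close> and its embeddings\<close>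

lemma ell1_diff:
  assumes "a \<in> ell1" "b \<in> ell1"
  shows "(\<lambda>n. a n - b n) \<in> ell1"
  unfolding ell1_def
proof (rule CollectI, rule summable_comparison_test')
  show "summable (\<lambda>n. norm (a n) + norm (b n))" using assms by (intro summable_add) (auto simp: ell1_def)
  show "norm (norm (a n - b n)) \<le> norm (a n) + norm (b n)" for n
    by (simp add: norm_triangle_ineq4)
qed

lemma ell1_add:
  assumes "a \<in> ell1" "b \<in> ell1"
  shows "(\<lambda>n. a n + b n) \<in> ell1"
  using ell1_diff[OF assms(1), of "\<lambda>n. - b n"] assms(2) by (simp add: ell1_def)

lemma ell1_scale: "a \<in> ell1 \<Longrightarrow> (\<lambda>n. c * a n) \<in> ell1"
  by (simp add: ell1_def norm_mult summable_mult)

lemma ell1_sum_le: "a \<in> ell1 \<Longrightarrow> (\<Sum>i<n. norm (a i)) \<le> ell1_norm a"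
  unfolding ell1_norm_def by (rule sum_le_suminf) (auto simp: ell1_def)

lemma ell1_complete:
  fixes a :: "nat \<Rightarrow> nat \<Rightarrow> 'k::real_or_complex"
  assumes a: "\<And>m. a m \<in> ell1"
    and cau: "\<And>e. 0 < e \<Longrightarrow> \<exists>M. \<forall>m\<ge>M. \<forall>n\<ge>M. ell1_norm (\<lambda>i. a m i - a n i) \<le> e"
  obtains b where "b \<in> ell1" "(\<lambda>m. ell1_norm (\<lambda>i. a m i - b i)) \<longlonglongrightarrow> 0"
proof -
  have entry: "norm (a m i - a n i) \<le> ell1_norm (\<lambda>i. a m i - a n i)" for m n i
  proof -
    have "norm (a m i - a n i) \<le> (\<Sum>j<Suc i. norm (a m j - a n j))"
      by (rule member_le_sum) auto
    then show ?thesis using ell1_sum_le[OF ell1_diff[OF a a], of m n "Suc i"] by linarith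
  qed
  have "Cauchy (\<lambda>m. a m i)" for i
  proof (rule metric_CauchyI)
    fix e :: real assume "0 < e"
    then obtain M where "\<forall>m\<ge>M. \<forall>n\<ge>M. ell1_norm (\<lambda>i. a m i - a n i) \<le> e / 2" using cau[of "e / 2"] by auto
    then have "\<forall>m\<ge>M. \<forall>n\<ge>M. dist (a m i) (a n i) \<le> e / 2"
      unfolding dist_norm using entry order_trans by blast
    then show "\<exists>M. \<forall>m\<ge>M. \<forall>n\<ge>M. dist (a m i) (a n i) < e"
      using \<open>0 < e\<close> by (intro exI[of _ M]) force
  qed
  then have "\<forall>i. \<exists>l. (\<lambda>m. a m i) \<longlonglongrightarrow> l" 
    using Cauchy_convergent_real_or_complex by (auto simp: convergent_def)
  then obtain b where b: "\<And>i. (\<lambda>m. a m i) \<longlonglongrightarrow> b i" by metis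
  \<comment> \<open>The limit in \<open>n\<close> is taken in finite partial sums, where entrywise
    convergence suffices.\<close>
  have part: "(\<Sum>i<N. norm (a m i - b i)) \<le> e"
    if M: "\<forall>m\<ge>M. \<forall>n\<ge>M. ell1_norm (\<lambda>i. a m i - a n i) \<le> e" "m \<ge> M" for m M N e
  proof (rule LIMSEQ_le_const2)
    show "(\<lambda>n. \<Sum>i<N. norm (a m i - a n i)) \<longlonglongrightarrow> (\<Sum>i<N. norm (a m i - b i))"
      by (intro tendsto_intros b)
    have "(\<Sum>i<N. norm (a m i - a n i)) \<le> e" if "n \<ge> M" for n
      using ell1_sum_le[OF ell1_diff[OF a a], of m n N] M that by force
    then show "\<exists>K. \<forall>n\<ge>K. (\<Sum>i<N. norm (a m i - a n i)) \<le> e" by blast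
  qed
  have diff: "(\<lambda>i. a m i - b i) \<in> ell1 \<and> ell1_norm (\<lambda>i. a m i - b i) \<le> e"
    if M: "\<forall>m\<ge>M. \<forall>n\<ge>M. ell1_norm (\<lambda>i. a m i - a n i) \<le> e" "m \<ge> M" for m M e
  proof -
    have "summable (\<lambda>i. norm (a m i - b i))"
      by (rule summableI_nonneg_bounded[of _ e]) (use part[OF M] in auto)
    then show ?thesis
      using part[OF M] by (auto simp: ell1_def ell1_norm_def intro: suminf_le_const)
  qed
  obtain M where "\<forall>m\<ge>M. \<forall>n\<ge>M. ell1_norm (\<lambda>i. a m i - a n i) \<le> 1" using cau[of 1] by auto
  then have "(\<lambda>i. a M i - b i) \<in> ell1" using diff by blast
  then have "b \<in> ell1" using ell1_diff[OF a[of M], of "\<lambda>i. a M i - b i"] by simp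
  moreover have "(\<lambda>m. ell1_norm (\<lambda>i. a m i - b i)) \<longlonglongrightarrow> 0"
  proof (rule metric_LIMSEQ_I)
    fix r :: real assume "0 < r"
    then obtain M where M: "\<forall>m\<ge>M. \<forall>n\<ge>M. ell1_norm (\<lambda>i. a m i - a n i) \<le> r / 2" using cau[of "r / 2"] by auto
    have "0 \<le> ell1_norm (\<lambda>i. a m i - b i)" if "m \<ge> M" for m
      using diff[OF M that] by (auto simp: ell1_norm_def ell1_def intro: suminf_nonneg)
    then have "\<forall>m\<ge>M. dist (ell1_norm (\<lambda>i. a m i - b i)) 0 < r"
      using diff[OF M] \<open>0 < r\<close> by (force simp: dist_real_def)
    then show "\<exists>M. \<forall>m\<ge>M. dist (ell1_norm (\<lambda>i. a m i - b i)) 0 < r" by blast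
  qed
  ultimately show ?thesis using that by blast
qed

text \<open>The lower estimate for finite sums extends to all of \<open>ell1\<close>. It makes
  \<open>J\<close> injective and pulls Cauchy sequences in the image back to Cauchy sequences in
  \<open>ell1\<close>, so the image is closed.\<close>

lemma contains_ell1I:
  fixes smul :: "'k::real_or_complex \<Rightarrow> 'a::banach \<Rightarrow> 'a" and z :: "nat \<Rightarrow> 'a"
  assumes nso: "normed_space_over smul" and z: "\<And>i. norm (z i) \<le> C" and \<kappa>: "0 < \<kappa>"
    and low: "\<And>a n. \<kappa> * (\<Sum>i<n. norm (a i)) \<le> norm (\<Sum>i<n. smul (a i) (z i))"
  shows "contains_ell1 smul"
proof -
  interpret normed_space_over smul by (rule nso)
  define J where "J a = (\<Sum>n. smul (a n) (z n))" for a
  have bd: "norm (smul (a n) (z n)) \<le> C * norm (a n)" for a n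
    using mult_left_mono[OF z[of n], of "norm (a n)"] by (simp add: norm_scale mult.commute)
  have sn: "summable (\<lambda>n. norm (smul (a n) (z n)))" if "a \<in> ell1" for a
    by (rule summable_comparison_test'[of "\<lambda>n. C * norm (a n)" 0])
       (use that bd in \<open>auto simp: ell1_def summable_mult\<close>)
  have s: "summable (\<lambda>n. smul (a n) (z n))" if "a \<in> ell1" for a
    using sn[OF that] by (rule summable_norm_cancel)
  have Jadd: "J (\<lambda>n. a n + b n) = J a + J b" if "a \<in> ell1" "b \<in> ell1" for a b
    using suminf_add[OF s[OF that(1)] s[OF that(2)]] by (simp add: J_def scale_left_distrib)
  have Jscale: "J (\<lambda>n. c * a n) = smul c (J a)" if "a \<in> ell1" for a c
    using bounded_linear.suminf[OF bounded_linear_smul s[OF that], of c] by (simp add: J_def)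
  have Jdiff: "J (\<lambda>n. a n - b n) = J a - J b" if "a \<in> ell1" "b \<in> ell1" for a b
    using Jadd[OF that(1) ell1_scale[OF that(2), of "-1"]] Jscale[OF that(2), of "-1"] by simp
  have up: "norm (J a) \<le> C * ell1_norm a" if "a \<in> ell1" for a
  proof -
    have sa: "summable (\<lambda>n. norm (a n))" using that by (simp add: ell1_def)
    have "norm (J a) \<le> (\<Sum>n. norm (smul (a n) (z n)))" unfolding J_def by (rule summable_norm[OF sn[OF that]])
    also have "\<dots> \<le> (\<Sum>n. C * norm (a n))" by (intro suminf_le bd sn[OF that] summable_mult[OF sa])
    also have "\<dots> = C * ell1_norm a" using suminf_mult[OF sa, of C] by (simp add: ell1_norm_def)
    finally show ?thesis .
  qed
  have dn: "\<kappa> * ell1_norm a \<le> norm (J a)" if "a \<in> ell1" for a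
  proof (rule LIMSEQ_le)
    show "(\<lambda>n. \<kappa> * (\<Sum>i<n. norm (a i))) \<longlonglongrightarrow> \<kappa> * ell1_norm a"
      using that unfolding ell1_norm_def by (intro tendsto_mult_left summable_LIMSEQ) (simp add: ell1_def)
    show "(\<lambda>n. norm (\<Sum>i<n. smul (a i) (z i))) \<longlonglongrightarrow> norm (J a)"
      unfolding J_def by (intro tendsto_norm summable_LIMSEQ s that)
    show "\<exists>N. \<forall>n\<ge>N. \<kappa> * (\<Sum>i<n. norm (a i)) \<le> norm (\<Sum>i<n. smul (a i) (z i))"
      using low by blast
  qed
  define Y where "Y = J ` ell1"
  have "inj_on J ell1"
  proof (rule inj_onI)
    fix a b assume ab: "a \<in> ell1" "b \<in> ell1" "J a = J b"
    have "\<kappa> * ell1_norm (\<lambda>n. a n - b n) \<le> 0"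
      using dn[OF ell1_diff[OF ab(1,2)]] Jdiff[OF ab(1,2)] ab(3) by simp
    then have le0: "ell1_norm (\<lambda>n. a n - b n) \<le> 0" using \<kappa> by (simp add: mult_le_0_iff)
    show "a = b"
    proof
      fix n
      have "0 \<le> (\<Sum>j<n. norm (a j - b j))" by (simp add: sum_nonneg)
      then have "norm (a n - b n) \<le> 0"
        using ell1_sum_le[OF ell1_diff[OF ab(1,2)], of "Suc n"] le0 unfolding sum.lessThan_Suc by linarith
      then show "a n = b n" by simp
    qed
  qed
  then have bij: "bij_betw J ell1 Y" by (simp add: bij_betw_def Y_def)
  have "closed Y"
    unfolding closed_sequential_limits
  proof (intro allI impI, elim conjE)
    fix y l assume y: "\<forall>n. y n \<in> Y" "y \<longlonglongrightarrow> l"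
    then have "\<forall>n. \<exists>a. a \<in> ell1 \<and> y n = J a" by (auto simp: Y_def)
    then obtain a where a: "\<And>n. a n \<in> ell1" "\<And>n. y n = J (a n)" by metis
    have "\<exists>M. \<forall>m\<ge>M. \<forall>n\<ge>M. ell1_norm (\<lambda>i. a m i - a n i) \<le> e" if e: "0 < e" for e
    proof -
      have "Cauchy y" using y(2) by (rule LIMSEQ_imp_Cauchy)
      then obtain M where M: "\<forall>m\<ge>M. \<forall>n\<ge>M. norm (y m - y n) < \<kappa> * e"
        using CauchyD[of y "\<kappa> * e"] e \<kappa> by auto
      have "ell1_norm (\<lambda>i. a m i - a n i) \<le> e" if "m \<ge> M" "n \<ge> M" for m n
      proof -
        have "\<kappa> * ell1_norm (\<lambda>i. a m i - a n i) \<le> norm (y m - y n)"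
          using dn[OF ell1_diff[OF a(1) a(1)], of m n] by (simp add: Jdiff[OF a(1) a(1)] a(2))
        also have "\<dots> < \<kappa> * e" using M that by blast
        finally show ?thesis using \<kappa> by simp
      qed
      then show ?thesis by blast
    qed
    from ell1_complete[OF a(1) this]
    obtain b where b: "b \<in> ell1" "(\<lambda>m. ell1_norm (\<lambda>i. a m i - b i)) \<longlonglongrightarrow> 0" .
    have "(\<lambda>m. y m - J b) \<longlonglongrightarrow> 0"
    proof (rule Lim_null_comparison)
      show "\<forall>\<^sub>F m in sequentially. norm (y m - J b) \<le> C * ell1_norm (\<lambda>i. a m i - b i)"
        using up[OF ell1_diff[OF a(1) b(1)]] by (simp add: Jdiff[OF a(1) b(1)] a(2))
      show "(\<lambda>m. C * ell1_norm (\<lambda>i. a m i - b i)) \<longlonglongrightarrow> 0" using tendsto_mult_left[OF b(2), of C] by simp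
    qed
    then have "y \<longlonglongrightarrow> J b" by (simp add: LIM_zero_iff)
    then have "l = J b" using y(2) LIMSEQ_unique by blast
    then show "l \<in> Y" using b(1) by (simp add: Y_def)
  qed
  moreover have "module.subspace smul Y"
  proof (rule subspaceI)
    have "(\<lambda>n. 0) \<in> ell1" by (simp add: ell1_def)
    then show "0 \<in> Y" using Jscale[of "\<lambda>n. 0" 0] by (force simp: Y_def)
    show "x + y \<in> Y" if xy: "x \<in> Y" "y \<in> Y" for x y
    proof -
      obtain a b where "a \<in> ell1" "b \<in> ell1" "x = J a" "y = J b" using xy by (auto simp: Y_def)
      then show ?thesis using Jadd[of a b] imageI[OF ell1_add, of a b J] by (simp add: Y_def)
    qed
    show "smul c x \<in> Y" if x: "x \<in> Y" for c x
    proof -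
      obtain a where "a \<in> ell1" "x = J a" using x by (auto simp: Y_def)
      then show ?thesis using Jscale[of a c] imageI[OF ell1_scale, of a J c] by (simp add: Y_def)
    qed
  qed
  ultimately show ?thesis
    unfolding contains_ell1_def
    by (intro exI[of _ Y] exI[of _ J] exI[of _ \<kappa>] exI[of _ C] conjI ballI allI bij Jadd Jscale dn up \<kappa>)
qed

lemma no_ell1_forces:
  fixes smul :: "'k::real_or_complex \<Rightarrow> 'a::banach \<Rightarrow> 'a"
  assumes nso: "normed_space_over smul" and no: "\<not> contains_ell1 smul"
    and v: "norm (v :: 'a) \<le> 1" and \<epsilon>: "0 < \<epsilon>"
  shows "forces v \<epsilon> dual_ball"
proof (rule ccontr)
  interpret normed_space_over smul by (rule nso)
  assume nf: "\<not> forces v \<epsilon> dual_ball"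
  define c where "c = \<epsilon> / 2"
  have c: "0 < c" "c < \<epsilon>" using \<epsilon> by (auto simp: c_def)
  obtain \<iota> :: 'k where \<iota>: "norm \<iota> \<le> 1" "\<forall>c. norm c \<le> \<bar>re c\<bar> + \<bar>re (\<iota> * c)\<bar>" by (rule imaginary_unit)
  have c4: "0 < c / 4" using c by simp
  obtain \<Omega> :: "'k set" where \<Omega>: "finite \<Omega>" "\<forall>\<omega>\<in>\<Omega>. norm \<omega> = 1"
    "\<forall>a. \<exists>\<omega>\<in>\<Omega>. norm (a - of_real (norm a) * \<omega>) \<le> c / 4 * norm a"
    by (rule unimodular_net[OF c4])
  have "\<Omega> \<noteq> {}" using \<Omega>(3) by blast
  then have card: "card \<Omega> > 0" using \<Omega>(1) by (simp add: card_gt_0_iff)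
  define d where "d = c / (8 * real (card \<Omega>))"
  have d: "0 < d" using c card by (simp add: d_def)
  obtain z :: "nat \<Rightarrow> 'a" where z: "\<forall>i. norm (z i) \<le> 2" "\<forall>n \<sigma>. sign_pattern smul \<iota> c d \<sigma> z n \<inter> dual_ball \<noteq> {}"
    by (rule independent_sequence[OF nf v c(2) d])
  have "contains_ell1 smul"
  proof (rule contains_ell1I[OF nso])
    show "norm (z i) \<le> 2" for i using z(1) by blast
    show "0 < c / (4 * real (card \<Omega>))" using c card by simp
    show "c / (4 * real (card \<Omega>)) * (\<Sum>i<n. norm (a i)) \<le> norm (\<Sum>i<n. smul (a i) (z i))" for a n
      by (rule sign_pattern_ell1_lower[OF _ _ \<iota>(2) c(1) \<Omega> d_def]) (use z in auto)
  qed
  then show False using no by simp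
qed

section \<open>The Radon-Nikodym property\<close>

text \<open>The norm itself need not be measurable. A measurable representative is wanted because
  additivity of the nonnegative integral requires measurable integrands.\<close>

lemma strong_bochner_measurable:
  assumes s: "\<And>i. Bochner_Integration.simple_bochner_integrable M (s i)"
    and lim: "AE x in M. (\<lambda>i. s i x) \<longlonglongrightarrow> h x"
    and t: "Bochner_Integration.simple_bochner_integrable M t"
  obtains q where "q \<in> borel_measurable M" "AE x in M. ennreal (norm (h x - t x)) = q x"
proof -
  define q where "q x = liminf (\<lambda>i. ennreal (norm (s i x - t x)))" for x
  have "simple_function M (\<lambda>x. ennreal (norm (s i x - t x)))" for i
    using s[of i] t by (auto simp: Bochner_Integration.simple_bochner_integrable.simps
        intro: simple_function_compose2[of M "s i" t "\<lambda>a b. ennreal (norm (a - b))"])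
  then have "q \<in> borel_measurable M"
    unfolding q_def by (intro borel_measurable_liminf borel_measurable_simple_function)
  moreover have "AE x in M. ennreal (norm (h x - t x)) = q x"
    using lim
  proof eventually_elim
    case (elim x)
    have "(\<lambda>i. ennreal (norm (s i x - t x))) \<longlonglongrightarrow> ennreal (norm (h x - t x))"
      by (intro tendsto_ennrealI tendsto_norm tendsto_diff elim tendsto_const)
    from lim_imp_Liminf[OF trivial_limit_sequentially this] show ?case unfolding q_def by (rule sym)
  qed
  ultimately show ?thesis using that by blast
qed

text \<open>The usual norm inequality for integrals, obtained along an approximating sequence; the
  measurable representatives \<open>p\<close> and \<open>q\<close> allow the integral of the
  triangle inequality to be split.\<close>

lemma strong_bochner_integral_diff:
  assumes h: "has_strong_bochner_integral M h I"
    and t: "Bochner_Integration.simple_bochner_integrable M t"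
  shows "ennreal (norm (I - Bochner_Integration.simple_bochner_integral M t)) \<le>
    (\<integral>\<^sup>+x. ennreal (norm (h x - t x)) \<partial>M)"
proof -
  let ?J = "Bochner_Integration.simple_bochner_integral M"
  obtain s where s: "\<And>i. Bochner_Integration.simple_bochner_integrable M (s i)"
    "AE x in M. (\<lambda>i. s i x) \<longlonglongrightarrow> h x"
    "(\<lambda>i. \<integral>\<^sup>+x. ennreal (norm (h x - s i x)) \<partial>M) \<longlonglongrightarrow> 0"
    "(\<lambda>i. ?J (s i)) \<longlonglongrightarrow> I"
    using h unfolding has_strong_bochner_integral_def by auto
  obtain q where q: "q \<in> borel_measurable M" "AE x in M. ennreal (norm (h x - t x)) = q x"
    by (rule strong_bochner_measurable[OF s(1,2) t])
  have *: "ennreal (norm (?J (s i) - ?J t)) \<le>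
      (\<integral>\<^sup>+x. ennreal (norm (h x - s i x)) \<partial>M) + (\<integral>\<^sup>+x. ennreal (norm (h x - t x)) \<partial>M)" for i
  proof -
    obtain p where p: "p \<in> borel_measurable M" "AE x in M. ennreal (norm (h x - s i x)) = p x"
      by (rule strong_bochner_measurable[OF s(1,2) s(1)])
    have d: "Bochner_Integration.simple_bochner_integrable M (\<lambda>x. s i x - t x)"
      by (rule simple_bochner_integrable_compose2[OF _ s(1) t]) simp
    have dn: "Bochner_Integration.simple_bochner_integrable M (\<lambda>x. norm (s i x - t x))"
      by (rule simple_bochner_integrable_compose2[of "\<lambda>a b. norm (a - b)", OF _ s(1) t]) simp
    have "norm (?J (s i) - ?J t) = norm (?J (\<lambda>x. s i x - t x))"
      by (simp add: simple_bochner_integral_diff[OF s(1) t])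
    also have "\<dots> \<le> ?J (\<lambda>x. norm (s i x - t x))" by (rule simple_bochner_integral_norm_bound[OF d])
    finally have "ennreal (norm (?J (s i) - ?J t)) \<le> ennreal (?J (\<lambda>x. norm (s i x - t x)))"
      by (rule ennreal_leI)
    also have "\<dots> = (\<integral>\<^sup>+x. ennreal (norm (s i x - t x)) \<partial>M)"
      by (rule simple_bochner_integral_eq_nn_integral[OF dn]) simp
    also have "\<dots> \<le> (\<integral>\<^sup>+x. p x + q x \<partial>M)"
    proof (rule nn_integral_mono_AE)
      show "AE x in M. ennreal (norm (s i x - t x)) \<le> p x + q x"
        using p(2) q(2)
      proof eventually_elim
        case (elim x)
        have "norm (s i x - t x) \<le> norm (h x - s i x) + norm (h x - t x)"
          using norm_triangle_ineq4[of "h x - t x" "h x - s i x"] by simp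
        then have "ennreal (norm (s i x - t x)) \<le> ennreal (norm (h x - s i x)) + ennreal (norm (h x - t x))"
          by (simp add: ennreal_plus[symmetric] del: ennreal_plus)
        then show ?case using elim by simp
      qed
    qed
    also have "\<dots> = (\<integral>\<^sup>+x. p x \<partial>M) + (\<integral>\<^sup>+x. q x \<partial>M)" by (rule nn_integral_add[OF p(1) q(1)])
    also have "(\<integral>\<^sup>+x. p x \<partial>M) = (\<integral>\<^sup>+x. ennreal (norm (h x - s i x)) \<partial>M)"
      using p(2) by (intro nn_integral_cong_AE) auto
    also have "(\<integral>\<^sup>+x. q x \<partial>M) = (\<integral>\<^sup>+x. ennreal (norm (h x - t x)) \<partial>M)"
      using q(2) by (intro nn_integral_cong_AE) auto
    finally show ?thesis .
  qed
  show ?thesis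
  proof (rule LIMSEQ_le)
    show "(\<lambda>i. ennreal (norm (?J (s i) - ?J t))) \<longlonglongrightarrow> ennreal (norm (I - ?J t))"
      by (intro tendsto_ennrealI tendsto_norm tendsto_diff s(4) tendsto_const)
    show "(\<lambda>i. (\<integral>\<^sup>+x. ennreal (norm (h x - s i x)) \<partial>M) + (\<integral>\<^sup>+x. ennreal (norm (h x - t x)) \<partial>M)) \<longlonglongrightarrow>
        (\<integral>\<^sup>+x. ennreal (norm (h x - t x)) \<partial>M)"
      using tendsto_add[OF s(3) tendsto_const, of "\<integral>\<^sup>+x. ennreal (norm (h x - t x)) \<partial>M"] by simp
    show "\<exists>N. \<forall>i\<ge>N. ennreal (norm (?J (s i) - ?J t)) \<le>
        (\<integral>\<^sup>+x. ennreal (norm (h x - s i x)) \<partial>M) + (\<integral>\<^sup>+x. ennreal (norm (h x - t x)) \<partial>M)"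
      using * by blast
  qed
qed

lemma simple_bochner_integral_indicator:
  assumes M: "finite_measure M" and s: "simple_function M s" and E: "E \<in> sets M"
  shows "Bochner_Integration.simple_bochner_integrable M (\<lambda>x. indicat_real E x *\<^sub>R s x)"
    and "Bochner_Integration.simple_bochner_integral M (\<lambda>x. indicat_real E x *\<^sub>R s x) =
      (\<Sum>y\<in>s ` space M. measure M (E \<inter> {x\<in>space M. s x = y}) *\<^sub>R y)"
proof -
  interpret finite_measure M by (rule M)
  have ind: "simple_function M (indicat_real E)" using E by (rule simple_function_indicator)
  have "simple_function M (\<lambda>x. indicat_real E x *\<^sub>R s x)"
    by (rule simple_function_compose2[OF ind s])
  then show int: "Bochner_Integration.simple_bochner_integrable M (\<lambda>x. indicat_real E x *\<^sub>R s x)"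
    by (rule Bochner_Integration.simple_bochner_integrable.intros) simp
  let ?g = "\<lambda>x. (indicat_real E x, s x)"
  have g: "simple_function M ?g" by (rule simple_function_compose2[OF ind s])
  have fin: "finite (s ` space M)" using s by (rule simple_functionD)
  have "Bochner_Integration.simple_bochner_integral M (\<lambda>x. indicat_real E x *\<^sub>R s x) =
      (\<Sum>p\<in>?g ` space M. measure M {x\<in>space M. ?g x = p} *\<^sub>R (fst p *\<^sub>R snd p))"
    by (rule simple_bochner_integral_partition[OF int g]) auto
  also have "\<dots> = (\<Sum>p\<in>{0, 1} \<times> s ` space M. measure M {x\<in>space M. ?g x = p} *\<^sub>R (fst p *\<^sub>R snd p))"
  proof (rule sum.mono_neutral_left)
    show "finite ({0, 1 :: real} \<times> s ` space M)" using fin by simp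
    show "?g ` space M \<subseteq> {0, 1} \<times> s ` space M" by (auto simp: indicator_def)
    show "\<forall>p\<in>{0, 1} \<times> s ` space M - ?g ` space M. measure M {x\<in>space M. ?g x = p} *\<^sub>R (fst p *\<^sub>R snd p) = 0"
    proof
      fix p assume "p \<in> {0, 1} \<times> s ` space M - ?g ` space M"
      then have empty: "{x\<in>space M. ?g x = p} = {}" by blast
      show "measure M {x\<in>space M. ?g x = p} *\<^sub>R (fst p *\<^sub>R snd p) = 0" unfolding empty by simp
    qed
  qed
  also have "\<dots> = (\<Sum>b\<in>{0, 1}. \<Sum>y\<in>s ` space M. measure M {x\<in>space M. ?g x = (b, y)} *\<^sub>R (b *\<^sub>R y))"
    by (simp add: sum.cartesian_product case_prod_unfold prod_eq_iff)
  also have "\<dots> = (\<Sum>y\<in>s ` space M. measure M {x\<in>space M. ?g x = (1, y)} *\<^sub>R y)"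
    by simp
  also have "\<dots> = (\<Sum>y\<in>s ` space M. measure M (E \<inter> {x\<in>space M. s x = y}) *\<^sub>R y)"
  proof (rule sum.cong[OF refl])
    fix y
    have "{x\<in>space M. ?g x = (1, y)} = E \<inter> {x\<in>space M. s x = y}" by (auto simp: indicator_def)
    then show "measure M {x\<in>space M. ?g x = (1, y)} *\<^sub>R y = measure M (E \<inter> {x\<in>space M. s x = y}) *\<^sub>R y"
      by simp
  qed
  finally show "Bochner_Integration.simple_bochner_integral M (\<lambda>x. indicat_real E x *\<^sub>R s x) =
      (\<Sum>y\<in>s ` space M. measure M (E \<inter> {x\<in>space M. s x = y}) *\<^sub>R y)" .
qed

text \<open>The sets that can be approximated form a sigma-algebra; for a countable union, a finite
  part of it is approximated.\<close>

lemma (in finite_measure) approx_by_algebra: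
  assumes alg: "algebra (space M) \<A>" and gen: "sets M = sigma_sets (space M) \<A>"
    and A: "A \<in> sets M" and e: "0 < (e::real)"
  shows "\<exists>S\<in>\<A>. measure M (sym_diff A S) < e"
proof -
  interpret algebra "space M" \<A> by (rule alg)
  have sub: "S \<in> sets M" if "S \<in> \<A>" for S using gen that by auto
  let ?P = "\<lambda>A. A \<in> sets M \<and> (\<forall>e>0. \<exists>S\<in>\<A>. measure M (sym_diff A S) < e)"
  have un: "?P (A \<union> B)" if "?P A" "?P B" for A B
  proof (intro conjI allI impI)
    show "A \<union> B \<in> sets M" using that by auto
    fix e :: real assume "0 < e"
    then have "0 < e / 2" by simp
    then obtain S T where ST: "S \<in> \<A>" "measure M (sym_diff A S) < e / 2"
      "T \<in> \<A>" "measure M (sym_diff B T) < e / 2" using \<open>?P A\<close> \<open>?P B\<close> by metis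
    have "measure M (sym_diff (A \<union> B) (S \<union> T)) \<le>
        measure M (sym_diff A S \<union> sym_diff B T)"
      using that sub ST by (intro finite_measure_mono) auto
    also have "\<dots> \<le> measure M (sym_diff A S) + measure M (sym_diff B T)"
      using that sub ST by (intro measure_Un_le) auto
    finally show "\<exists>S\<in>\<A>. measure M (sym_diff (A \<union> B) S) < e"
      using ST by (intro bexI[of _ "S \<union> T"]) auto
  qed
  have "A \<in> sigma_sets (space M) \<A> \<Longrightarrow> ?P A" for A
  proof (induction rule: sigma_sets.induct)
    case (Basic a)
    then show ?case using sub by (auto intro!: bexI[of _ a])
  next
    case Empty
    then show ?case by (auto intro!: bexI[of _ "{}"])
  next
    case (Compl a)
    have "\<exists>S\<in>\<A>. measure M (sym_diff (space M - a) S) < e" if "0 < e" for e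
    proof -
      have aM: "a \<in> sets M" using Compl.IH by simp
      have "\<exists>S\<in>\<A>. measure M (sym_diff a S) < e" using Compl.IH that by simp
      then obtain S where S: "S \<in> \<A>" "measure M (sym_diff a S) < e" by (elim bexE)
      have "measure M (sym_diff (space M - a) (space M - S)) \<le>
          measure M (sym_diff a S)"
        using S sub[OF S(1)] aM by (intro finite_measure_mono) auto
      then show ?thesis using S by (intro bexI[of _ "space M - S"]) auto
    qed
    then show ?case using Compl.IH by auto
  next
    case (Union a)
    define B where "B m = (\<Union>k<m. a k)" for m :: nat
    have PB: "?P (B m)" for m
    proof (induction m)
      case 0
      then show ?case by (auto simp: B_def intro!: bexI[of _ "{}"])
    next
      case (Suc m)
      have "B (Suc m) = a m \<union> B m" by (auto simp: B_def less_Suc_eq)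
      then show ?case using un[of "a m" "B m"] Union.IH Suc by simp
    qed
    have UB: "(\<Union>m. B m) = (\<Union>k. a k)" by (auto simp: B_def)
    have aM: "(\<Union>k. a k) \<in> sets M" using Union.IH by auto
    have "incseq B" by (rule incseq_SucI) (auto simp: B_def less_Suc_eq)
    then have "(\<lambda>m. measure M (B m)) \<longlonglongrightarrow> measure M (\<Union>m. B m)"
      using PB by (intro finite_Lim_measure_incseq) auto
    from tendsto_diff[OF tendsto_const this[unfolded UB], of "measure M (\<Union>k. a k)"]
    have lim: "(\<lambda>m. measure M (\<Union>k. a k) - measure M (B m)) \<longlonglongrightarrow> 0" by simp
    have "\<exists>S\<in>\<A>. measure M (sym_diff (\<Union>k. a k) S) < e" if "0 < e" for e
    proof -
      have "0 < e / 2" using that by simp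
      then have "\<forall>\<^sub>F m in sequentially. measure M (\<Union>k. a k) - measure M (B m) < e / 2"
        by (rule order_tendstoD(2)[OF lim])
      then obtain m where m: "measure M (\<Union>k. a k) - measure M (B m) < e / 2"
        by (auto dest: eventually_happens)
      have "\<exists>S\<in>\<A>. measure M (sym_diff (B m) S) < e / 2"
        using conjunct2[OF PB[of m], rule_format, OF \<open>0 < e / 2\<close>] .
      then obtain S where S: "S \<in> \<A>" "measure M (sym_diff (B m) S) < e / 2"
        by (elim bexE)
      have sB: "B m \<subseteq> (\<Union>k. a k)" by (auto simp: B_def)
      have "measure M (sym_diff (\<Union>k. a k) S) \<le>
          measure M ((\<Union>k. a k) - B m \<union> sym_diff (B m) S)"
        using PB[of m] aM sub[OF S(1)] sB by (intro finite_measure_mono) auto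
      also have "\<dots> \<le> measure M ((\<Union>k. a k) - B m) + measure M (sym_diff (B m) S)"
        using PB[of m] aM sub[OF S(1)] by (intro measure_Un_le) auto
      also have "measure M ((\<Union>k. a k) - B m) = measure M (\<Union>k. a k) - measure M (B m)"
        using PB[of m] aM sB by (intro finite_measure_Diff) auto
      finally show ?thesis using S m by (intro bexI[of _ S]) auto
    qed
    then show ?case using aM by auto
  qed
  then show ?thesis using A e unfolding gen by simp
qed

text \<open>A bush: at level \<open>n\<close>, the points \<open>c n i\<close> with \<open>i < K n\<close> are placed on the intervals of length
  \<open>1 / K n\<close> of the unit interval, and each interval is divided into \<open>N n\<close> intervals of the next level.\<close>

locale bush =
  fixes K N :: "nat \<Rightarrow> nat" and c :: "nat \<Rightarrow> nat \<Rightarrow> 'a::banach" and r :: real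
  assumes K0: "0 < K 0" and K_Suc: "K (Suc n) = K n * N n" and N_pos: "0 < N n" and r_pos: "0 < r"
    and c_bound: "norm (c n i) \<le> 1"
    and c_average: "i < K n \<Longrightarrow>
      norm (c n i - (\<Sum>j<N n. c (Suc n) (i * N n + j)) /\<^sub>R real (N n)) \<le> r / 16 * (1 / 2) ^ n"
    and c_separated: "i < K n \<Longrightarrow> j < N n \<Longrightarrow> r \<le> norm (c n i - c (Suc n) (i * N n + j))"
begin

section \<open>The intervals of a bush and the measure on them\<close>

lemma K_pos: "0 < K n"
  by (induction n) (auto simp: K0 K_Suc N_pos)

definition pos :: "nat \<Rightarrow> real \<Rightarrow> nat" where
  "pos n t = nat \<lfloor>t * real (K n)\<rfloor>"

text \<open>\<open>J\<close> may contain indices beyond \<open>K n\<close>, which contribute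
  nothing; so the complement of a block is simply the block of \<open>- J\<close>.\<close>

definition block :: "nat \<Rightarrow> nat set \<Rightarrow> real set" where
  "block n J = {t\<in>{0..<1}. pos n t \<in> J}"

text \<open>The children of interval \<open>i\<close> have the indices \<open>i * N n + j\<close>,
  so division by \<open>N n\<close> leads back to the parent.\<close>

lemma pos_Suc:
  assumes "0 \<le> t"
  shows "pos (Suc n) t div N n = pos n t"
proof -
  have "\<lfloor>t * real (K n)\<rfloor> = \<lfloor>t * real (K (Suc n)) / real_of_int (int (N n))\<rfloor>"
    using N_pos[of n] by (simp add: K_Suc)
  also have "\<dots> = \<lfloor>t * real (K (Suc n))\<rfloor> div int (N n)" by (rule floor_divide_real_eq_div) simp
  finally show ?thesis using assms by (simp add: pos_def nat_div_distrib)
qed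

lemma pos_less:
  assumes "0 \<le> t" "t < 1"
  shows "pos n t < K n"
proof -
  have "t * real (K n) < real (K n)" using assms K_pos[of n] by simp
  then have "\<lfloor>t * real (K n)\<rfloor> < int (K n)" by (simp add: floor_less_iff)
  then show ?thesis using assms K_pos[of n] by (simp add: pos_def nat_less_iff)
qed

lemma block_Suc: "block n J = block (Suc n) {k. k div N n \<in> J}"
  by (auto simp: block_def pos_Suc)

lemma block_mono_level:
  assumes "n \<le> m"
  obtains J' where "block n J = block m J'"
  using assms
proof (induction m arbitrary: thesis rule: dec_induct)
  case base
  then show ?case by blast
next
  case (step m)
  obtain J' where "block n J = block m J'" using step.IH by blast
  then show ?case using block_Suc[of m J'] step.prems by simp
qed

definition blocks :: "real set set" where
  "blocks = {block n J | n J. True}"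

lemma blocks_algebra: "algebra {0..<1} blocks"
  unfolding algebra_iff_Un
proof (intro conjI ballI)
  show "blocks \<subseteq> Pow {0..<1}" by (auto simp: blocks_def block_def)
  have "{} = block 0 {}" by (simp add: block_def)
  then show "{} \<in> blocks" unfolding blocks_def by blast
  fix a assume "a \<in> blocks"
  then obtain n J where a: "a = block n J" by (auto simp: blocks_def)
  have "{0..<1} - a = block n (- J)" unfolding a by (auto simp: block_def)
  then show "{0..<1} - a \<in> blocks" by (auto simp: blocks_def)
  fix b assume "b \<in> blocks"
  then obtain m L where b: "b = block m L" by (auto simp: blocks_def)
  obtain J' where J': "block n J = block (max n m) J'" by (rule block_mono_level[of n "max n m"]) auto
  obtain L' where L': "block m L = block (max n m) L'" by (rule block_mono_level[of m "max n m"]) auto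
  have "a \<union> b = block (max n m) (J' \<union> L')" unfolding a b J' L' by (auto simp: block_def)
  then show "a \<union> b \<in> blocks" by (auto simp: blocks_def)
qed

text \<open>Lebesgue measure on the sigma-algebra generated by the blocks rather than on all Borel
  sets: \<open>approx_by_algebra\<close> then applies by construction.\<close>

definition M :: "real measure" where
  "M = measure_of {0..<1} blocks (emeasure lborel)"

lemma blocks_Pow: "blocks \<subseteq> Pow {0..<1}"
  by (auto simp: blocks_def block_def)

lemma space_M: "space M = {0..<1}"
  unfolding M_def by (rule space_measure_of[OF blocks_Pow])

lemma sets_M: "sets M = sigma_sets (space M) blocks"
  unfolding space_M unfolding M_def by (rule sets_measure_of[OF blocks_Pow])

lemma block_borel: "block n J \<in> sets borel"
proof -
  have "(\<lambda>t. t * real (K n)) \<in> borel_measurable borel" by measurable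
  from measurable_compose[OF this measurable_real_floor]
  have "(\<lambda>t. \<lfloor>t * real (K n)\<rfloor>) \<in> borel \<rightarrow>\<^sub>M count_space UNIV" .
  from measurable_compose[OF this, of nat "count_space UNIV"]
  have "pos n \<in> borel \<rightarrow>\<^sub>M count_space UNIV" by (simp add: pos_def[abs_def])
  from measurable_sets[OF this, of J] have "pos n -` J \<in> sets borel" by simp
  moreover have "block n J = {0..<1} \<inter> pos n -` J" by (auto simp: block_def)
  ultimately show ?thesis by simp
qed

lemma block_sets: "block n J \<in> sets M"
  unfolding sets_M by (auto simp: blocks_def)

lemma sets_M_borel: "A \<in> sets M \<Longrightarrow> A \<in> sets borel"
proof -
  have "sigma_sets {0..<1::real} blocks \<subseteq> sets borel"
    by (rule sets.sigma_sets_subset'[of blocks borel "{0..<1}"]) (auto simp: blocks_def block_borel)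
  then show "A \<in> sets M \<Longrightarrow> A \<in> sets borel" by (auto simp: sets_M space_M)
qed

lemma emeasure_M: "A \<in> sets M \<Longrightarrow> emeasure M A = emeasure lborel A"
proof (rule emeasure_measure_of[OF M_def blocks_Pow])
  show "positive (sets M) (emeasure lborel)" by (simp add: positive_def)
  show "countably_additive (sets M) (emeasure lborel)"
  proof (rule countably_additiveI)
    fix A :: "nat \<Rightarrow> real set" assume "range A \<subseteq> sets M" "disjoint_family A"
    then show "(\<Sum>i. emeasure lborel (A i)) = emeasure lborel (\<Union>i. A i)"
      using sets_M_borel by (intro suminf_emeasure) auto
  qed
qed

sublocale finite_measure M
proof
  have "space M \<in> sets M" by (rule sets.top)
  then show "emeasure M (space M) \<noteq> \<infinity>" by (simp add: emeasure_M) (simp add: space_M)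
qed

lemma measure_space_M: "measure M (space M) = 1"
  using sets.top[of M] emeasure_M[of "space M"] by (simp add: measure_def) (simp add: space_M)

abbreviation cell :: "nat \<Rightarrow> nat \<Rightarrow> real set" where
  "cell n i \<equiv> block n {i}"

lemma measure_cell:
  assumes "i < K n"
  shows "measure M (cell n i) = 1 / real (K n)"
proof -
  have k: "0 < real (K n)" using K_pos by simp
  have "cell n i = {real i / real (K n)..<(real i + 1) / real (K n)}"
  proof (rule set_eqI)
    fix t
    have "t \<in> cell n i \<longleftrightarrow> t \<in> {0..<1} \<and> \<lfloor>t * real (K n)\<rfloor> = int i"
      using k by (auto simp: block_def pos_def)
    also have "\<dots> \<longleftrightarrow> t \<in> {0..<1} \<and> real i \<le> t * real (K n) \<and> t * real (K n) < real i + 1"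
      by (simp add: floor_eq_iff)
    also have "\<dots> \<longleftrightarrow> real i \<le> t * real (K n) \<and> t * real (K n) < real i + 1"
    proof -
      have "t \<in> {0..<1}" if *: "real i \<le> t * real (K n)" "t * real (K n) < real i + 1"
      proof -
        have "0 \<le> t * real (K n)" using *(1) by linarith
        then have "0 \<le> t" using k by (simp add: zero_le_mult_iff)
        moreover have "t * real (K n) < 1 * real (K n)" using *(2) assms by linarith
        then have "t < 1" using k by (simp only: mult_less_cancel_right_pos)
        ultimately show ?thesis by simp
      qed
      then show ?thesis by blast
    qed
    also have "\<dots> \<longleftrightarrow> t \<in> {real i / real (K n)..<(real i + 1) / real (K n)}"
      using k by (simp add: field_simps)
    finally show "t \<in> cell n i \<longleftrightarrow> t \<in> {real i / real (K n)..<(real i + 1) / real (K n)}" .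
  qed
  then have "emeasure M (cell n i) = ennreal ((real i + 1) / real (K n) - real i / real (K n))"
    using emeasure_M[OF block_sets, of n "{i}"] k by (simp add: divide_right_mono)
  also have "(real i + 1) / real (K n) - real i / real (K n) = 1 / real (K n)"
    by (simp add: diff_divide_distrib[symmetric])
  finally show ?thesis using k by (simp add: measure_def)
qed

lemma sum_cells:
  assumes "E \<in> sets M"
  shows "(\<Sum>i<K n. measure M (E \<inter> cell n i)) = measure M E"
proof -
  have "E \<subseteq> {0..<1}" using sets.sets_into_space[OF assms] by (simp add: space_M)
  then have "E = (\<Union>i<K n. E \<inter> cell n i)"
    using pos_less by (fastforce simp: block_def)
  moreover have "disjoint_family_on (\<lambda>i. E \<inter> cell n i) {..<K n}"
    by (auto simp: disjoint_family_on_def block_def)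
  then have "measure M (\<Union>i<K n. E \<inter> cell n i) = (\<Sum>i<K n. measure M (E \<inter> cell n i))"
    using assms block_sets by (intro finite_measure_finite_Union) auto
  ultimately show ?thesis by simp
qed

lemma block_Int_cell: "block n J \<inter> cell n i = (if i \<in> J then cell n i else {})"
  by (auto simp: block_def)

lemma block_Int_cell_Suc: "block n J \<inter> cell (Suc n) k = (if k div N n \<in> J then cell (Suc n) k else {})"
  by (subst block_Suc) (simp add: block_Int_cell)

lemma sum_levels: "(\<Sum>k<K (Suc n). f k) = (\<Sum>i<K n. \<Sum>j<N n. f (i * N n + j))"
proof -
  have "sum f {i * N n..<i * N n + N n} = (\<Sum>j<N n. f (i * N n + j))" for i
    using sum.shift_bounds_nat_ivl[of f 0 "i * N n" "N n"] by (simp add: lessThan_atLeast0 add.commute)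
  then show ?thesis using sum.nat_group[of f "N n" "K n"] by (simp add: K_Suc)
qed

text \<open>The indefinite integral of the step function with value \<open>c m i\<close> on
  \<open>cell m i\<close>.\<close>

definition G_level :: "nat \<Rightarrow> real set \<Rightarrow> 'a" where
  "G_level m E = (\<Sum>i<K m. measure M (E \<inter> cell m i) *\<^sub>R c m i)"

lemma G_level_norm:
  assumes "E \<in> sets M"
  shows "norm (G_level m E) \<le> measure M E"
proof -
  have "norm (G_level m E) \<le> (\<Sum>i<K m. norm (measure M (E \<inter> cell m i) *\<^sub>R c m i))"
    unfolding G_level_def by (rule norm_sum)
  also have "\<dots> \<le> (\<Sum>i<K m. measure M (E \<inter> cell m i))"
    using c_bound by (intro sum_mono) (simp add: mult_left_le)
  finally show ?thesis using sum_cells[OF assms] by simp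
qed

lemma G_level_Un:
  assumes "A \<in> sets M" "B \<in> sets M" "A \<inter> B = {}"
  shows "G_level m (A \<union> B) = G_level m A + G_level m B"
proof -
  have "measure M ((A \<union> B) \<inter> cell m i) = measure M (A \<inter> cell m i) + measure M (B \<inter> cell m i)" for i
    unfolding Int_Un_distrib2 using assms block_sets by (intro finite_measure_Union) auto
  then show ?thesis by (simp add: G_level_def scaleR_left_distrib sum.distrib)
qed

lemma G_level_diff:
  assumes "A \<in> sets M" "B \<in> sets M"
  shows "norm (G_level m A - G_level m B) \<le> measure M (sym_diff A B)"
proof -
  have "G_level m A = G_level m (A - B) + G_level m (A \<inter> B)"
  proof -
    have "A - B \<union> A \<inter> B = A" "(A - B) \<inter> (A \<inter> B) = {}" by auto
    then show ?thesis using G_level_Un[of "A - B" "A \<inter> B" m] assms by auto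
  qed
  moreover have "G_level m B = G_level m (B - A) + G_level m (A \<inter> B)"
  proof -
    have "B - A \<union> A \<inter> B = B" "(B - A) \<inter> (A \<inter> B) = {}" by auto
    then show ?thesis using G_level_Un[of "B - A" "A \<inter> B" m] assms by auto
  qed
  ultimately have "norm (G_level m A - G_level m B) \<le> norm (G_level m (A - B)) + norm (G_level m (B - A))"
    using norm_triangle_ineq4[of "G_level m (A - B)" "G_level m (B - A)"] by simp
  also have "\<dots> \<le> measure M (A - B) + measure M (B - A)"
    using assms by (intro add_mono G_level_norm) auto
  also have "\<dots> = measure M (sym_diff A B)"
    using assms by (intro finite_measure_Union[symmetric]) auto
  finally show ?thesis .
qed

text \<open>A block of level \<open>m\<close> consists of whole cells, whose children have equal
  measure; so only the error in \<open>c_average\<close> remains.\<close>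

lemma G_level_Suc:
  "norm (G_level (Suc m) (block m J) - G_level m (block m J)) \<le> measure M (block m J) * (r / 16 * (1 / 2) ^ m)"
proof -
  have k: "0 < real (K m)" "0 < real (N m)" using K_pos N_pos by auto
  define w where "w i = (if i \<in> J then 1 / real (K m) else 0)" for i
  have w0: "0 \<le> w i" for i by (simp add: w_def)
  have wm: "measure M (block m J \<inter> cell m i) = w i" if "i < K m" for i
    using measure_cell[OF that] by (simp add: block_Int_cell w_def)
  have ws: "measure M (block m J \<inter> cell (Suc m) (i * N m + j)) = w i / real (N m)"
    if "i < K m" "j < N m" for i j
  proof -
    have "i * N m + j < (i + 1) * N m" using that(2) by simp
    also have "\<dots> \<le> K (Suc m)" unfolding K_Suc using that(1) by (intro mult_le_mono1) simp
    finally have lt: "i * N m + j < K (Suc m)" .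
    have "(i * N m + j) div N m = i" using that(2) by simp
    then show ?thesis
      using measure_cell[OF lt] by (simp add: block_Int_cell_Suc w_def K_Suc)
  qed
  have "G_level (Suc m) (block m J) = (\<Sum>i<K m. \<Sum>j<N m. (w i / real (N m)) *\<^sub>R c (Suc m) (i * N m + j))"
    unfolding G_level_def sum_levels using ws by (intro sum.cong refl) simp
  also have "\<dots> = (\<Sum>i<K m. w i *\<^sub>R ((\<Sum>j<N m. c (Suc m) (i * N m + j)) /\<^sub>R real (N m)))"
    by (intro sum.cong refl) (simp add: scaleR_sum_right divide_inverse)
  finally have "G_level (Suc m) (block m J) - G_level m (block m J) =
      (\<Sum>i<K m. w i *\<^sub>R ((\<Sum>j<N m. c (Suc m) (i * N m + j)) /\<^sub>R real (N m) - c m i))"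
    by (simp add: G_level_def wm scaleR_diff_right sum_subtractf)
  also have "norm \<dots> \<le> (\<Sum>i<K m. w i * (r / 16 * (1 / 2) ^ m))"
  proof (rule sum_norm_le)
    fix i assume "i \<in> {..<K m}"
    then have "norm ((\<Sum>j<N m. c (Suc m) (i * N m + j)) /\<^sub>R real (N m) - c m i) \<le> r / 16 * (1 / 2) ^ m"
      using c_average[of i m] by (simp add: norm_minus_commute)
    then show "norm (w i *\<^sub>R ((\<Sum>j<N m. c (Suc m) (i * N m + j)) /\<^sub>R real (N m) - c m i)) \<le> w i * (r / 16 * (1 / 2) ^ m)"
      unfolding norm_scaleR abs_of_nonneg[OF w0] by (rule mult_left_mono[OF _ w0])
  qed
  also have "\<dots> = (\<Sum>i<K m. w i) * (r / 16 * (1 / 2) ^ m)" by (rule sum_distrib_right[symmetric])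
  also have "(\<Sum>i<K m. w i) = measure M (block m J)"
    using sum_cells[OF block_sets, of m J m] wm by simp
  finally show ?thesis .
qed

text \<open>The errors \<open>r / 16 * (1 / 2) ^ k\<close> from level \<open>n\<close> on form a
  geometric series with sum \<open>r / 8 * (1 / 2) ^ n\<close>; its exact partial sums make the
  induction close.\<close>

lemma G_level_tail:
  assumes "n \<le> m"
  shows "norm (G_level m (block n J) - G_level n (block n J)) \<le>
    measure M (block n J) * (r / 8 * ((1 / 2) ^ n - (1 / 2) ^ m))"
  using assms
proof (induction m rule: dec_induct)
  case base
  then show ?case by simp
next
  case (step m)
  obtain J' where J': "block n J = block m J'" by (rule block_mono_level[OF step.hyps(1)])
  have "norm (G_level (Suc m) (block n J) - G_level n (block n J)) \<le>
      norm (G_level (Suc m) (block n J) - G_level m (block n J)) + norm (G_level m (block n J) - G_level n (block n J))"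
    using norm_triangle_ineq[of "G_level (Suc m) (block n J) - G_level m (block n J)"
        "G_level m (block n J) - G_level n (block n J)"] by simp
  also have "\<dots> \<le> measure M (block n J) * (r / 16 * (1 / 2) ^ m) +
      measure M (block n J) * (r / 8 * ((1 / 2) ^ n - (1 / 2) ^ m))"
    using G_level_Suc[of m J'] step.IH unfolding J' by (rule add_mono)
  also have "\<dots> = measure M (block n J) * (r / 8 * ((1 / 2) ^ n - (1 / 2) ^ Suc m))"
    by (simp add: algebra_simps)
  finally show ?case .
qed

text \<open>On blocks this is \<open>G_level_tail\<close>. Other sets are approximated by blocks,
  with an error that is uniform in the level by \<open>G_level_diff\<close>.\<close>

lemma G_level_Cauchy:
  assumes E: "E \<in> sets M"
  shows "Cauchy (\<lambda>m. G_level m E)"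
proof (rule CauchyI)
  fix e :: real assume "0 < e"
  then have "0 < e / 4" by simp
  then obtain S where S: "S \<in> blocks" "measure M (sym_diff E S) < e / 4"
    using approx_by_algebra[OF _ sets_M E] blocks_algebra unfolding space_M by blast
  then obtain n J where nJ: "S = block n J" by (auto simp: blocks_def)
  have "(\<lambda>m. (r / 8) * (1 / 2) ^ m) \<longlonglongrightarrow> (r / 8) * 0"
    by (intro tendsto_mult_left LIMSEQ_realpow_zero) auto
  then have "\<forall>\<^sub>F m in sequentially. (r / 8) * (1 / 2) ^ m < e / 4"
    using \<open>0 < e / 4\<close> order_tendstoD(2) by fastforce
  then obtain m0 where m0: "\<And>m. m \<ge> m0 \<Longrightarrow> (r / 8) * (1 / 2) ^ m < e / 4"
    by (auto simp: eventually_sequentially)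
  define p where "p = max n m0"
  obtain J' where J': "S = block p J'"
    unfolding nJ by (rule block_mono_level[of n p J]) (auto simp: p_def)
  have near: "norm (G_level m E - G_level p S) < e / 2" if "m \<ge> p" for m
  proof -
    have "norm (G_level m S - G_level p S) \<le> measure M S * (r / 8 * ((1 / 2) ^ p - (1 / 2) ^ m))"
      using G_level_tail[OF that, of J'] by (simp add: J')
    also have "\<dots> \<le> 1 * (r / 8 * (1 / 2) ^ p)"
    proof (rule mult_mono)
      show "measure M S \<le> 1" using bounded_measure[of S] measure_space_M by simp
      show "r / 8 * ((1 / 2) ^ p - (1 / 2) ^ m) \<le> r / 8 * (1 / 2) ^ p" using r_pos by simp
      show "0 \<le> r / 8 * ((1 / 2) ^ p - (1 / 2) ^ m)"
        using r_pos that by (simp add: power_decreasing)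
    qed simp
    also have "\<dots> < e / 4" using m0[of p] by (simp add: p_def)
    finally have "norm (G_level m S - G_level p S) < e / 4" .
    moreover have "norm (G_level m E - G_level m S) < e / 4"
      using G_level_diff[OF E, of S m] S block_sets nJ by simp
    ultimately show ?thesis
      using norm_triangle_ineq[of "G_level m E - G_level m S" "G_level m S - G_level p S"] by simp
  qed
  show "\<exists>p. \<forall>m\<ge>p. \<forall>n\<ge>p. norm (G_level m E - G_level n E) < e"
  proof (intro exI[of _ p] allI impI)
    fix m n assume "p \<le> m" "p \<le> n"
    then have "norm (G_level m E - G_level p S) < e / 2" "norm (G_level n E - G_level p S) < e / 2"
      using near by auto
    then show "norm (G_level m E - G_level n E) < e"
      using norm_triangle_ineq4[of "G_level m E - G_level p S" "G_level n E - G_level p S"] by simp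
  qed
qed

definition G :: "real set \<Rightarrow> 'a" where
  "G E = lim (\<lambda>m. G_level m E)"

lemma G_lim: "E \<in> sets M \<Longrightarrow> (\<lambda>m. G_level m E) \<longlonglongrightarrow> G E"
  unfolding G_def using G_level_Cauchy Cauchy_convergent convergent_LIMSEQ_iff by blast

text \<open>This domination yields the countable additivity, the bounded variation and the
  continuity below.\<close>

lemma G_norm:
  assumes "E \<in> sets M"
  shows "norm (G E) \<le> measure M E"
  by (rule LIMSEQ_le_const2[OF tendsto_norm[OF G_lim[OF assms]]]) (use G_level_norm[OF assms] in blast)

lemma G_Un:
  assumes "A \<in> sets M" "B \<in> sets M" "A \<inter> B = {}"
  shows "G (A \<union> B) = G A + G B"
proof -
  have "(\<lambda>m. G_level m (A \<union> B)) \<longlonglongrightarrow> G A + G B"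
    unfolding G_level_Un[OF assms] by (intro tendsto_add G_lim assms)
  then show ?thesis using G_lim[of "A \<union> B"] assms LIMSEQ_unique by blast
qed

lemma G_vector_measure: "vector_measure M G"
  unfolding vector_measure_def
proof (intro allI impI, elim conjE)
  fix A :: "nat \<Rightarrow> real set" assume A: "range A \<subseteq> sets M" "disjoint_family A"
  define B where "B m = (\<Union>k<m. A k)" for m :: nat
  have BM: "B m \<in> sets M" for m using A(1) by (auto simp: B_def)
  have part: "(\<Sum>k<m. G (A k)) = G (B m)" for m
  proof (induction m)
    case 0
    have "norm (G {}) \<le> 0" using G_norm[of "{}"] by simp
    then show ?case by (simp add: B_def)
  next
    case (Suc m)
    have "A m \<inter> A k = {}" if "k < m" for k
      using disjoint_family_onD[OF A(2), of m k] that by simp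
    then have "A m \<inter> B m = {}" unfolding B_def by blast
    moreover have "B (Suc m) = A m \<union> B m" by (auto simp: B_def less_Suc_eq)
    ultimately show ?case using G_Un[of "A m" "B m"] A(1) BM Suc by (auto simp: add.commute)
  qed
  have UM: "(\<Union>k. A k) \<in> sets M" using A(1) by auto
  have "incseq B" by (rule incseq_SucI) (auto simp: B_def less_Suc_eq)
  then have "(\<lambda>m. measure M (B m)) \<longlonglongrightarrow> measure M (\<Union>m. B m)"
    using BM by (intro finite_Lim_measure_incseq) auto
  moreover have "(\<Union>m. B m) = (\<Union>k. A k)" by (auto simp: B_def)
  ultimately have "(\<lambda>m. measure M (B m)) \<longlonglongrightarrow> measure M (\<Union>k. A k)" by simp
  from tendsto_diff[OF tendsto_const this, of "measure M (\<Union>k. A k)"]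
  have lim: "(\<lambda>m. measure M (\<Union>k. A k) - measure M (B m)) \<longlonglongrightarrow> 0" by simp
  have sub: "B m \<subseteq> (\<Union>k. A k)" for m by (auto simp: B_def)
  have bound: "norm (G (B m) - G (\<Union>k. A k)) \<le> measure M (\<Union>k. A k) - measure M (B m)" for m
  proof -
    have "B m \<union> ((\<Union>k. A k) - B m) = (\<Union>k. A k)" using sub by blast
    then have "G (\<Union>k. A k) = G (B m) + G ((\<Union>k. A k) - B m)"
      using G_Un[OF BM sets.Diff[OF UM BM], of m m] by simp
    then have "norm (G (B m) - G (\<Union>k. A k)) = norm (G ((\<Union>k. A k) - B m))" by simp
    also have "\<dots> \<le> measure M ((\<Union>k. A k) - B m)" by (rule G_norm[OF sets.Diff[OF UM BM]])
    also have "\<dots> = measure M (\<Union>k. A k) - measure M (B m)"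
      using UM BM sub by (intro finite_measure_Diff) auto
    finally show ?thesis .
  qed
  have "(\<lambda>m. G (B m) - G (\<Union>k. A k)) \<longlonglongrightarrow> 0"
    by (rule Lim_null_comparison[OF _ lim]) (use bound in simp)
  then have "(\<lambda>m. G (B m)) \<longlonglongrightarrow> G (\<Union>k. A k)" by (simp add: LIM_zero_iff)
  then show "(\<lambda>n. G (A n)) sums G (\<Union>n. A n)" unfolding sums_def part .
qed

lemma G_bounded_variation: "bounded_variation M G"
  unfolding bounded_variation_def
proof (intro exI[of _ 1] allI impI, elim conjE)
  fix P assume P: "finite P" "P \<subseteq> sets M" "disjoint P" "\<Union>P = space M"
  have "(\<Sum>E\<in>P. norm (G E)) \<le> (\<Sum>E\<in>P. measure M E)" using P(2) G_norm by (intro sum_mono) auto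
  also have "\<dots> = measure M (\<Union>E\<in>P. E)"
    using P by (intro finite_measure_finite_Union[symmetric]) (auto simp: disjoint_family_on_def disjoint_def)
  also have "\<dots> = 1" using P(4) measure_space_M by simp
  finally show "(\<Sum>E\<in>P. norm (G E)) \<le> 1" .
qed

lemma G_measure_continuous: "measure_continuous M G"
  unfolding measure_continuous_def
proof (intro allI impI)
  fix e :: real assume "0 < e"
  then show "\<exists>d>0. \<forall>E\<in>sets M. measure M E < d \<longrightarrow> norm (G E) < e"
    using G_norm by (intro exI[of _ e]) (auto intro: le_less_trans)
qed

text \<open>The mean value of \<open>G\<close> over a cell remembers the point of the bush up to
  \<open>r / 8\<close>, the total averaging error.\<close>

lemma G_cell:
  assumes "i < K n"
  shows "norm (real (K n) *\<^sub>R G (cell n i) - c n i) \<le> r / 8"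
proof -
  have k: "0 < real (K n)" using K_pos by simp
  have "G_level n (cell n i) = (\<Sum>k<K n. if k = i then (1 / real (K n)) *\<^sub>R c n i else 0)"
    unfolding G_level_def by (intro sum.cong refl) (auto simp: block_Int_cell measure_cell)
  then have Gn: "G_level n (cell n i) = (1 / real (K n)) *\<^sub>R c n i" using assms by simp
  have "norm (G (cell n i) - G_level n (cell n i)) \<le> (1 / real (K n)) * (r / 8)"
  proof (rule LIMSEQ_le_const2)
    show "(\<lambda>m. norm (G_level m (cell n i) - G_level n (cell n i))) \<longlonglongrightarrow>
        norm (G (cell n i) - G_level n (cell n i))"
      by (intro tendsto_norm tendsto_diff tendsto_const G_lim block_sets)
    have "norm (G_level m (cell n i) - G_level n (cell n i)) \<le> (1 / real (K n)) * (r / 8)" if "m \<ge> n" for m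
    proof -
      have "(1 / 2 :: real) ^ n \<le> 1" by (rule power_le_one) auto
      then have "(1 / 2 :: real) ^ n - (1 / 2) ^ m \<le> 1" using zero_le_power[of "1 / 2 :: real" m] by linarith
      then have "r / 8 * ((1 / 2) ^ n - (1 / 2) ^ m) \<le> r / 8 * 1" using r_pos by (intro mult_left_mono) auto
      then have "(1 / real (K n)) * (r / 8 * ((1 / 2) ^ n - (1 / 2) ^ m)) \<le> (1 / real (K n)) * (r / 8)"
        using k by (intro mult_left_mono) auto
      then show ?thesis using G_level_tail[OF that, of "{i}"] measure_cell[OF assms] by simp
    qed
    then show "\<exists>M. \<forall>m\<ge>M. norm (G_level m (cell n i) - G_level n (cell n i)) \<le> (1 / real (K n)) * (r / 8)"
      by blast
  qed
  moreover have "real (K n) *\<^sub>R G (cell n i) - c n i = real (K n) *\<^sub>R (G (cell n i) - G_level n (cell n i))"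
    using k by (simp add: Gn scaleR_diff_right)
  ultimately show ?thesis
    using k mult_left_mono[of "norm (G (cell n i) - G_level n (cell n i))" "1 / real (K n) * (r / 8)" "real (K n)"]
    by simp
qed

text \<open>The deviation of a child from its equal share of the parent. It vanishes for measures
  proportional to \<open>M\<close> on the parent cell.\<close>

abbreviation jump :: "(real set \<Rightarrow> 'b::real_vector) \<Rightarrow> nat \<Rightarrow> nat \<Rightarrow> 'b" where
  "jump \<Phi> n k \<equiv> \<Phi> (cell (Suc n) k) - \<Phi> (cell n (k div N n)) /\<^sub>R real (N n)"

text \<open>The points at a parent and a child are \<open>r\<close> apart, and each mean value is
  off by at most \<open>r / 8\<close>; so the mean values differ by \<open>3 / 4 * r\<close>, at
  every level.\<close>

lemma G_oscillation: "3 / 4 * r \<le> (\<Sum>k<K (Suc n). norm (jump G n k))"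
proof -
  have k: "0 < real (K (Suc n))" "0 < real (N n)" "0 < real (K n)" using K_pos N_pos by auto
  have "3 / 4 * r / real (K (Suc n)) \<le> norm (jump G n l)"
    if l: "l < K (Suc n)" for l
  proof -
    define i j where "i = l div N n" and "j = l mod N n"
    have ij: "i < K n" "j < N n" "l = i * N n + j"
      using l N_pos[of n] by (auto simp: i_def j_def K_Suc less_mult_imp_div_less)
    let ?x = "real (K (Suc n)) *\<^sub>R G (cell (Suc n) l)" and ?y = "real (K n) *\<^sub>R G (cell n i)"
    have "r \<le> norm (c n i - c (Suc n) l)" using c_separated[OF ij(1,2)] ij(3) by simp
    also have "c n i - c (Suc n) l = (?x - c (Suc n) l) - (?y - c n i) - (?x - ?y)" by simp
    also have "norm \<dots> \<le> norm (?x - c (Suc n) l) + norm (?y - c n i) + norm (?x - ?y)"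
      using norm_triangle_ineq4[of "(?x - c (Suc n) l) - (?y - c n i)" "?x - ?y"]
        norm_triangle_ineq4[of "?x - c (Suc n) l" "?y - c n i"] by linarith
    also have "\<dots> \<le> r / 8 + r / 8 + norm (?x - ?y)" using G_cell[OF l] G_cell[OF ij(1)] by simp
    finally have "3 / 4 * r \<le> norm (?x - ?y)" by simp
    also have "?x - ?y = real (K (Suc n)) *\<^sub>R (G (cell (Suc n) l) - G (cell n i) /\<^sub>R real (N n))"
      using k by (simp add: scaleR_diff_right K_Suc)
    also have "norm \<dots> = real (K (Suc n)) * norm (G (cell (Suc n) l) - G (cell n i) /\<^sub>R real (N n))" by simp
    finally show ?thesis using k by (simp add: i_def pos_divide_le_eq mult.commute)
  qed
  then have "(\<Sum>l<K (Suc n). 3 / 4 * r / real (K (Suc n))) \<le> (\<Sum>l<K (Suc n). norm (jump G n l))"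
    by (intro sum_mono) auto
  then show ?thesis using k by simp
qed

text \<open>With a block of level \<open>n\<close> in place of \<open>A\<close> all jumps vanish.
  The error is the symmetric difference, counted once for the children and once for the
  parents.\<close>

lemma block_oscillation:
  assumes A: "A \<in> sets M"
  shows "(\<Sum>k<K (Suc n). \<bar>jump (\<lambda>E. measure M (E \<inter> A)) n k\<bar>) \<le> 2 * measure M (sym_diff A (block n J))"
proof -
  let ?S = "block n J"
  let ?D = "sym_diff A ?S"
  have D: "?D \<in> sets M" using A block_sets by auto
  have k: "0 < real (N n)" using N_pos by simp
  have d: "\<bar>measure M (C \<inter> A) - measure M (C \<inter> ?S)\<bar> \<le> measure M (C \<inter> ?D)" if C: "C \<in> sets M" for C
  proof -
    have "measure M (C \<inter> A) \<le> measure M ((C \<inter> ?S) \<union> (C \<inter> ?D))"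
      using A C block_sets by (intro finite_measure_mono) auto
    also have "\<dots> \<le> measure M (C \<inter> ?S) + measure M (C \<inter> ?D)"
      using A C block_sets by (intro measure_Un_le) auto
    finally have 1: "measure M (C \<inter> A) \<le> measure M (C \<inter> ?S) + measure M (C \<inter> ?D)" .
    have "measure M (C \<inter> ?S) \<le> measure M ((C \<inter> A) \<union> (C \<inter> ?D))"
      using A C block_sets by (intro finite_measure_mono) auto
    also have "\<dots> \<le> measure M (C \<inter> A) + measure M (C \<inter> ?D)"
      using A C block_sets by (intro measure_Un_le) auto
    finally show ?thesis using 1 by simp
  qed
  have "\<bar>jump (\<lambda>E. measure M (E \<inter> A)) n l\<bar> \<le>
      measure M (cell (Suc n) l \<inter> ?D) + measure M (cell n (l div N n) \<inter> ?D) / real (N n)"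
    if l: "l < K (Suc n)" for l
  proof -
    have i: "l div N n < K n" using l by (simp add: K_Suc less_mult_imp_div_less)
    have "measure M (cell (Suc n) l \<inter> ?S) = measure M (cell n (l div N n) \<inter> ?S) / real (N n)"
      using block_Int_cell_Suc[of n J l] block_Int_cell[of n J "l div N n"] measure_cell[OF l] measure_cell[OF i]
      by (simp add: Int_commute K_Suc)
    moreover have "\<bar>measure M (cell n (l div N n) \<inter> A) / real (N n) - measure M (cell n (l div N n) \<inter> ?S) / real (N n)\<bar>
        \<le> measure M (cell n (l div N n) \<inter> ?D) / real (N n)"
      using d[OF block_sets, of n "{l div N n}"] k
      by (simp add: diff_divide_distrib[symmetric] abs_divide divide_right_mono)
    ultimately show ?thesis using d[OF block_sets, of "Suc n" "{l}"]
      by (simp add: divide_inverse mult.commute)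
  qed
  then have "(\<Sum>k<K (Suc n). \<bar>jump (\<lambda>E. measure M (E \<inter> A)) n k\<bar>) \<le>
      (\<Sum>l<K (Suc n). measure M (cell (Suc n) l \<inter> ?D) + measure M (cell n (l div N n) \<inter> ?D) / real (N n))"
    by (intro sum_mono) auto
  also have "\<dots> = measure M ?D + (\<Sum>i<K n. \<Sum>j<N n. measure M (cell n i \<inter> ?D) / real (N n))"
    using sum_cells[OF D, of "Suc n"] unfolding sum.distrib sum_levels[of "\<lambda>l. measure M (cell n (l div N n) \<inter> ?D) / real (N n)"]
    by (simp add: Int_commute)
  also have "(\<Sum>i<K n. \<Sum>j<N n. measure M (cell n i \<inter> ?D) / real (N n)) = measure M ?D"
    using sum_cells[OF D, of n] k by (simp add: Int_commute)
  finally show ?thesis by simp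
qed

end

section \<open>Absence of a density\<close>

context bush
begin

text \<open>A density is close in mean to a simple function, so the indefinite integrals are close
  in variation; this is stated for finite disjoint families.\<close>

lemma density_close_to_simple:
  assumes g: "\<And>E. E \<in> sets M \<Longrightarrow> has_strong_bochner_integral M (\<lambda>x. indicat_real E x *\<^sub>R g x) (G E)"
    and \<kappa>: "0 < \<kappa>"
  obtains s where "simple_function M s"
    "\<forall>F (E :: nat \<Rightarrow> real set). finite F \<longrightarrow> disjoint_family_on E F \<longrightarrow> E ` F \<subseteq> sets M \<longrightarrow>
      (\<Sum>k\<in>F. norm (G (E k) - (\<Sum>y\<in>s ` space M. measure M (E k \<inter> {x\<in>space M. s x = y}) *\<^sub>R y))) \<le> \<kappa>"
proof -
  let ?h = "\<lambda>x. indicat_real (space M) x *\<^sub>R g x"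
  obtain S where S: "\<And>i. Bochner_Integration.simple_bochner_integrable M (S i)"
    "AE x in M. (\<lambda>i. S i x) \<longlonglongrightarrow> ?h x"
    "(\<lambda>i. \<integral>\<^sup>+x. ennreal (norm (?h x - S i x)) \<partial>M) \<longlonglongrightarrow> 0"
    using g[OF sets.top] unfolding has_strong_bochner_integral_def by auto
  have "0 < ennreal \<kappa>" using \<kappa> by simp
  then have "\<forall>\<^sub>F i in sequentially. (\<integral>\<^sup>+x. ennreal (norm (?h x - S i x)) \<partial>M) < ennreal \<kappa>"
    by (rule order_tendstoD(2)[OF S(3)])
  then obtain i where i: "(\<integral>\<^sup>+x. ennreal (norm (?h x - S i x)) \<partial>M) < ennreal \<kappa>"
    by (auto dest: eventually_happens)
  define s where "s = S i"
  have s: "simple_function M s"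
    using S(1)[of i] by (simp add: s_def Bochner_Integration.simple_bochner_integrable.simps)
  obtain q where q: "q \<in> borel_measurable M" "AE x in M. ennreal (norm (?h x - s x)) = q x"
    unfolding s_def by (rule strong_bochner_measurable[OF S(1,2) S(1)])
  define Z where "Z E = (\<Sum>y\<in>s ` space M. measure M (E \<inter> {x\<in>space M. s x = y}) *\<^sub>R y)" for E
  have each: "ennreal (norm (G E - Z E)) \<le> (\<integral>\<^sup>+x. indicator E x * q x \<partial>M)" if E: "E \<in> sets M" for E
  proof -
    note I = simple_bochner_integral_indicator[OF finite_measure_axioms s E]
    have "ennreal (norm (G E - Z E)) \<le>
        (\<integral>\<^sup>+x. ennreal (norm (indicat_real E x *\<^sub>R g x - indicat_real E x *\<^sub>R s x)) \<partial>M)"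
      using strong_bochner_integral_diff[OF g[OF E] I(1)] unfolding I(2) Z_def .
    also have "\<dots> = (\<integral>\<^sup>+x. indicator E x * q x \<partial>M)"
    proof (rule nn_integral_cong_AE)
      show "AE x in M. ennreal (norm (indicat_real E x *\<^sub>R g x - indicat_real E x *\<^sub>R s x)) = indicator E x * q x"
        using q(2) AE_space
      proof eventually_elim
        case (elim x)
        then show ?case by (cases "x \<in> E") auto
      qed
    qed
    finally show ?thesis .
  qed
  have fam: "(\<Sum>k\<in>F. norm (G (E k) - Z (E k))) \<le> \<kappa>"
    if F: "finite F" "disjoint_family_on E F" "E ` F \<subseteq> sets M" for F and E :: "nat \<Rightarrow> real set"
  proof -
    have "ennreal (\<Sum>k\<in>F. norm (G (E k) - Z (E k))) = (\<Sum>k\<in>F. ennreal (norm (G (E k) - Z (E k))))"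
      by (simp add: sum_ennreal)
    also have "\<dots> \<le> (\<Sum>k\<in>F. \<integral>\<^sup>+x. indicator (E k) x * q x \<partial>M)"
      using F(3) each by (intro sum_mono) auto
    also have "\<dots> = (\<integral>\<^sup>+x. (\<Sum>k\<in>F. indicator (E k) x * q x) \<partial>M)"
      using F(3) q(1) by (intro nn_integral_sum[symmetric] borel_measurable_times_ennreal borel_measurable_indicator) auto
    also have "\<dots> \<le> (\<integral>\<^sup>+x. q x \<partial>M)"
    proof (rule nn_integral_mono)
      fix x
      have "(\<Sum>k\<in>F. indicator (E k) x * q x) = indicator (\<Union>(E ` F)) x * q x"
        by (simp add: indicator_UN_disjoint[OF F(1,2)] sum_distrib_right)
      also have "\<dots> \<le> q x" by (cases "x \<in> \<Union>(E ` F)") auto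
      finally show "(\<Sum>k\<in>F. indicator (E k) x * q x) \<le> q x" .
    qed
    also have "\<dots> = (\<integral>\<^sup>+x. ennreal (norm (?h x - s x)) \<partial>M)"
      using q(2) by (intro nn_integral_cong_AE) auto
    also have "\<dots> \<le> ennreal \<kappa>" using i by (simp add: s_def)
    finally show ?thesis using \<kappa> by simp
  qed
  show ?thesis by (rule that[OF s]) (use fam in \<open>auto simp: Z_def\<close>)
qed

lemma common_level:
  assumes "finite Y" "\<And>y. y \<in> Y \<Longrightarrow> A y \<in> sets M" "0 < (e::real)"
  obtains n J where "\<forall>y\<in>Y. measure M (sym_diff (A y) (block n (J y))) < e"
proof -
  have "\<exists>m L. measure M (sym_diff (A y) (block m L)) < e" if "y \<in> Y" for y
  proof -
    have "\<exists>S\<in>blocks. measure M (sym_diff (A y) S) < e"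
      using approx_by_algebra[OF _ sets_M assms(2)[OF that] assms(3)] blocks_algebra by (simp add: space_M)
    then show ?thesis by (auto simp: blocks_def)
  qed
  then obtain m L where mL: "\<And>y. y \<in> Y \<Longrightarrow>
      measure M (sym_diff (A y) (block (m y) (L y))) < e" by metis
  define n where "n = Max (insert 0 (m ` Y))"
  have "\<exists>J. block (m y) (L y) = block n J" if "y \<in> Y" for y
  proof -
    have "m y \<le> n" unfolding n_def using assms(1) that by (intro Max_ge) auto
    from block_mono_level[OF this, of "L y"] show ?thesis by blast
  qed
  then obtain J where "\<And>y. y \<in> Y \<Longrightarrow> block (m y) (L y) = block n (J y)" by metis
  then show ?thesis using that[of n J] mL by auto
qed

text \<open>The total jump of \<open>G\<close> is at least \<open>3 / 4 * r\<close> at every level.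
  A density would make \<open>G\<close> close in variation to the integral \<open>Z\<close> of a
  simple function, whose jumps are small at a level where its level sets are almost blocks.\<close>

lemma not_radon_nikodym: "\<not> radon_nikodym_property TYPE('a)"
proof
  assume "radon_nikodym_property TYPE('a)"
  then have "finite_measure M \<and> vector_measure M G \<and> bounded_variation M G \<and> measure_continuous M G \<longrightarrow>
      (\<exists>g. \<forall>E\<in>sets M. has_strong_bochner_integral M (\<lambda>x. indicat_real E x *\<^sub>R g x) (G E))"
    unfolding radon_nikodym_property_def by blast
  then obtain g where g: "\<And>E. E \<in> sets M \<Longrightarrow> has_strong_bochner_integral M (\<lambda>x. indicat_real E x *\<^sub>R g x) (G E)"
    using finite_measure_axioms G_vector_measure G_bounded_variation G_measure_continuous by blast
  \<comment> \<open>Three errors of size \<open>\<kappa>\<close>, from the children, the parents and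
    the jumps of \<open>Z\<close>, stay below \<open>3 / 4 * r\<close>.\<close>
  define \<kappa> where "\<kappa> = r / 8"
  have \<kappa>: "0 < \<kappa>" using r_pos by (simp add: \<kappa>_def)
  obtain s where s: "simple_function M s"
    "\<forall>F (E :: nat \<Rightarrow> real set). finite F \<longrightarrow> disjoint_family_on E F \<longrightarrow> E ` F \<subseteq> sets M \<longrightarrow>
      (\<Sum>k\<in>F. norm (G (E k) - (\<Sum>y\<in>s ` space M. measure M (E k \<inter> {x\<in>space M. s x = y}) *\<^sub>R y))) \<le> \<kappa>"
    by (rule density_close_to_simple[OF g \<kappa>])
  define A where "A y = {x\<in>space M. s x = y}" for y
  define Y where "Y = s ` space M"
  define Z where "Z E = (\<Sum>y\<in>Y. measure M (E \<inter> A y) *\<^sub>R y)" for E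
  have fin: "finite Y" unfolding Y_def using s(1) by (rule simple_functionD)
  have AM: "A y \<in> sets M" for y
  proof -
    have "A y = s -` {y} \<inter> space M" by (auto simp: A_def)
    then show ?thesis using simple_functionD(2)[OF s(1), of "{y}"] by simp
  qed
  have cells: "(\<Sum>k<K m. norm (G (cell m k) - Z (cell m k))) \<le> \<kappa>" for m
  proof -
    have "disjoint_family_on (cell m) {..<K m}" "cell m ` {..<K m} \<subseteq> sets M"
      using block_sets by (auto simp: disjoint_family_on_def) (simp add: block_def)
    from s(2)[rule_format, OF finite_lessThan this] show ?thesis by (simp add: Z_def A_def Y_def)
  qed
  define W where "W = (\<Sum>y\<in>Y. norm y)"
  have W: "0 \<le> W" by (simp add: W_def sum_nonneg)
  define e where "e = \<kappa> / (2 * (W + 1))"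
  have e: "0 < e" "2 * e * W \<le> \<kappa>" using \<kappa> W by (auto simp: e_def field_simps)
  obtain n J where nJ: "\<forall>y\<in>Y. measure M (sym_diff (A y) (block n (J y))) < e"
    using common_level[OF fin, of A e] AM e(1) by metis
  have N: "0 < real (N n)" using N_pos by simp
  let ?i = "\<lambda>k. k div N n"
  let ?\<mu> = "\<lambda>y E. measure M (E \<inter> A y)"
  have Zdiff: "norm (jump Z n k) \<le> (\<Sum>y\<in>Y. \<bar>jump (?\<mu> y) n k\<bar> * norm y)" for k
  proof -
    have eq: "jump Z n k = (\<Sum>y\<in>Y. jump (?\<mu> y) n k *\<^sub>R y)"
      by (simp add: Z_def scaleR_sum_right sum_subtractf[symmetric] scaleR_diff_left)
    show ?thesis unfolding eq by (rule sum_norm_le) simp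
  qed
  have "(\<Sum>k<K (Suc n). norm (jump Z n k)) \<le> (\<Sum>k<K (Suc n). \<Sum>y\<in>Y. \<bar>jump (?\<mu> y) n k\<bar> * norm y)"
    by (rule sum_mono) (rule Zdiff)
  also have "\<dots> = (\<Sum>y\<in>Y. (\<Sum>k<K (Suc n). \<bar>jump (?\<mu> y) n k\<bar>) * norm y)"
    by (subst sum.swap) (simp add: sum_distrib_right)
  also have "\<dots> \<le> (\<Sum>y\<in>Y. (2 * e) * norm y)"
  proof (rule sum_mono, rule mult_right_mono)
    fix y assume "y \<in> Y"
    then have "measure M (sym_diff (A y) (block n (J y))) < e" using nJ by blast
    then show "(\<Sum>k<K (Suc n). \<bar>jump (?\<mu> y) n k\<bar>) \<le> 2 * e"
      using block_oscillation[OF AM, of n y "J y"] by linarith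
  qed simp
  also have "\<dots> = 2 * e * W" by (simp add: W_def sum_distrib_left)
  finally have third: "(\<Sum>k<K (Suc n). norm (jump Z n k)) \<le> \<kappa>"
    using e(2) by simp
  have second: "(\<Sum>k<K (Suc n). norm (G (cell n (?i k)) - Z (cell n (?i k))) / real (N n)) \<le> \<kappa>"
  proof -
    have "(\<Sum>k<K (Suc n). norm (G (cell n (?i k)) - Z (cell n (?i k))) / real (N n)) =
        (\<Sum>i<K n. \<Sum>j<N n. norm (G (cell n i) - Z (cell n i)) / real (N n))"
      unfolding sum_levels by (intro sum.cong refl) simp
    also have "\<dots> = (\<Sum>i<K n. norm (G (cell n i) - Z (cell n i)))" using N by simp
    finally show ?thesis using cells[of n] by simp
  qed
  have "norm (jump G n k) \<le> norm (G (cell (Suc n) k) - Z (cell (Suc n) k)) +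
      norm (G (cell n (?i k)) - Z (cell n (?i k))) / real (N n) + norm (jump Z n k)" for k
  proof -
    let ?a = "G (cell (Suc n) k) - Z (cell (Suc n) k)"
    let ?b = "(G (cell n (?i k)) - Z (cell n (?i k))) /\<^sub>R real (N n)"
    have d: "jump G n k = ?a - ?b + jump Z n k" by (simp add: scaleR_diff_right)
    have b: "norm ?b = norm (G (cell n (?i k)) - Z (cell n (?i k))) / real (N n)"
      by (simp add: divide_inverse mult.commute)
    show ?thesis
      unfolding d b[symmetric]
      using norm_triangle_ineq[of "?a - ?b" "jump Z n k"] norm_triangle_ineq4[of ?a ?b] by linarith
  qed
  then have "(\<Sum>k<K (Suc n). norm (jump G n k)) \<le>
      (\<Sum>k<K (Suc n). norm (G (cell (Suc n) k) - Z (cell (Suc n) k)) +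
        norm (G (cell n (?i k)) - Z (cell n (?i k))) / real (N n) + norm (jump Z n k))"
    by (intro sum_mono) auto
  also have "\<dots> \<le> \<kappa> + \<kappa> + \<kappa>"
    unfolding sum.distrib using cells[of "Suc n"] second third by linarith
  finally show False using G_oscillation[of n] \<kappa> by (simp add: \<kappa>_def)
qed

end

section \<open>Equal-weight averages and the construction of a bush\<close>

lemma rational_average:
  fixes xs ys :: "'a::real_vector list"
  assumes "xs \<noteq> []" "ys \<noteq> []" "0 < p + q" "set xs \<subseteq> S" "set ys \<subseteq> S"
  shows "\<exists>zs. zs \<noteq> [] \<and> set zs \<subseteq> S \<and> sum_list zs /\<^sub>R real (length zs) =
    (real p / real (p + q)) *\<^sub>R (sum_list xs /\<^sub>R real (length xs)) +
    (real q / real (p + q)) *\<^sub>R (sum_list ys /\<^sub>R real (length ys))"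
proof -
  let ?rep = "\<lambda>k xs. concat (replicate k xs)"
  have sum: "sum_list (?rep k xs) = real k *\<^sub>R sum_list xs" for k and xs :: "'a list"
    by (induction k) (auto simp: scaleR_left_distrib)
  have len: "length (?rep k xs) = k * length xs" for k and xs :: "'a list"
    by (induction k) auto
  define zs where "zs = ?rep (p * length ys) xs @ ?rep (q * length xs) ys"
  have l: "length zs = (p + q) * length xs * length ys" by (simp add: zs_def len algebra_simps)
  have lr: "real (length zs) = real (p + q) * real (length xs) * real (length ys)"
    unfolding l by (simp only: of_nat_mult)
  have pos: "0 < real (length xs)" "0 < real (length ys)" "0 < real (p + q)" using assms by auto
  have "sum_list zs = (real p * real (length ys)) *\<^sub>R sum_list xs + (real q * real (length xs)) *\<^sub>R sum_list ys"
    by (simp add: zs_def sum)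
  then have "sum_list zs /\<^sub>R real (length zs) =
      (real p * real (length ys) / real (length zs)) *\<^sub>R sum_list xs +
      (real q * real (length xs) / real (length zs)) *\<^sub>R sum_list ys"
    by (simp add: scaleR_add_right divide_inverse mult.commute)
  also have "real p * real (length ys) / real (length zs) = real p / real (p + q) * (1 / real (length xs))"
    using pos by (simp add: lr del: of_nat_add)
  also have "real q * real (length xs) / real (length zs) = real q / real (p + q) * (1 / real (length ys))"
    using pos by (simp add: lr del: of_nat_add)
  finally have "sum_list zs /\<^sub>R real (length zs) =
      (real p / real (p + q)) *\<^sub>R (sum_list xs /\<^sub>R real (length xs)) +
      (real q / real (p + q)) *\<^sub>R (sum_list ys /\<^sub>R real (length ys))"
    by (simp add: divide_inverse)
  moreover have "set zs \<subseteq> S" using assms(4,5) by (auto simp: zs_def)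
  moreover have "zs \<noteq> []" using l assms by auto
  ultimately show ?thesis by blast
qed

text \<open>Equal weights are wanted because the intervals of a bush have equal lengths. The closure
  of the averages is convex, since a real weight is a limit of fractions and fractions are realised
  by repeating lists.\<close>

lemma convex_hull_averages:
  fixes S :: "'a::real_normed_vector set"
  shows "closure (convex hull S) \<subseteq>
    closure {sum_list xs /\<^sub>R real (length xs) | xs. xs \<noteq> [] \<and> set xs \<subseteq> S}" (is "_ \<subseteq> closure ?A")
proof -
  have "convex (closure ?A)"
    unfolding convex_alt
  proof (intro ballI allI impI)
    fix a b and t :: real assume a: "a \<in> closure ?A" and b: "b \<in> closure ?A" and t: "0 \<le> t \<and> t \<le> 1"
    obtain as where as: "\<forall>n. as n \<in> ?A" "as \<longlonglongrightarrow> a" using a unfolding closure_sequential by blast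
    obtain bs where bs: "\<forall>n. bs n \<in> ?A" "bs \<longlonglongrightarrow> b" using b unfolding closure_sequential by blast
    define q where "q n = nat \<lfloor>t * real (Suc n)\<rfloor>" for n
    define T where "T n = real (q n) / real (Suc n)" for n
    have q: "real (q n) \<le> t * real (Suc n)" "t * real (Suc n) < real (q n) + 1" for n
      using t by (auto simp: q_def)
    have qn: "q n \<le> Suc n" for n
    proof -
      have "real (q n) \<le> 1 * real (Suc n)"
        using q(1)[of n] t mult_right_mono[of t 1 "real (Suc n)"] by linarith
      then show ?thesis by simp
    qed
    have "\<bar>T n - t\<bar> \<le> 1 / real (Suc n)" for n
    proof -
      have "T n - t = (real (q n) - t * real (Suc n)) / real (Suc n)" by (simp add: T_def field_simps)
      also have "\<bar>\<dots>\<bar> \<le> 1 / real (Suc n)" unfolding abs_divide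
        using q[of n] by (intro divide_mono) auto
      finally show ?thesis .
    qed
    then have "(\<lambda>n. T n - t) \<longlonglongrightarrow> 0"
      by (intro Lim_null_comparison[OF _ LIMSEQ_Suc[OF lim_1_over_n]]) (auto simp del: of_nat_Suc)
    then have T: "T \<longlonglongrightarrow> t" by (simp add: LIM_zero_iff)
    have mem: "(1 - T n) *\<^sub>R as n + T n *\<^sub>R bs n \<in> ?A" for n
    proof -
      obtain xs ys where xy: "xs \<noteq> []" "set xs \<subseteq> S" "as n = sum_list xs /\<^sub>R real (length xs)"
        "ys \<noteq> []" "set ys \<subseteq> S" "bs n = sum_list ys /\<^sub>R real (length ys)" using as(1) bs(1) by blast
      have pq: "(Suc n - q n) + q n = Suc n" using qn[of n] by simp
      have "1 - T n = real (Suc n - q n) / real (Suc n)"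
        using qn[of n] by (simp add: T_def field_simps of_nat_diff)
      moreover obtain zs where zs: "zs \<noteq> []" "set zs \<subseteq> S" "sum_list zs /\<^sub>R real (length zs) =
          (real (Suc n - q n) / real (Suc n)) *\<^sub>R (sum_list xs /\<^sub>R real (length xs)) +
          (real (q n) / real (Suc n)) *\<^sub>R (sum_list ys /\<^sub>R real (length ys))"
        using rational_average[OF xy(1,4) _ xy(2,5), of "Suc n - q n" "q n"] unfolding pq by blast
      ultimately have "(1 - T n) *\<^sub>R as n + T n *\<^sub>R bs n = sum_list zs /\<^sub>R real (length zs)"
        by (simp only: xy(3,6) T_def)
      then show ?thesis using zs(1,2) by blast
    qed
    have lim: "(\<lambda>n. (1 - T n) *\<^sub>R as n + T n *\<^sub>R bs n) \<longlonglongrightarrow> (1 - t) *\<^sub>R a + t *\<^sub>R b"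
      by (intro tendsto_intros T as(2) bs(2))
    show "(1 - t) *\<^sub>R a + t *\<^sub>R b \<in> closure ?A"
      unfolding closure_sequential by (intro exI conjI allI) (rule mem, rule lim)
  qed
  moreover have "S \<subseteq> closure ?A"
  proof
    fix x assume "x \<in> S"
    then have "x \<in> ?A" by (intro CollectI exI[of _ "[x]"]) auto
    then show "x \<in> closure ?A" by (rule subsetD[OF closure_subset])
  qed
  ultimately have "convex hull S \<subseteq> closure ?A" by (intro hull_minimal)
  then show ?thesis by (rule closure_minimal) (rule closed_closure)
qed

text \<open>A list with a good average is continued periodically, so that every multiple of its
  length is a good number of points too; \<open>bush_step\<close> needs one number for all nodes of
  a level.\<close>

lemma convex_hull_uniform_averages:
  fixes S :: "'a::real_normed_vector set"
  assumes x: "x \<in> closure (convex hull S)" and \<eta>: "0 < \<eta>"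
  shows "\<exists>N>0. \<exists>y::nat \<Rightarrow> 'a. (\<forall>j. y j \<in> S) \<and>
    (\<forall>k>0. norm (x - (\<Sum>j<N * k. y j) /\<^sub>R real (N * k)) < \<eta>)"
proof -
  obtain xs where xs: "xs \<noteq> []" "set xs \<subseteq> S" "dist (sum_list xs /\<^sub>R real (length xs)) x < \<eta>"
  proof -
    have "\<exists>a\<in>{sum_list xs /\<^sub>R real (length xs) | xs. xs \<noteq> [] \<and> set xs \<subseteq> S}. dist a x < \<eta>"
      by (rule closure_approachable[THEN iffD1, rule_format, OF subsetD[OF convex_hull_averages x] \<eta>])
    then show ?thesis using that by auto
  qed
  define N where "N = length xs"
  define y where "y j = xs ! (j mod N)" for j
  have N: "0 < N" using xs(1) by (simp add: N_def)
  have "(\<Sum>j<N * k. y j) = real k *\<^sub>R sum_list xs" for k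
  proof -
    have "sum y {m * N..<m * N + N} = sum_list xs" for m
      using sum.shift_bounds_nat_ivl[of y 0 "m * N" N]
      by (simp add: y_def sum_list_sum_nth N_def add.commute)
    then show ?thesis using sum.nat_group[of y N k] by (simp add: mult.commute scaleR_sum_left[symmetric] sum_constant_scaleR)
  qed
  then have "(\<Sum>j<N * k. y j) /\<^sub>R real (N * k) = sum_list xs /\<^sub>R real N" if "0 < k" for k
  proof -
    have "inverse (real (N * k)) * real k = inverse (real N)" using that N by (simp add: field_simps)
    then show ?thesis by (simp only: \<open>\<And>k. (\<Sum>j<N * k. y j) = real k *\<^sub>R sum_list xs\<close> scaleR_scaleR)
  qed
  moreover have "norm (x - sum_list xs /\<^sub>R real N) < \<eta>"
    using xs(3) by (simp add: N_def dist_norm norm_minus_commute)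
  moreover have "y j \<in> S" for j using xs(2) N by (auto simp: y_def N_def subset_iff)
  ultimately show ?thesis using N by (intro exI[of _ N] conjI exI[of _ y] allI impI) auto
qed

lemma bush_step:
  fixes D :: "'a::real_normed_vector set"
  assumes D: "\<And>x. x \<in> D \<Longrightarrow> x \<in> closure (convex hull {y\<in>D. r \<le> norm (x - y)})"
    and c: "\<And>i. c i \<in> D" and \<eta>: "0 < \<eta>"
  shows "\<exists>N>0. \<exists>c'. (\<forall>i. c' i \<in> D) \<and>
    (\<forall>i<K. norm (c i - (\<Sum>j<N. c' (i * N + j)) /\<^sub>R real N) \<le> \<eta>) \<and>
    (\<forall>i<K. \<forall>j<N. r \<le> norm (c i - c' (i * N + j)))"
proof -
  have "\<forall>i. \<exists>N>0. \<exists>y. (\<forall>j. y j \<in> {y\<in>D. r \<le> norm (c i - y)}) \<and>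
      (\<forall>k>0. norm (c i - (\<Sum>j<N * k. y j) /\<^sub>R real (N * k)) < \<eta>)"
    by (rule allI) (rule convex_hull_uniform_averages[OF D[OF c] \<eta>])
  from choice[OF this] obtain L where "\<forall>i. 0 < L i \<and> (\<exists>y. (\<forall>j. y j \<in> {y\<in>D. r \<le> norm (c i - y)}) \<and>
      (\<forall>k>0. norm (c i - (\<Sum>j<L i * k. y j) /\<^sub>R real (L i * k)) < \<eta>))"
    by (elim exE)
  then have L0: "0 < L i" and "\<exists>y. (\<forall>j. y j \<in> {y\<in>D. r \<le> norm (c i - y)}) \<and>
      (\<forall>k>0. norm (c i - (\<Sum>j<L i * k. y j) /\<^sub>R real (L i * k)) < \<eta>)" for i
    by simp_all
  then have "\<forall>i. \<exists>y. (\<forall>j. y j \<in> {y\<in>D. r \<le> norm (c i - y)}) \<and>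
      (\<forall>k>0. norm (c i - (\<Sum>j<L i * k. y j) /\<^sub>R real (L i * k)) < \<eta>)" by (intro allI)
  from choice[OF this] obtain y where y: "\<forall>i. (\<forall>j. y i j \<in> {y\<in>D. r \<le> norm (c i - y)}) \<and>
      (\<forall>k>0. norm (c i - (\<Sum>j<L i * k. y i j) /\<^sub>R real (L i * k)) < \<eta>)" by (elim exE)
  have L: "0 < L i" "y i j \<in> {y\<in>D. r \<le> norm (c i - y)}"
    "0 < k \<Longrightarrow> norm (c i - (\<Sum>j<L i * k. y i j) /\<^sub>R real (L i * k)) < \<eta>" for i j k
    using L0[of i] y[rule_format, of i] by simp_all
  \<comment> \<open>A common multiple of the \<open>L i\<close>, so that all nodes of the level get
    the same number of children.\<close>
  define N where "N = (\<Prod>i<K. L i)"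
  have N: "0 < N" unfolding N_def using L(1) by (intro prod_pos) auto
  define c' where "c' m = y (m div N) (m mod N)" for m
  have c': "c' (i * N + j) = y i j" if "j < N" for i j using that by (simp add: c'_def)
  have "norm (c i - (\<Sum>j<N. c' (i * N + j)) /\<^sub>R real N) \<le> \<eta>" if "i < K" for i
  proof -
    have "L i dvd N" unfolding N_def using that by (intro dvd_prodI) auto
    then obtain k where k: "N = L i * k" by blast
    then have "0 < k" using N by simp
    have "(\<Sum>j<N. c' (i * N + j)) = (\<Sum>j<N. y i j)" by (intro sum.cong refl) (simp add: c')
    then show ?thesis using L(3)[OF \<open>0 < k\<close>, of i] k by simp
  qed
  moreover have "c' m \<in> D" for m using L(2) by (simp add: c'_def)
  moreover have "r \<le> norm (c i - c' (i * N + j))" if "j < N" for i j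
    using L(2)[of i j] c'[OF that] by simp
  ultimately show ?thesis using N by (intro exI[of _ N] conjI exI[of _ c'] allI impI) auto
qed

lemma not_dentable_not_radon_nikodym:
  fixes D :: "'a::banach set"
  assumes D: "D \<noteq> {}" "D \<subseteq> cball 0 1" "\<And>x. x \<in> D \<Longrightarrow> x \<in> closure (convex hull {y\<in>D. r \<le> norm (x - y)})"
    and r: "0 < r"
  shows "\<not> radon_nikodym_property TYPE('a)"
proof -
  obtain x0 where x0: "x0 \<in> D" using D(1) by blast
  \<comment> \<open>The points lie in \<open>D\<close> for all indices, also beyond
    \<open>K\<close>, as the bound in \<open>bush\<close> is required there too.\<close>
  define P where "P = (\<lambda>(n::nat) (K::nat, c :: nat \<Rightarrow> 'a). 0 < K \<and> (\<forall>i. c i \<in> D))"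
  define R where "R = (\<lambda>n (K::nat, c :: nat \<Rightarrow> 'a) (K', c'). \<exists>N>0. K' = K * N \<and>
    (\<forall>i<K. norm (c i - (\<Sum>j<N. c' (i * N + j)) /\<^sub>R real N) \<le> r / 16 * (1 / 2) ^ n) \<and>
    (\<forall>i<K. \<forall>j<N. r \<le> norm (c i - c' (i * N + j))))"
  have "\<exists>f. \<forall>n. P n (f n) \<and> R n (f n) (f (Suc n))"
  proof (rule dependent_nat_choice)
    show "\<exists>x. P 0 x" using x0 by (intro exI[of _ "(1, \<lambda>i. x0)"]) (simp add: P_def)
    fix x n assume "P n x"
    obtain K c where x: "x = (K, c)" by (cases x)
    have c: "\<And>i. c i \<in> D" and K: "0 < K" using \<open>P n x\<close> by (auto simp: P_def x)
    have \<eta>: "0 < r / 16 * (1 / 2) ^ n" using r by simp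
    have "\<exists>N>0. \<exists>c'. (\<forall>i. c' i \<in> D) \<and>
        (\<forall>i<K. norm (c i - (\<Sum>j<N. c' (i * N + j)) /\<^sub>R real N) \<le> r / 16 * (1 / 2) ^ n) \<and>
        (\<forall>i<K. \<forall>j<N. r \<le> norm (c i - c' (i * N + j)))"
      by (rule bush_step[OF _ c \<eta>]) (rule D(3))
    then obtain N c' where "0 < N" "\<forall>i. c' i \<in> D"
      "\<forall>i<K. norm (c i - (\<Sum>j<N. c' (i * N + j)) /\<^sub>R real N) \<le> r / 16 * (1 / 2) ^ n"
      "\<forall>i<K. \<forall>j<N. r \<le> norm (c i - c' (i * N + j))" by (elim exE conjE)
    then show "\<exists>y. P (Suc n) y \<and> R n x y"
      using K by (intro exI[of _ "(K * N, c')"]) (auto simp: P_def R_def x)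
  qed
  then obtain f where f: "\<And>n. P n (f n)" "\<And>n. R n (f n) (f (Suc n))" by blast
  define K c where "K n = fst (f n)" and "c n = snd (f n)" for n
  have "\<forall>n. \<exists>N>0. K (Suc n) = K n * N \<and>
    (\<forall>i<K n. norm (c n i - (\<Sum>j<N. c (Suc n) (i * N + j)) /\<^sub>R real N) \<le> r / 16 * (1 / 2) ^ n) \<and>
    (\<forall>i<K n. \<forall>j<N. r \<le> norm (c n i - c (Suc n) (i * N + j)))"
    using f(2) by (auto simp: R_def K_def c_def case_prod_unfold)
  then obtain N where N: "\<And>n. 0 < N n" "\<And>n. K (Suc n) = K n * N n"
    "\<And>n. \<forall>i<K n. norm (c n i - (\<Sum>j<N n. c (Suc n) (i * N n + j)) /\<^sub>R real (N n)) \<le> r / 16 * (1 / 2) ^ n"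
    "\<And>n. \<forall>i<K n. \<forall>j<N n. r \<le> norm (c n i - c (Suc n) (i * N n + j))" by metis
  have cD: "c n i \<in> D" and K0: "0 < K n" for n i
    using f(1)[of n] by (auto simp: P_def K_def c_def case_prod_unfold)
  interpret bush K N c r
  proof
    show "norm (c n i) \<le> 1" for n i using cD[of n i] D(2) by auto
  qed (use N K0 r in auto)
  show ?thesis by (rule not_radon_nikodym)
qed

text \<open>In a thick set \<open>D\<close> every point \<open>x\<close> lies in the closed convex
  hull of the points of \<open>D\<close> far from it: a functional separating \<open>x\<close> from
  them would give a slice of \<open>D\<close> around \<open>x\<close> without far points.\<close>

lemma radon_nikodym_forces:
  fixes v :: "'a::banach"
  assumes rn: "radon_nikodym_property TYPE('a)" and v: "norm v \<le> 1" and \<epsilon>: "0 < \<epsilon>"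
  shows "forces v \<epsilon> dual_ball"
proof (rule ccontr)
  assume "\<not> ?thesis"
  then obtain D :: "'a set" where D: "D \<noteq> {}" "closed D" "convex D" "D \<subseteq> cball 0 1"
    "thick (\<epsilon> / 2) D"
    by (rule not_forces_thick_set[OF _ v \<epsilon>])
  \<comment> \<open>Two points at distance \<open>\<epsilon> / 2\<close> cannot both be closer than
    this to \<open>x\<close>.\<close>
  define r where "r = \<epsilon> / 4"
  have r: "0 < r" using \<epsilon> by (simp add: r_def)
  have far: "\<exists>y\<in>U \<inter> D. r \<le> norm (x - y)" if U: "weakly_open U" "x \<in> U \<inter> D" for U x
  proof (rule ccontr)
    assume neg: "\<not> ?thesis"
    obtain a b where ab: "a \<in> U \<inter> D" "b \<in> U \<inter> D" "\<epsilon> / 2 \<le> norm (a - b)" using D(5) U unfolding thick_def by blast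
    have "norm (x - a) < r" "norm (x - b) < r" using neg ab by force+
    then show False using ab(3) norm_triangle_ineq4[of "x - b" "x - a"] by (simp add: r_def)
  qed
  have "x \<in> closure (convex hull {y\<in>D. r \<le> norm (x - y)})" if x: "x \<in> D" for x
  proof (rule ccontr)
    let ?C = "{y\<in>D. r \<le> norm (x - y)}"
    assume "x \<notin> closure (convex hull ?C)"
    then obtain d where d: "d > 0" "\<And>c. c \<in> convex hull ?C \<Longrightarrow> d \<le> norm (x - c)"
      unfolding closure_approachable by (auto simp: dist_norm norm_minus_commute not_less)
    have "?C \<noteq> {}" using far[OF weakly_open_UNIV] x by auto
    then obtain g where g: "g \<in> dual_ball" "\<And>c. c \<in> convex hull ?C \<Longrightarrow> d \<le> g (x - c)"
      by (rule dual_ball_separation_point[OF convex_convex_hull, of ?C d x, unfolded convex_hull_eq_empty])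
        (use d in auto)
    have "weakly_open {y. g (x - y) < d}"
      by (rule weakly_open_slice_diff(2)[OF dual_ball_bounded_linear[OF g(1)]])
    moreover have "g (x - x) < d" using linear_0[OF dual_ball_linear[OF g(1)]] d(1) by simp
    ultimately obtain y where "y \<in> D" "g (x - y) < d" "r \<le> norm (x - y)" using far x by blast
    then show False using g(2)[OF hull_inc[of y ?C convex]] by simp
  qed
  then show False using not_dentable_not_radon_nikodym[OF D(1,4) _ r] rn by blast
qed

section \<open>Lipschitz maps\<close>

context normed_space_over
begin

text \<open>The segment from \<open>p\<close> to \<open>q\<close> is replaced by a polygonal path whose edges point in directions of a
  set \<open>Y\<close> on which \<open>h\<close> nearly attains its norm; on some edge \<open>h \<circ> T\<close> increases nearly as fast as possible.\<close>

lemma lipschitz_steep_edge: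
  assumes n1: "numerical_index_one smul"
    and fo: "\<forall>v::'a. \<forall>\<epsilon>>0. norm v \<le> 1 \<longrightarrow> forces v \<epsilon> dual_ball"
    and T: "\<And>x y. norm (T x - T y) \<le> norm (x - y)"
    and e: "0 < e" "e < 1" and pq: "p \<noteq> q" "(1 - e) * norm (q - p) < norm (T q - T p)"
  obtains h a s y \<theta> where "h \<in> dual_ball" "0 < s" "norm (y :: 'a) \<le> 1" "norm \<theta> = 1"
    "1 - e < h (smul \<theta> y)" "(1 - 3 * e) * s \<le> h (T (a + s *\<^sub>R y) - T a)"
proof -
  define r where "r = norm (q - p)"
  have r: "0 < r" using pq(1) by (simp add: r_def)
  define v where "v = (q - p) /\<^sub>R r"
  have v: "norm v \<le> 1" using r by (simp add: v_def r_def)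
  have "0 \<le> (1 - e) * norm (q - p)" using e by (intro mult_nonneg_nonneg) auto
  then have nT: "0 < norm (T q - T p)" using pq(2) by linarith
  define u where "u = (T q - T p) /\<^sub>R norm (T q - T p)"
  have u: "norm u = 1" using nT by (simp add: u_def)
  obtain h Y y0 where h: "h \<in> dual_ball" "1 - e < h u" and Y: "finite Y" "Y \<subseteq> cball 0 1"
    "\<And>y. y \<in> Y \<Longrightarrow> \<exists>\<theta>. norm \<theta> = 1 \<and> 1 - e < h (smul \<theta> y)"
    and y0: "y0 \<in> convex hull Y" "norm (v - y0) < e"
    using forces_lush[OF n1 e(1) fo[rule_format, OF e(1) v] u] by metis
  have lh: "linear h" using h(1) by (rule dual_ball_linear)
  obtain w where w: "\<forall>y\<in>Y. 0 \<le> w y" "sum w Y = 1" "(\<Sum>y\<in>Y. w y *\<^sub>R y) = y0"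
    using y0(1) unfolding convex_hull_finite[OF Y(1)] by blast
  \<comment> \<open>From \<open>p\<close> to \<open>q\<close> the value of
    \<open>h \<circ> T\<close> grows by more than \<open>(1 - e) * (1 - e) * r\<close>, hence by
    more than \<open>(1 - 2 * e) * r\<close>. The gap between the end of the path and
    \<open>q\<close> costs \<open>e * r\<close>, which leaves the rate \<open>1 - 3 * e\<close> for
    the edges.\<close>
  have "\<exists>a s. \<exists>y\<in>Y. 0 < s \<and> (1 - 3 * e) * s \<le> h (T (a + s *\<^sub>R y) - T a)"
  proof (rule ccontr)
    assume neg: "\<not> ?thesis"
    have path: "h (T (a + r *\<^sub>R (\<Sum>y\<in>F. w y *\<^sub>R y)) - T a) \<le> (1 - 3 * e) * (r * sum w F)"
      if "F \<subseteq> Y" for F a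
      using finite_subset[OF that Y(1)] that
    proof (induction F arbitrary: a)
      case empty
      then show ?case using linear_0[OF lh] by simp
    next
      case (insert y F)
      let ?s = "r * w y"
      have "h (T (a + ?s *\<^sub>R y) - T a) \<le> (1 - 3 * e) * ?s"
      proof (cases "w y = 0")
        case True
        then show ?thesis using linear_0[OF lh] by simp
      next
        case False
        then have "0 < ?s" using w(1) insert.prems r by (simp add: less_le)
        then have "\<not> (1 - 3 * e) * ?s \<le> h (T (a + ?s *\<^sub>R y) - T a)"
          using neg insert.prems by blast
        then show ?thesis by simp
      qed
      moreover have "h (T (a + ?s *\<^sub>R y + r *\<^sub>R (\<Sum>y\<in>F. w y *\<^sub>R y)) - T (a + ?s *\<^sub>R y)) \<le>
          (1 - 3 * e) * (r * sum w F)"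
        using insert.IH insert.prems by blast
      moreover have "a + r *\<^sub>R (\<Sum>y\<in>insert y F. w y *\<^sub>R y) = a + ?s *\<^sub>R y + r *\<^sub>R (\<Sum>y\<in>F. w y *\<^sub>R y)"
        using insert.hyps by (simp add: scaleR_add_right add.assoc)
      moreover have "sum w (insert y F) = w y + sum w F" using insert.hyps by simp
      ultimately show ?case
        by (simp add: linear_diff[OF lh] algebra_simps)
    qed
    have 1: "h (T (p + r *\<^sub>R y0) - T p) \<le> (1 - 3 * e) * r"
      using path[OF subset_refl, of p] w(2,3) by simp
    have "q - (p + r *\<^sub>R y0) = r *\<^sub>R (v - y0)" using r by (simp add: v_def scaleR_diff_right)
    then have "norm (q - (p + r *\<^sub>R y0)) = r * norm (v - y0)" using r by simp
    then have "norm (T q - T (p + r *\<^sub>R y0)) \<le> r * norm (v - y0)"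
      using T[of q "p + r *\<^sub>R y0"] by simp
    also have "\<dots> < r * e" using y0(2) r by simp
    finally have 2: "h (T q - T (p + r *\<^sub>R y0)) < r * e"
      using dual_ball_le[OF h(1), of "T q - T (p + r *\<^sub>R y0)"] by linarith
    have "h u = h (T q - T p) / norm (T q - T p)"
      by (simp add: u_def linear_scale[OF lh] divide_inverse mult.commute)
    then have "h (T q - T p) = norm (T q - T p) * h u" using nT by simp
    moreover have "((1 - e) * r) * (1 - e) < norm (T q - T p) * h u"
      using pq(2) h(2) e r nT unfolding r_def[symmetric] by (intro mult_strict_mono) auto
    ultimately have 3: "((1 - e) * r) * (1 - e) < h (T q - T p)" by simp
    have "((1 - e) * r) * (1 - e) = r - 2 * (e * r) + e * e * r" by (simp add: algebra_simps)
    moreover have "0 \<le> e * e * r" using e r by simp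
    moreover have "h (T q - T p) = h (T q - T (p + r *\<^sub>R y0)) + h (T (p + r *\<^sub>R y0) - T p)"
      by (simp add: linear_diff[OF lh])
    moreover have "(1 - 3 * e) * r = r - 3 * (e * r)" by (simp add: algebra_simps)
    ultimately show False using 1 2 3 by (simp add: mult.commute)
  qed
  then obtain a s y where y: "y \<in> Y" "0 < s" "(1 - 3 * e) * s \<le> h (T (a + s *\<^sub>R y) - T a)" by blast
  obtain \<theta> where "norm \<theta> = 1" "1 - e < h (smul \<theta> y)" using Y(3)[OF y(1)] by blast
  then show ?thesis using that h(1) y Y(2) by auto
qed

text \<open>Moving the direction \<open>z\<close> of a steep edge to \<open>z + t *\<^sub>R w\<close>, where \<open>w\<close> is the difference quotient of
  \<open>T\<close>, provides an exact support functional, which is large at \<open>w\<close> by convexity of the norm along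
  the ray.\<close>

lemma lip_numerical_range_large:
  assumes n1: "numerical_index_one smul"
    and fo: "\<forall>v::'a. \<forall>\<epsilon>>0. norm v \<le> 1 \<longrightarrow> forces v \<epsilon> dual_ball"
    and T: "\<And>x y. norm (T x - T y) \<le> norm (x - y)"
    and t: "0 < t" "t \<le> 1 / 6" and pq: "p \<noteq> q" "(1 - t\<^sup>2) * norm (q - p) < norm (T q - T p)"
  shows "\<exists>c\<in>lip_numerical_range smul T. 1 - 6 * t \<le> norm c"
proof -
  \<comment> \<open>The edge is steep up to order \<open>t\<^sup>2\<close>, because this error is
    going to be divided by the displacement \<open>t\<close>.\<close>
  have tt: "t\<^sup>2 \<le> t / 6" using t by (simp add: power2_eq_square)
  have e: "0 < t\<^sup>2" "t\<^sup>2 < 1" using t tt by auto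
  obtain h a s y \<theta> where h: "h \<in> dual_ball" and s: "0 < s" and y: "norm (y :: 'a) \<le> 1" and \<theta>: "norm \<theta> = 1"
    and hy: "1 - t\<^sup>2 < h (smul \<theta> y)" and hT: "(1 - 3 * t\<^sup>2) * s \<le> h (T (a + s *\<^sub>R y) - T a)"
    using lipschitz_steep_edge[OF n1 fo T e pq] by metis
  have lh: "linear h" using h by (rule dual_ball_linear)
  define z where "z = smul \<theta> y"
  define w where "w = (T (a + s *\<^sub>R y) - T a) /\<^sub>R s"
  define z' where "z' = z + t *\<^sub>R w"
  have z: "norm z \<le> 1" using y \<theta> by (simp add: z_def norm_scale)
  have w: "norm w \<le> 1"
  proof -
    have "norm (T (a + s *\<^sub>R y) - T a) \<le> norm (s *\<^sub>R y)" using T[of "a + s *\<^sub>R y" a] by simp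
    also have "\<dots> \<le> s" using s y by (simp add: mult_left_le)
    finally have "norm (T (a + s *\<^sub>R y) - T a) \<le> s" .
    moreover have "norm w = norm (T (a + s *\<^sub>R y) - T a) / s" using s by (simp add: w_def divide_inverse mult.commute)
    ultimately show ?thesis using s by simp
  qed
  have Tw: "T (a + s *\<^sub>R y) - T a = s *\<^sub>R w" using s by (simp add: w_def)
  have "(1 - 3 * t\<^sup>2) * s \<le> s * h w" using hT unfolding Tw linear_scale[OF lh] by simp
  then have hw: "1 - 3 * t\<^sup>2 \<le> h w" using s by (simp add: mult.commute)
  have "h z' = h z + t * h w" by (simp add: z'_def linear_add[OF lh] linear_scale[OF lh])
  moreover have "t * (1 - 3 * t\<^sup>2) \<le> t * h w" using hw t by (intro mult_left_mono) auto
  ultimately have nz: "1 - t\<^sup>2 + t * (1 - 3 * t\<^sup>2) < norm z'"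
    using hy dual_ball_le[OF h, of z'] by (simp add: z_def)
  have "0 \<le> t * (1 - 3 * t\<^sup>2)" using t tt by (intro mult_nonneg_nonneg) auto
  then have nz0: "0 < norm z'" using nz e(2) by linarith
  have nz1: "norm z' \<le> 1 + t"
  proof -
    have "norm z' \<le> norm z + t * norm w" using norm_triangle_ineq[of z "t *\<^sub>R w"] t by (simp add: z'_def)
    also have "\<dots> \<le> 1 + t" using z w t by (intro add_mono) (auto simp: mult_left_le)
    finally show ?thesis .
  qed
  obtain g where g: "g \<in> dual_ball" "g z' = norm z'" by (rule support_functional)
  have lg: "linear g" using g(1) by (rule dual_ball_linear)
  have "norm z' = g z + t * g w" using g(2) by (simp add: z'_def linear_add[OF lg] linear_scale[OF lg])
  moreover have "g z \<le> 1" using dual_ball_le[OF g(1), of z] z by linarith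
  ultimately have "t * (1 - 3 * t\<^sup>2 - t) \<le> t * g w" using nz by (simp add: algebra_simps power2_eq_square)
  then have gw: "1 - 3 * t\<^sup>2 - t \<le> g w" using t by simp
  have \<theta>0: "\<theta> \<noteq> 0" using \<theta> by auto
  \<comment> \<open>The rotation is undone: \<open>y'\<close> is the direction of the perturbed
    edge, and it stays within \<open>t\<close> of \<open>y\<close>.\<close>
  define y' where "y' = smul (1 / \<theta>) z'"
  have \<theta>y': "smul \<theta> y' = z'" using \<theta>0 by (simp add: y'_def)
  have "y' - y = smul (1 / \<theta>) (t *\<^sub>R w)"
    using \<theta>0 by (simp add: y'_def z'_def z_def scale_right_distrib)
  then have yy: "norm (y' - y) \<le> t" using \<theta> w t by (simp add: norm_scale norm_divide mult_left_le)
  define x where "x = a + s *\<^sub>R y'"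
  define \<rho> where "\<rho> = s * norm z'"
  have \<rho>: "0 < \<rho>" using s nz0 by (simp add: \<rho>_def)
  have "norm y' = norm z'" using \<theta> by (simp add: y'_def norm_scale norm_divide)
  then have nx: "norm (x - a) = \<rho>" using s by (simp add: x_def \<rho>_def)
  have gT: "s * (1 - 3 * t\<^sup>2 - 2 * t) \<le> g (T x - T a)"
  proof -
    have "norm (T (a + s *\<^sub>R y) - T x) \<le> norm (s *\<^sub>R (y - y'))"
      using T[of "a + s *\<^sub>R y" x] by (simp add: x_def scaleR_diff_right)
    also have "\<dots> \<le> s * t" using yy s by (simp add: norm_minus_commute)
    finally have "g (T (a + s *\<^sub>R y) - T x) \<le> s * t"
      using dual_ball_le[OF g(1), of "T (a + s *\<^sub>R y) - T x"] by linarith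
    moreover have "g (T (a + s *\<^sub>R y) - T a) = s * g w" unfolding Tw by (simp add: linear_scale[OF lg])
    moreover have "s * (1 - 3 * t\<^sup>2 - t) \<le> s * g w" using gw s by (intro mult_left_mono) auto
    ultimately show ?thesis by (simp add: linear_diff[OF lg] algebra_simps)
  qed
  obtain F where F: "F \<in> dual smul" "\<And>x. re (F x) = g x" "\<And>x. norm (F x) \<le> norm x"
    using dual_of_dual_ball[OF g(1)] by blast
  \<comment> \<open>The numerical range asks for \<open>onorm f = norm (x - a)\<close>, whence the
    factor \<open>\<rho>\<close>. The factor \<open>\<theta>\<close> turns the edge into a multiple
    of \<open>z'\<close>, where \<open>F\<close> attains its norm.\<close>
  define f where "f x = of_real \<rho> * (\<theta> * F x)" for x
  have nf: "norm (f x) = \<rho> * norm (F x)" for x using \<rho> \<theta> by (simp add: f_def norm_mult)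
  have fd: "f \<in> dual smul"
  proof (rule dualI)
    show "norm (f x) \<le> \<rho> * norm x" for x using F(3)[of x] \<rho> by (simp add: nf)
  qed (simp_all add: f_def dual_add[OF F(1)] dual_smul[OF F(1)] algebra_simps)
  have "\<theta> * F (x - a) = F (smul \<theta> (x - a))" by (simp add: dual_smul[OF F(1)])
  also have "smul \<theta> (x - a) = s *\<^sub>R z'" by (simp add: x_def smul_scaleR \<theta>y')
  finally have "f (x - a) = \<rho> *\<^sub>R F (s *\<^sub>R z')" by (simp add: f_def scaleR_conv_of_real)
  then have ref: "re (f (x - a)) = \<rho> * \<rho>"
    by (simp add: re_scaleR F(2) linear_scale[OF lg] g(2) \<rho>_def)
  have onf: "onorm f = \<rho>"
  proof (rule antisym)
    show "onorm f \<le> \<rho>" using F(3) \<rho> by (intro onorm_bound) (auto simp: nf)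
    have "\<rho> * \<rho> \<le> onorm f * \<rho>"
      using dual_norm_le[OF fd, of "x - a"] re_le[of "f (x - a)"] ref nx by simp
    then show "\<rho> \<le> onorm f" using \<rho> by simp
  qed
  define c where "c = f (T x - T a) / of_real ((norm (x - a))\<^sup>2)"
  have "c \<in> lip_numerical_range smul T"
    unfolding lip_numerical_range_def c_def
    by (intro CollectI exI[of _ x] exI[of _ a] exI[of _ f] conjI refl fd)
       (use \<rho> nx ref onf in \<open>auto simp: power2_eq_square\<close>)
  moreover have "1 - 6 * t \<le> norm c"
  proof -
    \<comment> \<open>The constant 6 absorbs the division by \<open>norm z'\<close>, which is at
      most \<open>1 + t\<close>; \<open>t \<le> 1 / 6\<close> keeps \<open>1 - 6 * t\<close>
      nonnegative.\<close>
    have "(1 - 6 * t) * norm z' \<le> (1 - 6 * t) * (1 + t)"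
      using nz1 t by (intro mult_left_mono) auto
    also have "\<dots> \<le> 1 - 3 * t\<^sup>2 - 2 * t" using t by (simp add: algebra_simps power2_eq_square)
    finally have "s * ((1 - 6 * t) * norm z') \<le> s * (1 - 3 * t\<^sup>2 - 2 * t)" using s by (intro mult_left_mono) auto
    also have "\<dots> \<le> norm (F (T x - T a))" using gT re_le[of "F (T x - T a)"] by (simp add: F(2))
    finally have "(1 - 6 * t) * \<rho> \<le> norm (F (T x - T a))" by (simp add: \<rho>_def algebra_simps)
    moreover have "norm c = norm (F (T x - T a)) / \<rho>"
      using \<rho> by (simp add: c_def norm_divide norm_mult nf nx power2_eq_square)
    ultimately show ?thesis using \<rho> by (simp add: pos_le_divide_eq)
  qed
  ultimately show ?thesis by blast
qed

text \<open>The supremum in the Lipschitz norm need not be attained, but a pair of points that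
  attains it up to \<open>t\<^sup>2\<close> suffices for each \<open>t\<close>. The upper bound is
  immediate from the normalisation of the functionals.\<close>

lemma lip_numerical_radius_eq_one:
  assumes n1: "numerical_index_one smul"
    and fo: "\<forall>v::'a. \<forall>\<epsilon>>0. norm v \<le> 1 \<longrightarrow> forces v \<epsilon> dual_ball"
    and ne: "\<exists>x::'a. x \<noteq> 0" and T: "T \<in> Lip" "lip_norm T = 1"
  shows "lip_numerical_radius smul T = 1"
proof -
  let ?S = "{norm (T x - T y) / norm (x - y) | x y. x \<noteq> y}"
  obtain L where L: "L-lipschitz_on UNIV T" using T(1) by (auto simp: Lip_def)
  have bdd: "bdd_above ?S"
  proof (rule bdd_aboveI)
    fix r assume "r \<in> ?S"
    then obtain x y where "r = norm (T x - T y) / norm (x - y)" "x \<noteq> y" by blast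
    then show "r \<le> L" using lipschitz_onD[OF L, of x y] by (simp add: dist_norm pos_divide_le_eq)
  qed
  have neS: "?S \<noteq> {}" using ne by blast
  have contr: "norm (T x - T y) \<le> norm (x - y)" for x y
  proof (cases "x = y")
    case False
    then have "norm (T x - T y) / norm (x - y) \<le> Sup ?S" by (intro cSup_upper bdd) blast
    then show ?thesis using False T(2) by (simp add: lip_norm_def pos_divide_le_eq)
  qed simp
  have large: "\<exists>c\<in>lip_numerical_range smul T. 1 - 6 * t \<le> norm c" if t: "0 < t" "t \<le> 1 / 6" for t
  proof -
    have "1 - t\<^sup>2 < Sup ?S" using T(2) t by (simp add: lip_norm_def)
    then obtain q p where "q \<noteq> p" "1 - t\<^sup>2 < norm (T q - T p) / norm (q - p)"
      using less_cSup_iff[OF neS bdd] by blast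
    then show ?thesis
      by (intro lip_numerical_range_large[OF n1 fo contr t, of p q]) (auto simp: pos_less_divide_eq)
  qed
  have up: "norm c \<le> 1" if c: "c \<in> lip_numerical_range smul T" for c
  proof -
    obtain x y f where xyf: "c = f (T x - T y) / of_real ((norm (x - y))\<^sup>2)" "x \<noteq> y" "f \<in> dual smul"
      "onorm f * norm (x - y) = (norm (x - y))\<^sup>2"
      using c unfolding lip_numerical_range_def by blast
    have "0 \<le> onorm f" using onorm_pos_le[OF dual_bounded_linear[OF xyf(3)]] .
    then have "norm (f (T x - T y)) \<le> onorm f * norm (x - y)"
      using dual_norm_le[OF xyf(3), of "T x - T y"] mult_left_mono[OF contr[of x y], of "onorm f"] by linarith
    then show ?thesis using xyf(1,2,4) by (simp add: norm_divide pos_divide_le_eq norm_power)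
  qed
  have bddR: "bdd_above (norm ` lip_numerical_range smul T)" by (rule bdd_aboveI2) (rule up)
  show ?thesis
  proof (rule antisym)
    show "lip_numerical_radius smul T \<le> 1"
      unfolding lip_numerical_radius_def
      by (rule cSUP_least[OF _ up]) (use large[of "1 / 6"] in auto)
    show "1 \<le> lip_numerical_radius smul T"
    proof (rule field_le_epsilon)
      fix e :: real assume "0 < e"
      define t where "t = min (1 / 6) (e / 6)"
      have t: "0 < t" "t \<le> 1 / 6" "6 * t \<le> e" using \<open>0 < e\<close> by (auto simp: t_def min_def)
      obtain c where c: "c \<in> lip_numerical_range smul T" "1 - 6 * t \<le> norm c" using large[OF t(1,2)] by blast
      have "norm c \<le> lip_numerical_radius smul T"
        unfolding lip_numerical_radius_def by (rule cSUP_upper[OF c(1) bddR])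
      then show "1 \<le> lip_numerical_radius smul T + e" using c(2) t(3) by linarith
    qed
  qed
qed

end

lemma lip_norm_ident:
  assumes "\<exists>x::'a::real_normed_vector. x \<noteq> 0"
  shows "lip_norm (\<lambda>x::'a. x) = 1"
proof -
  have "{norm (x - y) / norm (x - y) | x y :: 'a. x \<noteq> y} = {1}" using assms by auto
  then show ?thesis by (simp add: lip_norm_def)
qed

theorem corollary3p13:
  fixes smul :: "'k::real_or_complex \<Rightarrow> 'a::banach \<Rightarrow> 'a"
  assumes "normed_space_over smul"
    and "\<exists>x::'a. x \<noteq> 0"
    and "numerical_index_one smul"
    and "radon_nikodym_property TYPE('a) \<or> asplund_space TYPE('a) \<or>
         \<not> contains_ell1 smul \<or> convex_point_of_continuity_property smul"
  shows "lip_numerical_index smul = 1"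
proof -
  interpret normed_space_over smul by fact
  have "forces v \<epsilon> dual_ball" if "norm v \<le> 1" "0 < \<epsilon>" for v :: 'a and \<epsilon>
    using assms(4) radon_nikodym_forces[OF _ that] asplund_forces[OF _ that]
      no_ell1_forces[OF assms(1) _ that] cpcp_forces[OF _ that] by blast
  then have fo: "\<forall>v::'a. \<forall>\<epsilon>>0. norm v \<le> 1 \<longrightarrow> forces v \<epsilon> dual_ball" by simp
  \<comment> \<open>The identity shows that the infimum is not taken over the empty set.\<close>
  have "1-lipschitz_on UNIV (\<lambda>x::'a. x)" by (rule lipschitz_onI) auto
  then have "(\<lambda>x::'a. x) \<in> {T. T \<in> Lip \<and> lip_norm T = 1}"
    using lip_norm_ident[OF assms(2)] by (auto simp: Lip_def)
  then have "lip_numerical_radius smul ` {T. T \<in> Lip \<and> lip_norm T = 1} \<noteq> {}" by blast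
  moreover have "lip_numerical_radius smul ` {T. T \<in> Lip \<and> lip_norm T = 1} \<subseteq> {1}"
    using lip_numerical_radius_eq_one[OF assms(3) fo assms(2)] by auto
  ultimately have "lip_numerical_radius smul ` {T. T \<in> Lip \<and> lip_norm T = 1} = {1}"
    by (metis subset_singletonD)
  then show ?thesis by (simp add: lip_numerical_index_def)
qed

end
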